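(* Let $(X,D)$ be a toric pair of dimension $d-1\ge1$ over an algebraically closed field $K$ of characteristic $p>0$. Then, for $\lambda\ge0$, $$HKd(X,kD)(\lambda+1)=\frac{e_0(X,D)\,k^{d-1}}{(d-1)!}\,\varphi_{kD}(\lambda)+O(k^{d-2}),$$ where, for each integer $k\ge1$, $\varphi_{kD}:[0,\infty)\to[0,1]$ is the compactly supported continuous function given by $$\varphi_{kD}(\lambda)=\mathrm{Vol}_{d-1}\Big(\big[W_v\times\{z=\lambda+1\}\big]\setminus\bigcup_{u\in\mathbb{Z}^{d-1}}\big[(u,1)+C_{kD}\big]\Big),$$ for any $v\in\mathbb{Z}^{d-1}$.
   Context: Toric pair: Let $T$ be a torus with cocharacter lattice $N\cong\mathbb{Z}^{d-1}$ and character lattice $M=\mathrm{Hom}(N,\mathbb{Z})$, identified with $\mathbb{Z}^{d-1}$, so $M_{\mathbb{R}}=\mathbb{R}^{d-1}$. A toric pair $(X,D)$ consists of a projective toric variety $X$ of dimension $d-1\ge1$ over $K$, given by a complete fan in $N_{\mathbb{R}}$ whose rays have primitive generators $v_1,\dots,v_n$, and a very ample $T$-Cartier divisor $D=\sum_i a_iD_i$ on $X$ ($a_i\in\mathbb{Z}$, $D_i$ the $T$-invariant prime divisor corresponding to $v_i$). Its associated lattice polytope is $P_D=\{u\in M_{\mathbb{R}}\mid \langle u,v_i\rangle\ge -a_i \text{ for all } i\}$; one has $P_{kD}=kP_D$ for integers $k\ge1$. Homogeneous coordinate ring: if $P_D\cap M=\{u_1,\dots,u_r\}$ and $S\subset M\times\mathbb{Z}$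 is the semigroup generated by $(u_1,1),\dots,(u_r,1)$, the homogeneous coordinate ring of $(X,D)$ is $R=K[S]=K[\chi^{(u_1,1)},\dots,\chi^{(u_r,1)}]$, a standard graded ring of dimension $d$ with $\deg\chi^{(u_i,1)}=1$ and graded maximal ideal $\mathbf{m}$. $e_0(X,D)$ denotes the Hilbert-Samuel multiplicity $e_0(R,\mathbf{m})$. Hilbert-Kunz density function: $$HKd(X,D)(\lambda)=\lim_{n\to\infty}\frac{1}{q^{d-1}}\,\ell\big((R/\mathbf{m}^{[q]})_{\lfloor q\lambda\rfloor}\big),\qquad q=p^n,\ \lambda\ge0,$$ where $\mathbf{m}^{[q]}$ is the ideal generated by $q$-th powers of elements of $\mathbf{m}$ (the limit is known to exist). $HKd(X,kD)$ is the same for the toric pair $(X,kD)$. $C_{kD}\subset\mathbb{R}^{d}$ is the convex cone (with apex the origin) spanned by $P_{kD}\times\{1\}\subset\mathbb{R}^{d-1}\times\mathbb{R}$, and $(u,1)+C_{kD}$ is its translate with apex $(u,1)$. $W_v=v+[0,1]^{d-1}\subset\mathbb{R}^{d-1}$ is the unit cell at $v\in\mathbb{Z}^{d-1}$. The last coordinate of $\mathbb{R}^d$ is $z$; $W_v\times\{z=\mu\}=\{(x,\mu)\mid x\in W_v\}$, and $\mathrm{Vol}_{d-1}$ is $(d-1)$-dimensional Lebesgue volume in the hyperplane $\{z=\mu\}$. *)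

theory Defs
  imports
    "HOL-Analysis.Analysis"
    "HOL-Library.Poly_Mapping"
    "HOL-Computational_Algebra.Polynomial"
    "HOL-Algebra.Ideal_Product"
begin

text \<open>
  Throughout, \<open>d - 1 = CARD('n)\<close>, both lattices \<open>N\<close> and \<open>M\<close> are \<open>int ^ 'n\<close>, and
  \<open>N\<^sub>\<real>\<close>, \<open>M\<^sub>\<real>\<close> are \<open>real ^ 'n\<close> with the standard pairing.
\<close>

definition rvec :: "int ^ 'n \<Rightarrow> real ^ 'n"
  where "rvec v = (\<chi> i. real_of_int (v $ i))"

definition pairing :: "int ^ 'n::finite \<Rightarrow> int ^ 'n \<Rightarrow> int"
  where "pairing u v = (\<Sum>i\<in>UNIV. u $ i * v $ i)"


section \<open>Complete fans and torus-invariant divisors\<close>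

definition rational_polyhedral_cone :: "(real ^ 'n::finite) set \<Rightarrow> bool"
  where "rational_polyhedral_cone \<sigma> \<longleftrightarrow>
    (\<exists>B :: (int ^ 'n) set. finite B \<and> \<sigma> = convex_cone hull (rvec ` B))"

definition strongly_convex_cone :: "(real ^ 'n::finite) set \<Rightarrow> bool"
  where "strongly_convex_cone \<sigma> \<longleftrightarrow> (\<forall>x. x \<in> \<sigma> \<and> - x \<in> \<sigma> \<longrightarrow> x = 0)"

text \<open>
  The library relation \<open>face_of\<close> also admits the empty face, which is not a cone.
\<close>

definition is_fan :: "(real ^ 'n::finite) set set \<Rightarrow> bool"
  where "is_fan \<Delta> \<longleftrightarrow>
    finite \<Delta> \<and>
    (\<forall>\<sigma>\<in>\<Delta>. rational_polyhedral_cone \<sigma> \<and> strongly_convex_cone \<sigma>) \<and>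
    (\<forall>\<sigma>\<in>\<Delta>. \<forall>\<tau>. \<tau> face_of \<sigma> \<and> \<tau> \<noteq> {} \<longrightarrow> \<tau> \<in> \<Delta>) \<and>
    (\<forall>\<sigma>\<in>\<Delta>. \<forall>\<tau>\<in>\<Delta>. (\<sigma> \<inter> \<tau>) face_of \<sigma> \<and> (\<sigma> \<inter> \<tau>) face_of \<tau>)"

definition complete_fan :: "(real ^ 'n::finite) set set \<Rightarrow> bool"
  where "complete_fan \<Delta> \<longleftrightarrow> is_fan \<Delta> \<and> \<Union>\<Delta> = UNIV"

definition ray_generators :: "(real ^ 'n::finite) set set \<Rightarrow> (int ^ 'n) set"
  where "ray_generators \<Delta> =
    {v. Gcd (range (\<lambda>i. v $ i)) = 1 \<and> convex_cone hull {rvec v} \<in> \<Delta>}"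

text \<open>
  A \<open>T\<close>-invariant Weil divisor \<open>\<Sum>\<^sub>i a\<^sub>i D\<^sub>i\<close> is given by its coefficient function \<open>a\<close>, of which
  only the values on \<open>ray_generators\<close> matter.  Since
  \<open>div (\<chi>\<^sup>m) = \<Sum>\<^sub>i \<langle>m, v\<^sub>i\<rangle> D\<^sub>i\<close>, the condition below says that the divisor has the local equation
  \<open>\<chi>\<^sup>-\<^sup>m\<close> on \<open>U\<^sub>\<sigma>\<close>.
\<close>

definition local_datum ::
  "(real ^ 'n::finite) set set \<Rightarrow> (int ^ 'n \<Rightarrow> int) \<Rightarrow> (real ^ 'n) set \<Rightarrow> int ^ 'n \<Rightarrow> bool"
  where "local_datum \<Delta> a \<sigma> m \<longleftrightarrow>
    (\<forall>v\<in>ray_generators \<Delta>. rvec v \<in> \<sigma> \<longrightarrow> pairing m v = - a v)"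

definition T_Cartier :: "(real ^ 'n::finite) set set \<Rightarrow> (int ^ 'n \<Rightarrow> int) \<Rightarrow> bool"
  where "T_Cartier \<Delta> a \<longleftrightarrow> (\<forall>\<sigma>\<in>\<Delta>. \<exists>m. local_datum \<Delta> a \<sigma> m)"

definition multiple :: "nat \<Rightarrow> ('a \<Rightarrow> int) \<Rightarrow> 'a \<Rightarrow> int"
  where "multiple k a = (\<lambda>v. int k * a v)"

definition polytope_of ::
  "(real ^ 'n::finite) set set \<Rightarrow> (int ^ 'n \<Rightarrow> int) \<Rightarrow> (real ^ 'n) set"
  where "polytope_of \<Delta> a = {u. \<forall>v\<in>ray_generators \<Delta>. u \<bullet> rvec v \<ge> - real_of_int (a v)}"

definition lattice_points ::
  "(real ^ 'n::finite) set set \<Rightarrow> (int ^ 'n \<Rightarrow> int) \<Rightarrow> (int ^ 'n) set"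
  where "lattice_points \<Delta> a = {u. rvec u \<in> polytope_of \<Delta> a}"


section \<open>The toric variety over a field\<close>

text \<open>
  \<open>K\<close> is algebraically closed where these notions are used, so varieties are rendered
  classically: a set of (closed) points with its Zariski topology and, for every open set, the
  \<open>K\<close>-valued functions that are regular on it.
\<close>

definition dual_monoid :: "(real ^ 'n::finite) set \<Rightarrow> (int ^ 'n) set"
  where "dual_monoid \<sigma> = {u. \<forall>x\<in>\<sigma>. rvec u \<bullet> x \<ge> 0}"

definition perp_lattice :: "(real ^ 'n::finite) set \<Rightarrow> (int ^ 'n) set"
  where "perp_lattice \<sigma> = {u. \<forall>x\<in>\<sigma>. rvec u \<bullet> x = 0}"

text \<open>
  A point of the affine chart \<open>U\<^sub>\<sigma> = Spec K[\<sigma>\<^sup>\<or> \<inter> M]\<close> is a monoid homomorphism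
  \<open>\<sigma>\<^sup>\<or> \<inter> M \<rightarrow> (K, \<cdot>)\<close>; its support is \<open>\<tau>\<^sup>\<bottom> \<inter> \<sigma>\<^sup>\<or> \<inter> M\<close> for a unique face \<open>\<tau>\<close> of \<open>\<sigma>\<close>, and it extends
  uniquely to a group homomorphism \<open>\<tau>\<^sup>\<bottom> \<inter> M \<rightarrow> K\<^sup>\<times>\<close>.  The charts are glued along the charts of common
  faces, and the pair \<open>(\<tau>, \<gamma>)\<close> does not depend on the chart.  So the points of \<open>X\<close> are the pairs
  \<open>(\<tau>, \<gamma>)\<close> with \<open>\<tau>\<close> in the fan and \<open>\<gamma>\<close> such a homomorphism, extended by zero to \<open>M\<close>; \<open>(\<tau>, \<gamma>)\<close>
  lies on \<open>U\<^sub>\<sigma>\<close> iff \<open>\<tau> \<subseteq> \<sigma>\<close>, and then \<open>\<chi>\<^sup>u\<close> takes the value \<open>\<gamma> u\<close> there for every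
  \<open>u \<in> \<sigma>\<^sup>\<or> \<inter> M\<close>.
\<close>

type_synonym ('n, 'k) toric_point = "(real ^ 'n) set \<times> (int ^ 'n \<Rightarrow> 'k)"

definition toric_points ::
  "(real ^ 'n::finite) set set \<Rightarrow> ('n, 'k::field) toric_point set"
  where "toric_points \<Delta> = {(\<tau>, \<gamma>). \<tau> \<in> \<Delta> \<and> \<gamma> 0 = 1 \<and>
    (\<forall>u\<in>perp_lattice \<tau>. \<forall>w\<in>perp_lattice \<tau>. \<gamma> (u + w) = \<gamma> u * \<gamma> w) \<and>
    (\<forall>u. u \<notin> perp_lattice \<tau> \<longrightarrow> \<gamma> u = 0)}"

definition chart ::
  "(real ^ 'n::finite) set set \<Rightarrow> (real ^ 'n) set \<Rightarrow> ('n, 'k::field) toric_point set"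
  where "chart \<Delta> \<sigma> = {x \<in> toric_points \<Delta>. fst x \<subseteq> \<sigma>}"

definition chart_functions :: "(real ^ 'n::finite) set \<Rightarrow> (int ^ 'n \<Rightarrow>\<^sub>0 'k::field) set"
  where "chart_functions \<sigma> = {f. Poly_Mapping.keys f \<subseteq> dual_monoid \<sigma>}"

definition chart_eval ::
  "(int ^ 'n \<Rightarrow>\<^sub>0 'k::field) \<Rightarrow> ('n::finite, 'k) toric_point \<Rightarrow> 'k"
  where "chart_eval f x = (\<Sum>u\<in>Poly_Mapping.keys f. Poly_Mapping.lookup f u * snd x u)"

definition toric_topology ::
  "(real ^ 'n::finite) set set \<Rightarrow> ('n, 'k::field) toric_point topology"
  where "toric_topology \<Delta> = topology_generated_by
    {{x \<in> chart \<Delta> \<sigma>. chart_eval f x \<noteq> 0} | \<sigma> f. \<sigma> \<in> \<Delta> \<and> f \<in> chart_functions \<sigma>}"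

text \<open>
  \<open>f\<close> is locally a quotient \<open>g / h\<close> with \<open>g, h \<in> K[\<sigma>\<^sup>\<or> \<inter> M]\<close>; the neighbourhood of \<open>x\<close> is the part of
  \<open>W \<inter> U\<^sub>\<sigma>\<close> where \<open>h\<close> does not vanish.
\<close>

definition toric_regular ::
  "(real ^ 'n::finite) set set \<Rightarrow> ('n, 'k::field) toric_point set
    \<Rightarrow> (('n, 'k) toric_point \<Rightarrow> 'k) \<Rightarrow> bool"
  where "toric_regular \<Delta> W f \<longleftrightarrow>
    (\<forall>x\<in>W. \<exists>\<sigma>\<in>\<Delta>. \<exists>g\<in>chart_functions \<sigma>. \<exists>h\<in>chart_functions \<sigma>.
      x \<in> chart \<Delta> \<sigma> \<and> chart_eval h x \<noteq> 0 \<and>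
      (\<forall>y\<in>W \<inter> chart \<Delta> \<sigma>. chart_eval h y \<noteq> 0 \<longrightarrow> f y = chart_eval g y / chart_eval h y))"


section \<open>Projective space and very ampleness\<close>

text \<open>
  The projective space with homogeneous coordinates indexed by a finite set \<open>A\<close>.  Coordinate
  vectors are functions vanishing off \<open>A\<close>, a point is the set of nonzero multiples of a nonzero
  vector, and polynomials in the coordinates are elements of \<open>('i \<Rightarrow>\<^sub>0 nat) \<Rightarrow>\<^sub>0 'k\<close>.
\<close>

definition proj_class :: "('i \<Rightarrow> 'k::field) \<Rightarrow> ('i \<Rightarrow> 'k) set"
  where "proj_class y = {(\<lambda>u. c * y u) | c. c \<noteq> 0}"

definition proj_space :: "'i set \<Rightarrow> ('i \<Rightarrow> 'k::field) set set"
  where "proj_space A = {proj_class y | y. (\<forall>u. u \<notin> A \<longrightarrow> y u = 0) \<and> (\<exists>u. y u \<noteq> 0)}"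

definition homogeneous_poly :: "'i set \<Rightarrow> nat \<Rightarrow> (('i \<Rightarrow>\<^sub>0 nat) \<Rightarrow>\<^sub>0 'k::field) \<Rightarrow> bool"
  where "homogeneous_poly A e F \<longleftrightarrow>
    (\<forall>\<mu>\<in>Poly_Mapping.keys F. Poly_Mapping.keys \<mu> \<subseteq> A \<and>
      (\<Sum>u\<in>Poly_Mapping.keys \<mu>. Poly_Mapping.lookup \<mu> u) = e)"

definition poly_eval :: "(('i \<Rightarrow>\<^sub>0 nat) \<Rightarrow>\<^sub>0 'k::field) \<Rightarrow> ('i \<Rightarrow> 'k) \<Rightarrow> 'k"
  where "poly_eval F y = (\<Sum>\<mu>\<in>Poly_Mapping.keys F.
    Poly_Mapping.lookup F \<mu> * (\<Prod>u\<in>Poly_Mapping.keys \<mu>. y u ^ Poly_Mapping.lookup \<mu> u))"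

definition proj_topology :: "'i set \<Rightarrow> ('i \<Rightarrow> 'k::field) set topology"
  where "proj_topology A = topology_generated_by
    {{L \<in> proj_space A. \<forall>y\<in>L. poly_eval F y \<noteq> 0} | F e. homogeneous_poly A e F}"

definition proj_regular ::
  "'i set \<Rightarrow> ('i \<Rightarrow> 'k::field) set set \<Rightarrow> (('i \<Rightarrow> 'k) set \<Rightarrow> 'k) \<Rightarrow> bool"
  where "proj_regular A V f \<longleftrightarrow>
    (\<forall>L\<in>V. \<exists>e F G. homogeneous_poly A e F \<and> homogeneous_poly A e G \<and>
      (\<forall>y\<in>L. poly_eval G y \<noteq> 0) \<and>
      (\<forall>L'\<in>V. \<forall>y\<in>L'. poly_eval G y \<noteq> 0 \<longrightarrow> f L' = poly_eval F y / poly_eval G y))"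

text \<open>
  Closed embedding of varieties: a homeomorphism onto a closed subset that is an isomorphism for
  the reduced structure on the image, i.e. regular functions pull back to regular functions and
  every regular function is locally a pull-back.
\<close>

definition closed_embedding ::
  "'a topology \<Rightarrow> ('a set \<Rightarrow> ('a \<Rightarrow> 'k) \<Rightarrow> bool) \<Rightarrow> 'b topology \<Rightarrow> ('b set \<Rightarrow> ('b \<Rightarrow> 'k) \<Rightarrow> bool)
    \<Rightarrow> ('a \<Rightarrow> 'b) \<Rightarrow> bool"
  where "closed_embedding X regX Y regY \<phi> \<longleftrightarrow>
    embedding_map X Y \<phi> \<and> closedin Y (\<phi> ` topspace X) \<and>
    (\<forall>V g. openin Y V \<and> regY V g \<longrightarrow> regX {x \<in> topspace X. \<phi> x \<in> V} (g \<circ> \<phi>)) \<and>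
    (\<forall>W f x. openin X W \<and> regX W f \<and> x \<in> W \<longrightarrow>
      (\<exists>V g. openin Y V \<and> \<phi> x \<in> V \<and> regY V g \<and> (\<forall>y\<in>W. \<phi> y \<in> V \<longrightarrow> f y = g (\<phi> y))))"

text \<open>
  \<open>H\<^sup>0(X, O(D))\<close> has the basis \<open>\<chi>\<^sup>u\<close>, \<open>u \<in> P\<^sub>D \<inter> M\<close>.  At a point \<open>(\<tau>, \<gamma>)\<close>, where \<open>O(D)\<close> is generated by
  \<open>\<chi>\<^sup>m\<close> for a local datum \<open>m\<close> of \<open>\<tau>\<close>, these sections have the values \<open>\<gamma> (u - m)\<close>; another
  choice of \<open>m\<close> rescales all of them by the same unit.
\<close>

definition section_map ::
  "(real ^ 'n::finite) set set \<Rightarrow> (int ^ 'n \<Rightarrow> int) \<Rightarrow> ('n, 'k::field) toric_point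
    \<Rightarrow> (int ^ 'n \<Rightarrow> 'k) set"
  where "section_map \<Delta> a x = proj_class
    (\<lambda>u. if u \<in> lattice_points \<Delta> a then snd x (u - (SOME m. local_datum \<Delta> a (fst x) m)) else 0)"

text \<open>
  At a base point \<open>section_map\<close> is the class of the zero vector, which is not in \<open>proj_space\<close>, so
  base point freeness is part of the closed embedding property.
\<close>

definition very_ample ::
  "'k::field itself \<Rightarrow> (real ^ 'n::finite) set set \<Rightarrow> (int ^ 'n \<Rightarrow> int) \<Rightarrow> bool"
  where "very_ample K \<Delta> a \<longleftrightarrow>
    closed_embedding (toric_topology \<Delta>) (toric_regular \<Delta>)
      (proj_topology (lattice_points \<Delta> a)) (proj_regular (lattice_points \<Delta> a))
      (section_map \<Delta> a :: ('n, 'k) toric_point \<Rightarrow> (int ^ 'n \<Rightarrow> 'k) set)"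

text \<open>The embedding in \<open>very_ample\<close> also gives the projectivity of \<open>X\<close>.\<close>

definition toric_pair ::
  "'k::field itself \<Rightarrow> (real ^ 'n::finite) set set \<Rightarrow> (int ^ 'n \<Rightarrow> int) \<Rightarrow> bool"
  where "toric_pair K \<Delta> a \<longleftrightarrow> complete_fan \<Delta> \<and> T_Cartier \<Delta> a \<and> very_ample K \<Delta> a"


section \<open>The homogeneous coordinate ring\<close>

inductive_set coord_semigroup ::
  "(real ^ 'n::finite) set set \<Rightarrow> (int ^ 'n \<Rightarrow> int) \<Rightarrow> ((int ^ 'n) \<times> int) set" for \<Delta> a where
  zero: "0 \<in> coord_semigroup \<Delta> a"
| add: "s \<in> coord_semigroup \<Delta> a \<Longrightarrow> u \<in> lattice_points \<Delta> a \<Longrightarrow> s + (u, 1) \<in> coord_semigroup \<Delta> a"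

definition coord_ring ::
  "(real ^ 'n::finite) set set \<Rightarrow> (int ^ 'n \<Rightarrow> int) \<Rightarrow> ((int ^ 'n) \<times> int \<Rightarrow>\<^sub>0 'k::field) ring"
  where "coord_ring \<Delta> a =
    \<lparr>carrier = {f. Poly_Mapping.keys f \<subseteq> coord_semigroup \<Delta> a}, mult = (*), one = 1, zero = 0, add = (+)\<rparr>"

definition graded_piece ::
  "((int ^ 'n::finite) \<times> int \<Rightarrow>\<^sub>0 'k::field) ring \<Rightarrow> int \<Rightarrow> ((int ^ 'n) \<times> int \<Rightarrow>\<^sub>0 'k) set"
  where "graded_piece R j = {f \<in> carrier R. \<forall>s\<in>Poly_Mapping.keys f. snd s = j}"

definition graded_max_ideal ::
  "((int ^ 'n::finite) \<times> int \<Rightarrow>\<^sub>0 'k::field) ring \<Rightarrow> ((int ^ 'n) \<times> int \<Rightarrow>\<^sub>0 'k) set"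
  where "graded_max_ideal R = {f \<in> carrier R. \<forall>s\<in>Poly_Mapping.keys f. snd s > 0}"


section \<open>Multiplicity and Hilbert-Kunz density function\<close>

text \<open>
  Length of \<open>B / A\<close>, the supremum of the lengths of strict chains of submodules from \<open>A\<close> to \<open>B\<close>,
  where \<open>is_sub\<close> singles out the submodules.  It is only used for quotients of finite length.
\<close>

definition quotient_length :: "('a set \<Rightarrow> bool) \<Rightarrow> 'a set \<Rightarrow> 'a set \<Rightarrow> nat"
  where "quotient_length is_sub A B = Sup {n. \<exists>c :: nat \<Rightarrow> 'a set.
    c 0 = A \<and> c n = B \<and> (\<forall>i\<le>n. is_sub (c i)) \<and> (\<forall>i<n. c i \<subset> c (Suc i))}"

definition multiplicity_of :: "nat \<Rightarrow> 'a ring \<Rightarrow> 'a set \<Rightarrow> real"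
  where "multiplicity_of d R I = lim (\<lambda>n.
    fact d * real (quotient_length (\<lambda>J. ideal J R) (I [^]\<^bsub>ideals_set R\<^esub> n) (carrier R)) / real n ^ d)"

definition e0 :: "'k::field itself \<Rightarrow> (real ^ 'n::finite) set set \<Rightarrow> (int ^ 'n \<Rightarrow> int) \<Rightarrow> real"
  where "e0 K \<Delta> a = (let R = (coord_ring \<Delta> a :: ((int ^ 'n) \<times> int \<Rightarrow>\<^sub>0 'k) ring)
    in multiplicity_of (CARD('n) + 1) R (graded_max_ideal R))"

definition frobenius_power :: "'a ring \<Rightarrow> 'a set \<Rightarrow> nat \<Rightarrow> 'a set"
  where "frobenius_power R I q = genideal R {x [^]\<^bsub>R\<^esub> q | x. x \<in> I}"

text \<open>
  The degree \<open>j\<close> part of \<open>R / m\<^sup>[\<^sup>q\<^sup>]\<close> is \<open>R\<^sub>j / (m\<^sup>[\<^sup>q\<^sup>] \<inter> R\<^sub>j)\<close>, a module over \<open>R\<^sub>0 = K\<close>; the constants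
  embed as \<open>Poly_Mapping.single 0\<close>.
\<close>

definition HKd ::
  "'k::field itself \<Rightarrow> (real ^ 'n::finite) set set \<Rightarrow> (int ^ 'n \<Rightarrow> int) \<Rightarrow> real \<Rightarrow> real"
  where "HKd K \<Delta> a t =
    (let R = (coord_ring \<Delta> a :: ((int ^ 'n) \<times> int \<Rightarrow>\<^sub>0 'k) ring) in
     lim (\<lambda>n. let q = CHAR('k) ^ n; j = \<lfloor>real q * t\<rfloor> in
       real (quotient_length (module.subspace (\<lambda>c f. Poly_Mapping.single 0 c * f))
         (frobenius_power R (graded_max_ideal R) q \<inter> graded_piece R j) (graded_piece R j))
       / real q ^ CARD('n)))"


section \<open>The cone and the volume function\<close>

definition cone_over ::
  "(real ^ 'n::finite) set set \<Rightarrow> (int ^ 'n \<Rightarrow> int) \<Rightarrow> ((real ^ 'n) \<times> real) set"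
  where "cone_over \<Delta> a = convex_cone hull (polytope_of \<Delta> a \<times> {1})"

definition unit_cell :: "int ^ 'n::finite \<Rightarrow> (real ^ 'n) set"
  where "unit_cell v = (+) (rvec v) ` cbox 0 1"

text \<open>The hyperplane \<open>z = t + 1\<close> is identified with \<open>real ^ 'n\<close> by dropping the last coordinate.\<close>

definition cell_volume ::
  "(real ^ 'n::finite) set set \<Rightarrow> (int ^ 'n \<Rightarrow> int) \<Rightarrow> int ^ 'n \<Rightarrow> real \<Rightarrow> real"
  where "cell_volume \<Delta> a v t = measure lebesgue
    {x. (x, t + 1) \<in> unit_cell v \<times> {t + 1} - (\<Union>u :: int ^ 'n. (+) (rvec u, 1) ` cone_over \<Delta> a)}"

end

theory Submission
  imports Defs
begin

text \<open>
  Write \<open>P\<close> for the polytope of \<open>D\<close>, \<open>C\<close> for the cone over \<open>P \<times> {1}\<close> and \<open>n = d - 1\<close>.  Since the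
  coordinate ring is spanned by monomials and \<open>m\<^sup>[\<^sup>q\<^sup>]\<close> is a monomial ideal, lengths are numbers of points of
  the semigroup \<open>S\<close>.  Very ampleness enters twice: base point freeness makes \<open>P\<close> the convex hull of its
  lattice points, and characters of the torus being regular makes differences of lattice points
  generate \<open>M\<close>.  Hence \<open>S\<close> contains all lattice points of a translate of \<open>C\<close>, so that counts
  converge to volumes: \<open>e\<^sub>0 = n! Vol P\<close>, and \<open>HKd(X, kD)(t + 1)\<close> is the volume of \<open>(k + s) P\<close> with the
  translates \<open>u + s P\<close>, \<open>u \<in> kP \<inter> M\<close>, removed, where \<open>s = kt\<close>.  For \<open>s\<close> large this set
  is empty; for \<open>s\<close> bounded it differs from \<open>kP\<close> with all translates \<open>u + s P\<close>, \<open>u \<in> M\<close>, removed only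
  at bounded distance from the boundary of \<open>kP\<close>, and the latter set is periodic
  with density \<open>\<phi>\<close>.
\<close>


section \<open>Monomial subspaces\<close>

text \<open>The semigroup \<open>S\<close> may miss lattice points of \<open>C\<close>, so the ring
  need not be normal. All missing points lie within bounded distance of the boundary of
  \<open>C\<close>; the defect disappears after rescaling because boundaries of convex sets are null
  sets. Very ampleness of multiples is not revisited: its two combinatorial traces are carried from
  \<open>D\<close> to \<open>kD\<close> directly, and the field enters the rest only through lengths
  that turn out to be independent of it. Passing from \<open>D\<close> to \<open>kD\<close> only
  rescales the last coordinate, since the cone over \<open>kP\<close> at height \<open>z\<close> is
  \<open>C\<close> at height \<open>kz\<close>. In the variable \<open>s = kt\<close> the removed
  translates \<open>u + s P\<close> do not depend on \<open>k\<close>, so one threshold for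
  \<open>s\<close> and one shell width serve all \<open>k\<close> and \<open>t\<close>
  simultaneously. This is the source of uniformity in \<open>t\<close> of the error term, whose
  order is the volume of a shell of fixed width around \<open>kP\<close>.\<close>

definition monomial_span :: "'b set \<Rightarrow> ('b \<Rightarrow>\<^sub>0 'k::zero) set"
  where "monomial_span T = {f. Poly_Mapping.keys f \<subseteq> T}"

lemma monomial_span_iff: "f \<in> monomial_span T \<longleftrightarrow> Poly_Mapping.keys f \<subseteq> T"
  by (simp add: monomial_span_def)

lemma monomial_span_mono_iff:
  "monomial_span T \<subseteq> (monomial_span U :: ('b \<Rightarrow>\<^sub>0 'k::zero_neq_one) set) \<longleftrightarrow> T \<subseteq> U"
proof
  assume *: "monomial_span T \<subseteq> (monomial_span U :: ('b \<Rightarrow>\<^sub>0 'k) set)"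
  show "T \<subseteq> U"
  proof
    fix t assume "t \<in> T"
    then have "(Poly_Mapping.single t 1 :: 'b \<Rightarrow>\<^sub>0 'k) \<in> monomial_span T"
      by (auto simp: monomial_span_iff)
    with * have "(Poly_Mapping.single t 1 :: 'b \<Rightarrow>\<^sub>0 'k) \<in> monomial_span U" by blast
    then show "t \<in> U" by (simp add: monomial_span_iff)
  qed
qed (auto simp: monomial_span_iff)

lemma monomial_span_add:
  "f \<in> monomial_span T \<Longrightarrow> g \<in> monomial_span T \<Longrightarrow> f + g \<in> monomial_span T"
  using Poly_Mapping.keys_add[of f g] by (auto simp: monomial_span_iff)

lemma monomial_span_uminus:
  "f \<in> monomial_span T \<Longrightarrow> - f \<in> monomial_span (T :: 'b set)" for f :: "'b \<Rightarrow>\<^sub>0 'k::ab_group_add"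
  by (simp add: monomial_span_iff)

lemma poly_mapping_sum_single:
  fixes f :: "'b \<Rightarrow>\<^sub>0 'k::comm_monoid_add"
  shows "f = (\<Sum>s\<in>Poly_Mapping.keys f. Poly_Mapping.single s (Poly_Mapping.lookup f s))"
  by (rule poly_mapping_eqI)
     (auto simp: lookup_sum lookup_single when_def in_keys_iff sum.delta)

lemma vector_space_poly_mapping:
  "vector_space (\<lambda>c (f :: 'b::comm_monoid_add \<Rightarrow>\<^sub>0 'k::field). Poly_Mapping.single 0 c * f)"
  by unfold_locales (auto simp: algebra_simps single_add mult_single
      simp flip: mult.assoc)

lemma subspace_monomial_span:
  "module.subspace (\<lambda>c f. Poly_Mapping.single 0 c * f)
     (monomial_span T :: ('b::comm_monoid_add \<Rightarrow>\<^sub>0 'k::field) set)"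
proof -
  interpret vector_space "\<lambda>c (f :: 'b \<Rightarrow>\<^sub>0 'k). Poly_Mapping.single 0 c * f"
    by (rule vector_space_poly_mapping)
  show ?thesis
  proof (rule subspaceI)
    fix c and f :: "'b \<Rightarrow>\<^sub>0 'k"
    assume "f \<in> monomial_span T"
    moreover have "Poly_Mapping.keys (Poly_Mapping.single 0 c * f) \<subseteq> Poly_Mapping.keys f"
      using keys_mult[of "Poly_Mapping.single 0 c" f] by (auto split: if_splits)
    ultimately show "Poly_Mapping.single 0 c * f \<in> monomial_span T"
      by (auto simp: monomial_span_iff)
  qed (auto intro: monomial_span_add, simp add: monomial_span_iff)
qed

lemma sum_single_in_subspace:
  fixes J :: "('b::comm_monoid_add \<Rightarrow>\<^sub>0 'k::field) set"
  assumes J: "module.subspace (\<lambda>c f. Poly_Mapping.single 0 c * f) J"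
    and f: "\<And>s. s \<in> Poly_Mapping.keys f \<Longrightarrow> Poly_Mapping.single s 1 \<in> J"
  shows "f \<in> J"
proof -
  interpret vector_space "\<lambda>c (f :: 'b \<Rightarrow>\<^sub>0 'k). Poly_Mapping.single 0 c * f"
    by (rule vector_space_poly_mapping)
  have "(\<Sum>s\<in>Poly_Mapping.keys f. Poly_Mapping.single 0 (Poly_Mapping.lookup f s) * Poly_Mapping.single s 1) \<in> J"
    by (intro subspace_sum subspace_scale J f)
  then show ?thesis
    using poly_mapping_sum_single[of f] by (simp add: mult_single)
qed

text \<open>\<open>is_sub\<close> stays abstract because the same count serves chains of ideals and
  chains of \<open>K\<close>-subspaces. Submodules are subspaces, so no chain is longer than the
  dimension \<open>card (B - A)\<close>; \<open>step\<close> allows monomials to be added one at a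
  time, which reaches this bound.\<close>

proposition quotient_length_monomial_span:
  fixes A B :: "'b::comm_monoid_add set" and is_sub :: "('b \<Rightarrow>\<^sub>0 'k::field) set \<Rightarrow> bool"
  assumes AB: "A \<subseteq> B" and fin: "finite (B - A)"
    and sub: "\<And>J. is_sub J \<Longrightarrow> module.subspace (\<lambda>c f. Poly_Mapping.single 0 c * f) J"
    and base: "is_sub (monomial_span A)"
    and step: "\<And>T. A \<subseteq> T \<Longrightarrow> T \<subset> B \<Longrightarrow> is_sub (monomial_span T) \<Longrightarrow>
                 \<exists>s\<in>B - T. is_sub (monomial_span (insert s T))"
  shows "quotient_length is_sub (monomial_span A) (monomial_span B) = card (B - A)"
proof -
  interpret vector_space "\<lambda>c (f :: 'b \<Rightarrow>\<^sub>0 'k). Poly_Mapping.single 0 c * f"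
    by (rule vector_space_poly_mapping)
  let ?chain = "\<lambda>n (c :: nat \<Rightarrow> ('b \<Rightarrow>\<^sub>0 'k) set). c 0 = monomial_span A \<and> c n = monomial_span B \<and>
      (\<forall>i\<le>n. is_sub (c i)) \<and> (\<forall>i<n. c i \<subset> c (Suc i))"
  have upper: "n \<le> card (B - A)" if c: "?chain n c" for n c
  proof -
    have mono: "c i \<subseteq> c j" if "i \<le> j" "j \<le> n" for i j
      using that
    proof (induction j rule: dec_induct)
      case (step j)
      then have "c j \<subset> c (Suc j)" using c by simp
      with step show ?case by auto
    qed simp
    have "\<exists>f. f \<in> c (Suc i) \<and> f \<notin> c i \<and> Poly_Mapping.keys f \<subseteq> B - A" if i: "i < n" for i
    proof -
      obtain f where f: "f \<in> c (Suc i)" "f \<notin> c i" using c i by blast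
      \<comment> \<open>The part of \<open>f\<close> supported on \<open>A\<close> lies in every
        member of the chain, so subtracting it preserves both membership and non-membership and
        leaves support in \<open>B - A\<close>.\<close>
      define g :: "'b \<Rightarrow>\<^sub>0 'k"
        where "g = (\<Sum>s\<in>Poly_Mapping.keys f \<inter> A. Poly_Mapping.single s (Poly_Mapping.lookup f s))"
      have g: "Poly_Mapping.lookup g s = (if s \<in> A then Poly_Mapping.lookup f s else 0)" for s
        by (auto simp: g_def lookup_sum lookup_single when_def in_keys_iff sum.delta)
      have "g \<in> monomial_span A" by (auto simp: monomial_span_iff in_keys_iff g split: if_splits)
      then have gi: "g \<in> c i" "g \<in> c (Suc i)" using mono[of 0 i] mono[of 0 "Suc i"] c i by auto
      have "f - g \<in> c (Suc i)"
        using subspace_diff[OF sub] c i f(1) gi by simp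
      moreover have "f - g \<notin> c i"
        using subspace_add[OF sub, of "c i" "f - g" g] c i f(2) gi by auto
      moreover have "f \<in> monomial_span B" using mono[of "Suc i" n] c i f by auto
      then have "Poly_Mapping.keys (f - g) \<subseteq> B - A"
        by (auto simp: monomial_span_iff in_keys_iff lookup_minus g split: if_splits)
      ultimately show ?thesis by blast
    qed
    then obtain F where F: "\<And>i. i < n \<Longrightarrow> F i \<in> c (Suc i) \<and> F i \<notin> c i \<and> Poly_Mapping.keys (F i) \<subseteq> B - A"
      by metis
    \<comment> \<open>Each \<open>F i\<close> lies outside \<open>c i\<close>, which contains the
      span of the earlier choices.\<close>
    have ind: "i \<le> n \<Longrightarrow> independent (F ` {..<i}) \<and> card (F ` {..<i}) = i" for i
    proof (induction i)
      case (Suc i)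
      have "F ` {..<i} \<subseteq> c i"
      proof clarify
        fix j assume "j < i"
        then show "F j \<in> c i" using F[of j] mono[of "Suc j" i] Suc.prems by auto
      qed
      then have "span (F ` {..<i}) \<subseteq> c i"
        using span_minimal[OF _ sub] c Suc.prems by auto
      then have "F i \<notin> span (F ` {..<i})" using F[of i] Suc.prems by auto
      note notin = this
      have notin': "F i \<notin> F ` {..<i}" using notin span_base[of "F i" "F ` {..<i}"] by argo
      show ?case unfolding lessThan_Suc image_insert
        using Suc.IH Suc.prems notin notin' by (simp add: independent_insertI)
    qed (simp add: independent_empty)
    let ?M = "(\<lambda>s. Poly_Mapping.single s (1::'k)) ` (B - A)"
    have "F ` {..<n} \<subseteq> span ?M"
    proof clarify
      fix i assume "i < n"
      then have "Poly_Mapping.keys (F i) \<subseteq> B - A" using F by blast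
      then show "F i \<in> span ?M"
        by - (rule sum_single_in_subspace[OF subspace_span], auto intro: span_base)
    qed
    then have "card (F ` {..<n}) \<le> card ?M"
      using independent_span_bound[of ?M "F ` {..<n}"] ind[of n] fin by blast
    also have "\<dots> \<le> card (B - A)" using fin by (rule card_image_le)
    finally show ?thesis using ind[of n] by simp
  qed
  have finite_diff: "finite (B - T)" if "A \<subseteq> T" for T
    using that fin by (auto intro: finite_subset[of "B - T" "B - A"])
  have lower: "\<exists>c. c 0 = monomial_span T \<and> c (card (B - T)) = monomial_span B \<and>
      (\<forall>i\<le>card (B - T). is_sub (c i)) \<and> (\<forall>i<card (B - T). c i \<subset> c (Suc i))"
    if "A \<subseteq> T" "T \<subseteq> B" "is_sub (monomial_span T)" for T
    using that
  proof (induction "card (B - T)" arbitrary: T)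
    case 0
    then have "T = B" using finite_diff[of T] by auto
    then show ?case using 0 by (intro exI[of _ "\<lambda>_. monomial_span B"]) auto
  next
    case (Suc m)
    from Suc have "T \<subset> B" by auto
    then obtain s where s: "s \<in> B - T" "is_sub (monomial_span (insert s T))"
      using step[of T] Suc.prems by blast
    have "finite (B - T)" using finite_diff Suc.prems by blast
    then have m: "card (B - insert s T) = m" using Suc.hyps(2) s
      by (simp add: Diff_insert[of B s T])
    have "A \<subseteq> insert s T" "insert s T \<subseteq> B" using s Suc.prems by auto
    from Suc.hyps(1)[OF m[symmetric] this s(2)] obtain c where
      c: "c 0 = monomial_span (insert s T) \<and> c m = monomial_span B \<and>
        (\<forall>i\<le>m. is_sub (c i)) \<and> (\<forall>i<m. c i \<subset> c (Suc i))"
      unfolding m ..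
    have "monomial_span T \<subset> (monomial_span (insert s T) :: ('b \<Rightarrow>\<^sub>0 'k) set)"
      using s unfolding less_le_not_le monomial_span_mono_iff by auto
    moreover define c' where "c' i = (case i of 0 \<Rightarrow> monomial_span T | Suc j \<Rightarrow> c j)" for i
    ultimately have "c' i \<subset> c' (Suc i)" if "i < Suc m" for i
      using c that by (cases i) (simp_all add: c'_def)
    moreover have "is_sub (c' i)" if "i \<le> Suc m" for i
      using c that Suc.prems(3) by (cases i) (simp_all add: c'_def)
    moreover have "c' 0 = monomial_span T" "c' (Suc m) = monomial_span B"
      using c by (simp_all add: c'_def)
    ultimately show ?case unfolding Suc.hyps(2)[symmetric] by blast
  qed
  \<comment> \<open>\<open>Sup\<close> on \<open>nat\<close> is meaningful only for bounded sets, so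
    the value is exhibited as an attained maximum.\<close>
  have "Sup {n. \<exists>c. ?chain n c} = card (B - A)"
  proof (rule cSup_eq_maximum)
    show "card (B - A) \<in> {n. \<exists>c. ?chain n c}"
      using lower[OF order_refl AB base] by (rule CollectI)
    fix n assume "n \<in> {n. \<exists>c. ?chain n c}"
    then obtain c where "?chain n c" by (elim CollectE exE)
    then show "n \<le> card (B - A)" by (rule upper)
  qed
  then show ?thesis unfolding quotient_length_def .
qed


section \<open>The homogeneous coordinate ring\<close>

lemma coord_semigroup_add:
  assumes "s \<in> coord_semigroup \<Delta> a" "t \<in> coord_semigroup \<Delta> a"
  shows "s + t \<in> coord_semigroup \<Delta> a"
  using assms(2) by (induction rule: coord_semigroup.induct)
    (use assms(1) coord_semigroup.add[of "s + _"] in \<open>simp_all add: add.assoc[symmetric]\<close>)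

lemma coord_semigroup_generator:
  "u \<in> lattice_points \<Delta> a \<Longrightarrow> (u, 1) \<in> coord_semigroup \<Delta> a"
  using coord_semigroup.add[OF coord_semigroup.zero] by force

lemma coord_semigroup_snd_nonneg: "s \<in> coord_semigroup \<Delta> a \<Longrightarrow> snd s \<ge> 0"
  by (induction rule: coord_semigroup.induct) auto

lemma coord_semigroup_cases_snd:
  assumes "s \<in> coord_semigroup \<Delta> a"
  obtains "s = 0" | u t where "snd s > 0" "u \<in> lattice_points \<Delta> a" "t \<in> coord_semigroup \<Delta> a" "s = t + (u, 1)"
  using assms
proof cases
  case (add t u)
  then show ?thesis using that(2)[of u t] coord_semigroup_snd_nonneg[of t \<Delta> a] by auto
qed (rule that)

lemma coord_ring_simps [simp]:
  "carrier (coord_ring \<Delta> a) = monomial_span (coord_semigroup \<Delta> a)"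
  "mult (coord_ring \<Delta> a) = (*)" "one (coord_ring \<Delta> a) = 1"
  "zero (coord_ring \<Delta> a) = 0" "add (coord_ring \<Delta> a) = (+)"
  by (simp_all add: coord_ring_def monomial_span_def)

lemma monomial_span_mult:
  fixes f g :: "'b::comm_monoid_add \<Rightarrow>\<^sub>0 'k::field"
  assumes "f \<in> monomial_span T" "g \<in> monomial_span U" "\<And>t u. t \<in> T \<Longrightarrow> u \<in> U \<Longrightarrow> t + u \<in> V"
  shows "f * g \<in> monomial_span V"
  using keys_mult[of f g] assms by (fastforce simp: monomial_span_iff)

lemma cring_coord_ring:
  "cring (coord_ring \<Delta> a :: ((int ^ 'n::finite) \<times> int \<Rightarrow>\<^sub>0 'k::field) ring)"
proof (rule cringI)
  show "abelian_group (coord_ring \<Delta> a :: ((int ^ 'n) \<times> int \<Rightarrow>\<^sub>0 'k) ring)"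
  proof (rule abelian_groupI)
    fix x assume "x \<in> carrier (coord_ring \<Delta> a :: ((int ^ 'n) \<times> int \<Rightarrow>\<^sub>0 'k) ring)"
    then show "\<exists>y\<in>carrier (coord_ring \<Delta> a :: ((int ^ 'n) \<times> int \<Rightarrow>\<^sub>0 'k) ring). y \<oplus>\<^bsub>coord_ring \<Delta> a\<^esub> x = \<zero>\<^bsub>coord_ring \<Delta> a\<^esub>"
      by (intro bexI[of _ "- x"]) (simp_all add: monomial_span_uminus)
  qed (simp_all add: monomial_span_add add_ac, simp add: monomial_span_iff)
  show "comm_monoid (coord_ring \<Delta> a :: ((int ^ 'n) \<times> int \<Rightarrow>\<^sub>0 'k) ring)"
    by (rule comm_monoidI)
       (auto simp: mult_ac intro: monomial_span_mult coord_semigroup_add,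
        simp add: monomial_span_iff coord_semigroup.zero)
qed (simp add: algebra_simps)

lemma ideal_monomial_span:
  fixes T :: "((int ^ 'n::finite) \<times> int) set"
  assumes T: "T \<subseteq> coord_semigroup \<Delta> a"
    and add: "\<And>t s. t \<in> T \<Longrightarrow> s \<in> coord_semigroup \<Delta> a \<Longrightarrow> t + s \<in> T"
  shows "ideal (monomial_span T) (coord_ring \<Delta> a :: ((int ^ 'n) \<times> int \<Rightarrow>\<^sub>0 'k::field) ring)"
proof -
  interpret R: cring "coord_ring \<Delta> a :: ((int ^ 'n) \<times> int \<Rightarrow>\<^sub>0 'k) ring"
    by (rule cring_coord_ring)
  show ?thesis
  proof (rule idealI)
    show "subgroup (monomial_span T) (add_monoid (coord_ring \<Delta> a :: ((int ^ 'n) \<times> int \<Rightarrow>\<^sub>0 'k) ring))"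
    proof (rule R.add.subgroupI)
      fix f :: "(int ^ 'n) \<times> int \<Rightarrow>\<^sub>0 'k" assume f: "f \<in> monomial_span T"
      then have "f \<in> carrier (coord_ring \<Delta> a)" using T by (auto simp: monomial_span_iff)
      moreover have "- f \<oplus>\<^bsub>coord_ring \<Delta> a\<^esub> f = \<zero>\<^bsub>coord_ring \<Delta> a\<^esub>" by simp
      ultimately have "\<ominus>\<^bsub>coord_ring \<Delta> a\<^esub> f = - f"
        by (intro R.minus_equality) (auto simp: monomial_span_iff)
      with f show "\<ominus>\<^bsub>coord_ring \<Delta> a\<^esub> f \<in> monomial_span T"
        by (simp add: monomial_span_uminus)
    next
      show "monomial_span T \<noteq> ({} :: ((int ^ 'n) \<times> int \<Rightarrow>\<^sub>0 'k) set)"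
        by (auto simp: monomial_span_def intro: exI[of _ 0])
    qed (use T in \<open>auto simp: monomial_span_iff\<close>, use Poly_Mapping.keys_add in fastforce)
    fix f g :: "(int ^ 'n) \<times> int \<Rightarrow>\<^sub>0 'k"
    assume f: "f \<in> monomial_span T" "g \<in> carrier (coord_ring \<Delta> a)"
    then show "f \<otimes>\<^bsub>coord_ring \<Delta> a\<^esub> g \<in> monomial_span T"
      by (auto intro: monomial_span_mult add)
    then show "g \<otimes>\<^bsub>coord_ring \<Delta> a\<^esub> f \<in> monomial_span T"
      by (simp add: mult.commute)
  qed (rule R.ring_axioms)
qed

lemma ideal_imp_subspace:
  assumes "ideal J (coord_ring \<Delta> a :: ((int ^ 'n::finite) \<times> int \<Rightarrow>\<^sub>0 'k::field) ring)"
  shows "module.subspace (\<lambda>c f. Poly_Mapping.single 0 c * f) J"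
proof -
  interpret vector_space "\<lambda>c (f :: (int ^ 'n) \<times> int \<Rightarrow>\<^sub>0 'k). Poly_Mapping.single 0 c * f"
    by (rule vector_space_poly_mapping)
  interpret J: ideal J "coord_ring \<Delta> a :: ((int ^ 'n) \<times> int \<Rightarrow>\<^sub>0 'k) ring" by fact
  show ?thesis
  proof (rule subspaceI)
    show "0 \<in> J" using additive_subgroup.zero_closed[OF ideal.axioms(1)[OF assms]] by simp
    show "x + y \<in> J" if "x \<in> J" "y \<in> J" for x y
      using additive_subgroup.a_closed[OF ideal.axioms(1)[OF assms] that] by simp
    show "Poly_Mapping.single 0 c * x \<in> J" if "x \<in> J" for c x
      using J.I_l_closed[of x "Poly_Mapping.single 0 c"] that
      by (simp add: monomial_span_iff coord_semigroup.zero)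
  qed
qed

lemma monomial_span_subset_ideal:
  fixes J :: "((int ^ 'n::finite) \<times> int \<Rightarrow>\<^sub>0 'k::field) set"
  assumes "ideal J (coord_ring \<Delta> a)" "\<And>t. t \<in> T \<Longrightarrow> Poly_Mapping.single t 1 \<in> J"
  shows "monomial_span T \<subseteq> J"
proof
  fix f :: "(int ^ 'n) \<times> int \<Rightarrow>\<^sub>0 'k" assume "f \<in> monomial_span T"
  then show "f \<in> J"
    by - (rule sum_single_in_subspace[OF ideal_imp_subspace[OF assms(1)]],
       auto simp: monomial_span_iff intro: assms(2))
qed

section \<open>Powers of the graded maximal ideal and their colengths\<close>

lemma graded_max_ideal_eq:
  "graded_max_ideal (coord_ring \<Delta> a) = monomial_span {s \<in> coord_semigroup \<Delta> a. snd s \<ge> 1}"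
  by (simp add: graded_max_ideal_def monomial_span_def int_one_le_iff_zero_less subset_eq) blast

lemma coord_semigroup_decompose:
  assumes "s \<in> coord_semigroup \<Delta> a" "snd s \<ge> int (Suc N)"
  obtains t u where "t \<in> coord_semigroup \<Delta> a" "snd t \<ge> int N" "u \<in> lattice_points \<Delta> a" "s = t + (u, 1)"
  using assms(1)
proof (cases rule: coord_semigroup_cases_snd)
  case 1
  then show ?thesis using assms by simp
next
  case (2 u t)
  then show ?thesis using assms(2) that[of t u] by simp
qed

text \<open>The ring is standard graded: a monomial of degree at least \<open>N + 1\<close> is one
  of degree at least \<open>N\<close> times a generator. For \<open>N = 0\<close> the unit of
  \<open>ideals_set\<close> is the whole ring, whose degrees are all nonnegative.\<close>

lemma graded_max_ideal_pow:
  "graded_max_ideal (coord_ring \<Delta> a) [^]\<^bsub>ideals_set (coord_ring \<Delta> a)\<^esub> N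
     = (monomial_span {s \<in> coord_semigroup \<Delta> a. snd s \<ge> int N}
         :: ((int ^ 'n::finite) \<times> int \<Rightarrow>\<^sub>0 'k::field) set)"
proof (induction N)
  case 0
  have "{s \<in> coord_semigroup \<Delta> a. snd s \<ge> int 0} = coord_semigroup \<Delta> a"
    using coord_semigroup_snd_nonneg by auto
  then show ?case by (simp add: nat_pow_def ideals_set_def)
next
  case (Suc N)
  let ?R = "coord_ring \<Delta> a :: ((int ^ 'n) \<times> int \<Rightarrow>\<^sub>0 'k) ring"
  let ?T = "\<lambda>N. {s \<in> coord_semigroup \<Delta> a. snd s \<ge> int N}"
  have id: "ideal (monomial_span (?T N)) ?R" for N
    by (rule ideal_monomial_span) (auto intro: coord_semigroup_add dest: coord_semigroup_snd_nonneg)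
  interpret cring ?R by (rule cring_coord_ring)
  have id': "ideal (ideal_prod ?R (monomial_span (?T N)) (monomial_span (?T 1))) ?R"
    by (intro ideal_prod_is_ideal id)
  have "ideal_prod ?R (monomial_span (?T N)) (monomial_span (?T 1)) = monomial_span (?T (Suc N))"
  proof (intro antisym subsetI)
    fix f assume "f \<in> ideal_prod ?R (monomial_span (?T N)) (monomial_span (?T 1))"
    then show "f \<in> monomial_span (?T (Suc N))"
    proof induction
      case (prod f g)
      then show ?case by (auto intro!: monomial_span_mult intro: coord_semigroup_add)
    next
      case (sum f g)
      then show ?case by (auto intro: monomial_span_add)
    qed
  next
    have "monomial_span (?T (Suc N)) \<subseteq> ideal_prod ?R (monomial_span (?T N)) (monomial_span (?T 1))"
    proof (rule monomial_span_subset_ideal[OF id'])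
      fix s assume "s \<in> ?T (Suc N)"
      then obtain t u where tu: "t \<in> coord_semigroup \<Delta> a" "snd t \<ge> int N"
          "u \<in> lattice_points \<Delta> a" "s = t + (u, 1)"
        using coord_semigroup_decompose by blast
      then have "Poly_Mapping.single t (1::'k) \<otimes>\<^bsub>?R\<^esub> Poly_Mapping.single (u, 1) 1
          \<in> ideal_prod ?R (monomial_span (?T N)) (monomial_span (?T 1))"
        by (intro ideal_prod.prod) (auto simp: monomial_span_iff coord_semigroup_generator)
      then show "Poly_Mapping.single s 1 \<in> ideal_prod ?R (monomial_span (?T N)) (monomial_span (?T 1))"
        by (simp add: tu mult_single)
    qed
    then show "f \<in> monomial_span (?T (Suc N)) \<Longrightarrow>
        f \<in> ideal_prod ?R (monomial_span (?T N)) (monomial_span (?T 1))" for f by blast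
  qed
  then show ?case using Suc by (simp add: nat_pow_def ideals_set_def graded_max_ideal_eq)
qed

lemma length_quotient_max_ideal_pow:
  fixes \<Delta> :: "(real ^ 'n::finite) set set" and a :: "int ^ 'n \<Rightarrow> int"
  assumes fin: "finite {s \<in> coord_semigroup \<Delta> a. snd s < int N}"
  defines "R \<equiv> coord_ring \<Delta> a :: ((int ^ 'n) \<times> int \<Rightarrow>\<^sub>0 'k::field) ring"
  shows "quotient_length (\<lambda>J. ideal J R) (graded_max_ideal R [^]\<^bsub>ideals_set R\<^esub> N) (carrier R)
    = card {s \<in> coord_semigroup \<Delta> a. snd s < int N}"
proof -
  let ?S = "coord_semigroup \<Delta> a" and ?T = "{s \<in> coord_semigroup \<Delta> a. snd s \<ge> int N}"
  have diff: "?S - ?T = {s \<in> ?S. snd s < int N}" by auto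
  have "quotient_length (\<lambda>J. ideal J R) (monomial_span ?T) (monomial_span ?S) = card (?S - ?T)"
  proof (rule quotient_length_monomial_span)
    show "ideal (monomial_span ?T) R" unfolding R_def
      by (rule ideal_monomial_span) (auto intro: coord_semigroup_add dest: coord_semigroup_snd_nonneg)
  next
    fix U assume U: "?T \<subseteq> U" "U \<subset> ?S" "ideal (monomial_span U) R"
    interpret U: ideal "monomial_span U" R by fact
    have add: "t + s \<in> U" if "t \<in> U" "s \<in> ?S" for t s
    proof -
      have "Poly_Mapping.single t (1::'k) \<otimes>\<^bsub>R\<^esub> Poly_Mapping.single s 1 \<in> monomial_span U"
        using that by (intro U.I_r_closed) (auto simp: monomial_span_iff R_def)
      then show ?thesis by (simp add: R_def mult_single monomial_span_iff)
    qed
    have "finite (?S - U)" using U diff fin finite_subset[of "?S - U" "?S - ?T"] by auto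
    then have finU: "finite (snd ` (?S - U))" by simp
    \<comment> \<open>A missing monomial of maximal degree is added next: its product with a
      nonconstant monomial has larger degree and so already lies in \<open>U\<close>, which keeps
      the span an ideal.\<close>
    have "Max (snd ` (?S - U)) \<in> snd ` (?S - U)" using U(2) by (intro Max_in finU) auto
    then obtain s where "s \<in> ?S - U" "Max (snd ` (?S - U)) = snd s" by blast
    then have s: "s \<in> ?S - U" "\<And>t. t \<in> ?S - U \<Longrightarrow> snd t \<le> snd s"
      using Max_ge[OF finU] by auto
    have "ideal (monomial_span (insert s U)) R" unfolding R_def
    proof (rule ideal_monomial_span)
      fix t r assume tr: "t \<in> insert s U" "r \<in> ?S"
      show "t + r \<in> insert s U"
      proof (cases "t \<in> U \<or> r = 0")
        case True
        then show ?thesis using add[of t r] tr by (elim disjE) simp_all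
      next
        case False
        have "snd r > 0"
          by (rule coord_semigroup_cases_snd[OF tr(2)]) (use False in auto)
        with tr False s show ?thesis using coord_semigroup_add[of s \<Delta> a r] s(2)[of "s + r"] by auto
      qed
    qed (use U s in auto)
    with s(1) show "\<exists>s\<in>?S - U. ideal (monomial_span (insert s U)) R" by blast
  qed (use fin diff ideal_imp_subspace in \<open>auto simp: R_def\<close>)
  then show ?thesis unfolding R_def graded_max_ideal_pow diff by simp
qed

section \<open>Frobenius powers in positive characteristic\<close>

lemma single_power:
  "Poly_Mapping.single (u :: int ^ 'n, j :: int) (c::'k::field) ^ q
     = Poly_Mapping.single (int q *s u, int q * j) (c ^ q)"
proof (induction q)
  case (Suc q)
  have "int (Suc q) *s u = u + int q *s u" by (simp add: vec_eq_iff algebra_simps)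
  with Suc show ?case by (simp add: mult_single algebra_simps)
qed (simp add: zero_prod_def[symmetric])

text \<open>The freshman's dream is applied in the monoid algebra, whose characteristic has to be
  that of \<open>K\<close>.\<close>

lemma CHAR_poly_mapping: "CHAR('b::comm_monoid_add \<Rightarrow>\<^sub>0 'k::field) = CHAR('k)"
proof (rule CHAR_eqI)
  have *: "of_nat n = (0 :: 'b \<Rightarrow>\<^sub>0 'k) \<longleftrightarrow> of_nat n = (0 :: 'k)" for n
    unfolding single_of_nat[symmetric] by (metis lookup_single_eq single_zero)
  show "of_nat CHAR('k) = (0 :: 'b \<Rightarrow>\<^sub>0 'k)" by (simp add: *)
  show "CHAR('k) dvd n" if "of_nat n = (0 :: 'b \<Rightarrow>\<^sub>0 'k)" for n
    using that by (simp add: * of_nat_eq_0_iff_char_dvd)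
qed

lemma coord_ring_pow:
  "x [^]\<^bsub>coord_ring \<Delta> a\<^esub> (q::nat) = (x :: (int ^ 'n::finite) \<times> int \<Rightarrow>\<^sub>0 'k::field) ^ q"
  by (induction q) (simp_all add: nat_pow_def mult.commute)

lemma coord_semigroup_scale:
  "(u, j) \<in> coord_semigroup \<Delta> a \<Longrightarrow> (int q *s u, int q * j) \<in> coord_semigroup \<Delta> a"
proof (induction q)
  case 0
  then show ?case using coord_semigroup.zero by (simp add: zero_prod_def)
next
  case (Suc q)
  have "(int (Suc q) *s u, int (Suc q) * j) = (int q *s u, int q * j) + (u, j)"
    by (simp add: vec_eq_iff algebra_simps)
  with Suc coord_semigroup_add show ?case by metis
qed

text \<open>The generators are \<open>q\<close>-th powers of arbitrary elements of the maximal
  ideal. As \<open>q\<close> is a power of the characteristic, such a power is the sum of the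
  \<open>q\<close>-th powers of its terms, and splitting one generator off each exponent shows that
  these lie in the monomial ideal.\<close>

lemma frobenius_power_coord_ring:
  fixes \<Delta> :: "(real ^ 'n::finite) set set" and a :: "int ^ 'n \<Rightarrow> int"
  assumes "prime CHAR('k::field)" and q: "q = CHAR('k) ^ e"
  defines "R \<equiv> coord_ring \<Delta> a :: ((int ^ 'n) \<times> int \<Rightarrow>\<^sub>0 'k) ring"
  shows "frobenius_power R (graded_max_ideal R) q = monomial_span
    {s + (int q *s u, int q) | s u. s \<in> coord_semigroup \<Delta> a \<and> u \<in> lattice_points \<Delta> a}"
    (is "_ = monomial_span ?Z")
proof -
  interpret cring R unfolding R_def by (rule cring_coord_ring)
  have scale: "(int q *s u, int q) \<in> coord_semigroup \<Delta> a" if "u \<in> lattice_points \<Delta> a" for u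
    using coord_semigroup_scale[OF coord_semigroup_generator[OF that]] by simp
  have idZ: "ideal (monomial_span ?Z) R" unfolding R_def
  proof (rule ideal_monomial_span)
    show "?Z \<subseteq> coord_semigroup \<Delta> a" using coord_semigroup_add scale by blast
    fix t s assume "t \<in> ?Z" and s: "s \<in> coord_semigroup \<Delta> a"
    then obtain r u where "t = r + (int q *s u, int q)" "r \<in> coord_semigroup \<Delta> a" "u \<in> lattice_points \<Delta> a"
      by blast
    then show "t + s \<in> ?Z" using coord_semigroup_add[of r \<Delta> a s] s
      by (intro CollectI exI[of _ "r + s"] exI[of _ u]) (simp add: algebra_simps)
  qed
  have pow_in: "x ^ q \<in> monomial_span ?Z" if "x \<in> graded_max_ideal R" for x
  proof -
    have x: "Poly_Mapping.keys x \<subseteq> {s \<in> coord_semigroup \<Delta> a. snd s \<ge> 1}"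
      using that by (simp add: R_def graded_max_ideal_eq monomial_span_iff)
    have "x ^ q = (\<Sum>s\<in>Poly_Mapping.keys x. Poly_Mapping.single s (Poly_Mapping.lookup x s)) ^ q"
      using poly_mapping_sum_single[of x] by simp
    also have "\<dots> = (\<Sum>s\<in>Poly_Mapping.keys x. Poly_Mapping.single s (Poly_Mapping.lookup x s) ^ q)"
      by (rule freshmans_dream_sum') (use assms(1) q in \<open>simp_all add: CHAR_poly_mapping\<close>)
    also have "\<dots> \<in> monomial_span ?Z"
    proof -
      interpret vs: vector_space "\<lambda>c (f :: (int ^ 'n) \<times> int \<Rightarrow>\<^sub>0 'k). Poly_Mapping.single 0 c * f"
        by (rule vector_space_poly_mapping)
      show ?thesis
      proof (rule vs.subspace_sum[OF subspace_monomial_span])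
        fix s assume "s \<in> Poly_Mapping.keys x"
        then have "s \<in> coord_semigroup \<Delta> a" "snd s \<ge> int (Suc 0)" using x by auto
        then obtain t u where tu: "t \<in> coord_semigroup \<Delta> a" "u \<in> lattice_points \<Delta> a" "s = t + (u, 1)"
          using coord_semigroup_decompose by metis
        have "(int q *s fst s, int q * snd s) = (int q *s fst t, int q * snd t) + (int q *s u, int q)"
          by (simp add: tu vec_eq_iff algebra_simps)
        moreover have "(int q *s fst t, int q * snd t) \<in> coord_semigroup \<Delta> a"
          using coord_semigroup_scale tu by (metis prod.collapse)
        ultimately have "(int q *s fst s, int q * snd s) \<in> ?Z" using tu by blast
        then show "Poly_Mapping.single s (Poly_Mapping.lookup x s) ^ q \<in> monomial_span ?Z"
          using single_power[of "fst s" "snd s" "Poly_Mapping.lookup x s" q]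
          by (simp add: monomial_span_iff)
      qed
    qed
    finally show ?thesis .
  qed
  let ?G = "{x [^]\<^bsub>R\<^esub> q | x. x \<in> graded_max_ideal R}"
  have G: "?G \<subseteq> monomial_span ?Z" using pow_in by (auto simp: R_def coord_ring_pow)
  also have "\<dots> \<subseteq> carrier R" using idZ by (simp add: ideal.Icarr subsetI)
  finally have G': "?G \<subseteq> carrier R" .
  have "Idl\<^bsub>R\<^esub> ?G \<subseteq> monomial_span ?Z" using idZ G by (rule genideal_minimal)
  moreover have "monomial_span ?Z \<subseteq> Idl\<^bsub>R\<^esub> ?G"
  proof (rule monomial_span_subset_ideal)
    show id: "ideal (Idl\<^bsub>R\<^esub> ?G) (coord_ring \<Delta> a)" using genideal_ideal[OF G'] by (simp add: R_def)
    fix t assume "t \<in> ?Z"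
    then obtain s u where su: "t = s + (int q *s u, int q)" "s \<in> coord_semigroup \<Delta> a" "u \<in> lattice_points \<Delta> a"
      by blast
    have "Poly_Mapping.single (u, 1) (1::'k) \<in> graded_max_ideal R"
      using su by (simp add: R_def graded_max_ideal_eq monomial_span_iff coord_semigroup_generator)
    then have "Poly_Mapping.single (u, 1) (1::'k) [^]\<^bsub>R\<^esub> q \<in> Idl\<^bsub>R\<^esub> ?G"
      using genideal_self[OF G'] by blast
    then have "Poly_Mapping.single (int q *s u, int q) (1::'k) \<in> Idl\<^bsub>R\<^esub> ?G"
      by (simp add: R_def coord_ring_pow single_power)
    then have "Poly_Mapping.single s (1::'k) \<otimes>\<^bsub>coord_ring \<Delta> a\<^esub> Poly_Mapping.single (int q *s u, int q) 1 \<in> Idl\<^bsub>R\<^esub> ?G"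
      using su by (intro ideal.I_l_closed[OF id]) (simp_all add: monomial_span_iff)
    then show "Poly_Mapping.single t 1 \<in> Idl\<^bsub>R\<^esub> ?G" by (simp add: su mult_single)
  qed
  ultimately show ?thesis unfolding frobenius_power_def by blast
qed

lemma graded_piece_eq:
  "graded_piece (coord_ring \<Delta> a) j = monomial_span {s \<in> coord_semigroup \<Delta> a. snd s = j}"
  by (simp add: graded_piece_def monomial_span_def subset_eq) blast

text \<open>Chains of \<open>K\<close>-subspaces admit any missing monomial as the next one, so the
  refinement condition is automatic. Solving for the remaining semigroup element turns membership in
  the Frobenius power into a condition on translates, the discrete model of
  \<open>HK_region\<close>.\<close>

lemma length_frobenius_quotient:
  fixes \<Delta> :: "(real ^ 'n::finite) set set" and a :: "int ^ 'n \<Rightarrow> int"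
  assumes "prime CHAR('k::field)" and "q = CHAR('k) ^ e"
    and fin: "finite {s \<in> coord_semigroup \<Delta> a. snd s = j}"
  defines "R \<equiv> coord_ring \<Delta> a :: ((int ^ 'n) \<times> int \<Rightarrow>\<^sub>0 'k) ring"
  shows "quotient_length (module.subspace (\<lambda>c f. Poly_Mapping.single 0 c * f))
      (frobenius_power R (graded_max_ideal R) q \<inter> graded_piece R j) (graded_piece R j)
    = card {x. (x, j) \<in> coord_semigroup \<Delta> a \<and>
        (\<forall>u\<in>lattice_points \<Delta> a. (x - int q *s u, j - int q) \<notin> coord_semigroup \<Delta> a)}"
proof -
  let ?S = "coord_semigroup \<Delta> a" and ?L = "lattice_points \<Delta> a"
  define Z where "Z = {s + (int q *s u, int q) | s u. s \<in> ?S \<and> u \<in> ?L}"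
  let ?B = "{s \<in> ?S. snd s = j}" and ?A = "Z \<inter> {s \<in> ?S. snd s = j}"
  have eq: "frobenius_power R (graded_max_ideal R) q \<inter> graded_piece R j = monomial_span ?A"
    unfolding R_def frobenius_power_coord_ring[OF assms(1,2)] graded_piece_eq Z_def
    by (auto simp: monomial_span_iff)
  have "quotient_length (module.subspace (\<lambda>c f. Poly_Mapping.single 0 c * f))
      (monomial_span ?A) (monomial_span ?B :: ((int ^ 'n) \<times> int \<Rightarrow>\<^sub>0 'k) set) = card (?B - ?A)"
  proof (rule quotient_length_monomial_span)
    fix T assume "T \<subset> ?B"
    then show "\<exists>s\<in>?B - T. module.subspace (\<lambda>c f. Poly_Mapping.single 0 c * f)
        (monomial_span (insert s T) :: ((int ^ 'n) \<times> int \<Rightarrow>\<^sub>0 'k) set)"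
      by (auto simp: subspace_monomial_span)
  qed (rule Int_lower2, rule finite_subset[OF Diff_subset fin], assumption, rule subspace_monomial_span)
  also have "?B - ?A = (\<lambda>x. (x, j)) ` {x. (x, j) \<in> ?S \<and> (\<forall>u\<in>?L. (x - int q *s u, j - int q) \<notin> ?S)}"
  proof -
    have "(x, i) \<in> Z \<longleftrightarrow> (\<exists>u\<in>?L. (x - int q *s u, i - int q) \<in> ?S)" for x i
    proof
      assume "(x, i) \<in> Z"
      then obtain s u where "(x, i) = s + (int q *s u, int q)" "s \<in> ?S" "u \<in> ?L" unfolding Z_def by blast
      moreover from this have "(x - int q *s u, i - int q) = s" by (cases s) simp
      ultimately show "\<exists>u\<in>?L. (x - int q *s u, i - int q) \<in> ?S" by blast
    next
      assume "\<exists>u\<in>?L. (x - int q *s u, i - int q) \<in> ?S"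
      then obtain u where "u \<in> ?L" "(x - int q *s u, i - int q) \<in> ?S" by blast
      moreover have "(x, i) = (x - int q *s u, i - int q) + (int q *s u, int q)" by simp
      ultimately show "(x, i) \<in> Z" unfolding Z_def by blast
    qed
    then show ?thesis by (auto simp: image_iff)
  qed
  also have "card \<dots> = card {x. (x, j) \<in> ?S \<and> (\<forall>u\<in>?L. (x - int q *s u, j - int q) \<notin> ?S)}"
    by (rule card_image) (auto simp: inj_on_def)
  finally show ?thesis unfolding eq by (simp add: R_def graded_piece_eq)
qed


section \<open>Polytopes of divisors on complete fans\<close>

lemma rvec_simps [simp]:
  "rvec (u + v) = rvec u + rvec v" "rvec (u - v) = rvec u - rvec v" "rvec 0 = 0" "rvec (- u) = - rvec u"
  "rvec (c *s u) = real_of_int c *\<^sub>R rvec u" "rvec u $ i = real_of_int (u $ i)"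
  by (simp_all add: rvec_def vec_eq_iff)

lemma rvec_eq_iff [simp]: "rvec u = rvec v \<longleftrightarrow> u = v"
  by (simp add: rvec_def vec_eq_iff)

lemma inner_rvec: "rvec u \<bullet> rvec v = real_of_int (pairing u v)"
  by (simp add: inner_vec_def pairing_def)

lemma convex_cone_hull_singleton: "convex_cone hull {b} = {c *\<^sub>R b | c. 0 \<le> c}"
  by (subst convex_cone_hull_convex_hull_nonempty) auto

text \<open>A generating subset minimal under inclusion works: minimality keeps each generator
  outside the cone of the others, and pointedness excludes cancellation among those others.\<close>

lemma pointed_cone_extreme_rays:
  fixes B :: "'a::real_vector set"
  assumes B: "finite B"
    and pointed: "\<And>x. x \<in> convex_cone hull B \<Longrightarrow> - x \<in> convex_cone hull B \<Longrightarrow> x = 0"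
  obtains B' where "B' \<subseteq> B" "0 \<notin> B'" "convex_cone hull B' = convex_cone hull B"
    "\<And>b. b \<in> B' \<Longrightarrow> (convex_cone hull {b}) face_of (convex_cone hull B)"
proof -
  define \<S> where "\<S> = {A. A \<subseteq> B \<and> convex_cone hull A = convex_cone hull B}"
  have "finite \<S>" "B \<in> \<S>" using B by (auto simp: \<S>_def)
  then obtain B' where B': "B' \<in> \<S>" "\<And>A. A \<in> \<S> \<Longrightarrow> A \<subseteq> B' \<Longrightarrow> A = B'"
    using finite_has_minimal[of \<S>] by (metis empty_iff)
  have hull: "convex_cone hull B' = convex_cone hull B" and sub: "B' \<subseteq> B"
    using B' by (auto simp: \<S>_def)
  have notin: "b \<notin> convex_cone hull (B' - {b})" if "b \<in> B'" for b
  proof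
    assume b: "b \<in> convex_cone hull (B' - {b})"
    have "B' \<subseteq> convex_cone hull (B' - {b})" using b by (auto intro: hull_inc)
    then have "convex_cone hull B' \<subseteq> convex_cone hull (B' - {b})"
      by (rule hull_minimal) (rule convex_cone_convex_cone_hull)
    moreover have "convex_cone hull (B' - {b}) \<subseteq> convex_cone hull B'" by (rule hull_mono) auto
    ultimately have "B' - {b} \<in> \<S>" using hull sub by (auto simp: \<S>_def)
    then show False using B'(2)[of "B' - {b}"] that by auto
  qed
  have "0 \<notin> B'" using notin[of 0] convex_cone_hull_contains_0 by auto
  moreover have "(convex_cone hull {b}) face_of (convex_cone hull B)" if b: "b \<in> B'" for b
    unfolding face_of_def
  proof (intro conjI ballI impI)
    show "convex_cone hull {b} \<subseteq> convex_cone hull B" using b sub by (intro hull_mono) auto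
    show "convex (convex_cone hull {b})" by (rule convex_convex_cone_hull)
    let ?A = "convex_cone hull (B' - {b})"
    have A_sub: "?A \<subseteq> convex_cone hull B" unfolding hull[symmetric] by (rule hull_mono) auto
    have decomp: "\<exists>x1 \<alpha>. x1 \<in> ?A \<and> 0 \<le> \<alpha> \<and> x = x1 + \<alpha> *\<^sub>R b" if "x \<in> convex_cone hull B" for x
    proof -
      have "x \<in> convex_cone hull ((B' - {b}) \<union> {b})"
        using that b hull by (simp add: insert_absorb)
      then show ?thesis unfolding convex_cone_hull_Un convex_cone_hull_singleton by blast
    qed
    \<comment> \<open>The components away from \<open>b\<close> combine to
      \<open>w = (\<gamma> - \<delta>) b\<close>. A positive factor would make \<open>b\<close>
      redundant; otherwise \<open>w\<close> and \<open>- w\<close> both lie in the cone, so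
      \<open>w = 0\<close>, and pointedness applied to its two summands kills each of them.\<close>
    have *: "x1 = 0 \<and> y1 = 0"
      if "x1 \<in> ?A" "y1 \<in> ?A" "0 \<le> \<alpha>" "0 \<le> \<beta>" "0 < t" "t < 1"
        "(1 - t) *\<^sub>R (x1 + \<alpha> *\<^sub>R b) + t *\<^sub>R (y1 + \<beta> *\<^sub>R b) = \<gamma> *\<^sub>R b" for x1 y1 \<alpha> \<beta> t \<gamma>
    proof -
      define w where "w = (1 - t) *\<^sub>R x1 + t *\<^sub>R y1"
      define \<delta> where "\<delta> = (1 - t) * \<alpha> + t * \<beta>"
      have x1: "(1 - t) *\<^sub>R x1 \<in> ?A" and y1: "t *\<^sub>R y1 \<in> ?A"
        using that by (auto intro: convex_cone_hull_mul)
      then have w: "w \<in> ?A" unfolding w_def by (rule convex_cone_hull_add)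
      have eq: "w = (\<gamma> - \<delta>) *\<^sub>R b" using that(7) by (simp add: w_def \<delta>_def algebra_simps)
      have "\<not> \<gamma> > \<delta>"
      proof
        assume "\<gamma> > \<delta>"
        then have "b = (1 / (\<gamma> - \<delta>)) *\<^sub>R w" by (simp add: eq)
        moreover have "(1 / (\<gamma> - \<delta>)) *\<^sub>R w \<in> ?A"
          using \<open>\<gamma> > \<delta>\<close> by (intro convex_cone_hull_mul w) simp
        ultimately show False using notin[OF b] by simp
      qed
      then have "(\<delta> - \<gamma>) *\<^sub>R b \<in> convex_cone hull B"
        using b sub by (intro convex_cone_hull_mul hull_inc) auto
      moreover have "- w = (\<delta> - \<gamma>) *\<^sub>R b" by (simp add: eq algebra_simps)
      ultimately have "w = 0" using pointed[of w] w A_sub by auto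
      then have neg: "- ((1 - t) *\<^sub>R x1) = t *\<^sub>R y1" by (simp add: w_def eq_neg_iff_add_eq_0 neg_eq_iff_add_eq_0)
      then have "(1 - t) *\<^sub>R x1 = 0" using pointed[of "(1 - t) *\<^sub>R x1"] x1 y1 A_sub by auto
      with neg that(5,6) show ?thesis by auto
    qed
    fix x y z assume "x \<in> convex_cone hull B" "y \<in> convex_cone hull B"
      "z \<in> convex_cone hull {b}" and seg: "z \<in> open_segment x y"
    then obtain x1 \<alpha> y1 \<beta> \<gamma> where xy: "x1 \<in> ?A" "0 \<le> \<alpha>" "x = x1 + \<alpha> *\<^sub>R b"
        "y1 \<in> ?A" "0 \<le> \<beta>" "y = y1 + \<beta> *\<^sub>R b" "z = \<gamma> *\<^sub>R b"
      using decomp unfolding convex_cone_hull_singleton by blast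
    from seg obtain t where "0 < t" "t < 1" "z = (1 - t) *\<^sub>R x + t *\<^sub>R y"
      by (auto simp: in_segment)
    then have "x1 = 0 \<and> y1 = 0" using xy *[of x1 y1 \<alpha> \<beta> t \<gamma>] by auto
    then show "x \<in> convex_cone hull {b}" "y \<in> convex_cone hull {b}"
      using xy unfolding convex_cone_hull_singleton by auto
  qed
  ultimately show thesis using that hull sub by blast
qed

lemma primitive_multiple:
  fixes w :: "int ^ 'n::finite"
  assumes "w \<noteq> 0"
  obtains v g where "g > 0" "w = g *s v" "Gcd (range (\<lambda>i. v $ i)) = 1"
proof -
  define g where "g = Gcd (range (\<lambda>i. w $ i))"
  define v :: "int ^ 'n" where "v = (\<chi> i. w $ i div g)"
  have dvd: "g dvd w $ i" for i unfolding g_def by (rule Gcd_dvd) auto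
  have "g \<noteq> 0" using assms by (auto simp: g_def vec_eq_iff)
  moreover have "g \<ge> 0" by (simp add: g_def)
  ultimately have g: "g > 0" by simp
  have w: "w $ i = g * v $ i" for i using dvd[of i] by (simp add: v_def)
  have "range (\<lambda>i. w $ i) = (*) g ` range (\<lambda>i. v $ i)" unfolding image_image by (simp add: w)
  then have "g = Gcd ((*) g ` range (\<lambda>i. v $ i))" unfolding g_def by (rule arg_cong)
  also have "\<dots> = g * Gcd (range (\<lambda>i. v $ i))" using g by (simp add: Gcd_mult abs_mult)
  finally have "Gcd (range (\<lambda>i. v $ i)) = 1" using g by simp
  moreover have "w = g *s v" using w by (simp add: vec_eq_iff)
  ultimately show thesis using that g by blast
qed

text \<open>Extreme rays of \<open>\<sigma>\<close> are faces, hence members of the fan, and their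
  primitive vectors are ray generators. Linear inequalities on \<open>\<sigma>\<close> can thus be
  tested where the coefficients of the divisor live.\<close>

lemma fan_cone_generated_by_rays:
  assumes "is_fan \<Delta>" "\<sigma> \<in> \<Delta>"
  shows "\<sigma> \<subseteq> convex_cone hull (rvec ` {v \<in> ray_generators \<Delta>. rvec v \<in> \<sigma>})"
proof -
  have fan: "rational_polyhedral_cone \<sigma>" "strongly_convex_cone \<sigma>"
     "\<And>\<tau>. \<tau> face_of \<sigma> \<Longrightarrow> \<tau> \<noteq> {} \<Longrightarrow> \<tau> \<in> \<Delta>"
    using assms by (auto simp: is_fan_def)
  obtain B :: "(int ^ 'a) set" where B: "finite B" "\<sigma> = convex_cone hull (rvec ` B)"
    using fan by (auto simp: rational_polyhedral_cone_def)
  obtain B' where B': "B' \<subseteq> rvec ` B" "0 \<notin> B'" "convex_cone hull B' = \<sigma>"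
     "\<And>b. b \<in> B' \<Longrightarrow> (convex_cone hull {b}) face_of \<sigma>"
    using pointed_cone_extreme_rays[of "rvec ` B"] B fan(2) unfolding strongly_convex_cone_def
    by (metis finite_imageI)
  let ?C = "convex_cone hull (rvec ` {v \<in> ray_generators \<Delta>. rvec v \<in> \<sigma>})"
  have "B' \<subseteq> ?C"
  proof
    fix b assume b: "b \<in> B'"
    then obtain w where w: "b = rvec w" using B' by blast
    then have "w \<noteq> 0" using b B' by auto
    then obtain v g where v: "g > 0" "w = g *s v" "Gcd (range (\<lambda>i. v $ i)) = 1"
      by (rule primitive_multiple)
    have bv: "b = real_of_int g *\<^sub>R rvec v" by (simp add: w v)
    have hull_eq: "convex_cone hull {rvec v} = convex_cone hull {b}"
    proof (intro equalityI hull_minimal convex_cone_convex_cone_hull)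
      have "rvec v = (1 / real_of_int g) *\<^sub>R b" using v by (simp add: bv)
      then show "{rvec v} \<subseteq> convex_cone hull {b}" using v
        by (auto simp: convex_cone_hull_singleton intro!: exI[of _ "1 / real_of_int g"])
      show "{b} \<subseteq> convex_cone hull {rvec v}" using v
        by (auto simp: convex_cone_hull_singleton bv intro!: exI[of _ "real_of_int g"])
    qed
    have face: "(convex_cone hull {rvec v}) face_of \<sigma>" using B'(4)[OF b] by (simp add: hull_eq)
    then have "v \<in> ray_generators \<Delta>"
      using fan(3) v convex_cone_hull_nonempty by (auto simp: ray_generators_def)
    moreover have "rvec v \<in> \<sigma>" using face_of_imp_subset[OF face] by (auto intro: hull_inc)
    ultimately have "rvec v \<in> ?C" by (intro hull_inc) auto
    then show "b \<in> ?C" unfolding bv using v by (intro convex_cone_hull_mul) auto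
  qed
  then show ?thesis unfolding B'(3)[symmetric]
    by (rule hull_minimal) (rule convex_cone_convex_cone_hull)
qed

lemma fan_cone_inner_nonneg:
  assumes "is_fan \<Delta>" "\<sigma> \<in> \<Delta>" "x \<in> \<sigma>"
    and "\<And>v. v \<in> ray_generators \<Delta> \<Longrightarrow> rvec v \<in> \<sigma> \<Longrightarrow> c \<bullet> rvec v \<ge> 0"
  shows "c \<bullet> x \<ge> 0"
proof -
  have "convex_cone {x. c \<bullet> x \<ge> 0}"
    by (auto simp: convex_cone_def conic_def inner_simps convex_halfspace_ge intro!: exI[of _ 0])
  then have "convex_cone hull (rvec ` {v \<in> ray_generators \<Delta>. rvec v \<in> \<sigma>}) \<subseteq> {x. c \<bullet> x \<ge> 0}"
    using assms by (intro hull_minimal) auto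
  then show ?thesis using fan_cone_generated_by_rays[OF assms(1,2)] assms(3) by blast
qed

lemma finite_int_vectors_bounded: "finite {u :: int ^ 'n::finite. \<forall>i. \<bar>u $ i\<bar> \<le> M}"
proof (rule finite_imageD)
  show "finite (($) ` {u :: int ^ 'n. \<forall>i. \<bar>u $ i\<bar> \<le> M})"
    by (rule finite_subset[OF _ finite_PiE[of UNIV "\<lambda>_. {- M..M}"]]) (auto simp: abs_le_iff minus_le_iff)
  show "inj_on (($)) {u :: int ^ 'n. \<forall>i. \<bar>u $ i\<bar> \<le> M}" by (auto simp: inj_on_def vec_eq_iff)
qed

text \<open>Base point freeness in combinatorial form.\<close>

definition support_attained :: "(real ^ 'n::finite) set set \<Rightarrow> (int ^ 'n \<Rightarrow> int) \<Rightarrow> bool"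
  where "support_attained \<Delta> a \<longleftrightarrow> (\<forall>\<tau>\<in>\<Delta>. \<exists>u\<in>lattice_points \<Delta> a. local_datum \<Delta> a \<tau> u)"

text \<open>Completeness puts \<open>x\<close> in some cone \<open>\<tau>\<close>. At a local datum
  \<open>u\<close> of \<open>\<tau>\<close> the inequalities of \<open>P\<close> for the rays of
  \<open>\<tau>\<close> are equalities, so \<open>y - u\<close> is nonnegative on these rays and
  hence on \<open>\<tau>\<close>.\<close>

lemma support_attained_min:
  assumes "complete_fan \<Delta>" "support_attained \<Delta> a"
  shows "\<exists>u\<in>lattice_points \<Delta> a. \<forall>y\<in>polytope_of \<Delta> a. rvec u \<bullet> x \<le> y \<bullet> x"
proof -
  have fan: "is_fan \<Delta>" using assms by (simp add: complete_fan_def)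
  have "x \<in> \<Union>\<Delta>" using assms by (simp add: complete_fan_def)
  then obtain \<tau> where \<tau>: "\<tau> \<in> \<Delta>" "x \<in> \<tau>" by blast
  then obtain u where u: "u \<in> lattice_points \<Delta> a" "local_datum \<Delta> a \<tau> u"
    using assms by (auto simp: support_attained_def)
  have "rvec u \<bullet> x \<le> y \<bullet> x" if y: "y \<in> polytope_of \<Delta> a" for y
  proof -
    have "(y - rvec u) \<bullet> x \<ge> 0"
    proof (rule fan_cone_inner_nonneg[OF fan \<tau>])
      fix v assume v: "v \<in> ray_generators \<Delta>" "rvec v \<in> \<tau>"
      then have "rvec u \<bullet> rvec v = - real_of_int (a v)"
        using u by (simp add: inner_rvec local_datum_def)
      then show "(y - rvec u) \<bullet> rvec v \<ge> 0"
        using y v by (force simp: polytope_of_def inner_simps)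
    qed
    then show ?thesis by (simp add: inner_simps)
  qed
  with u show ?thesis by blast
qed

lemma convex_polytope_of: "convex (polytope_of \<Delta> a)"
proof -
  have "polytope_of \<Delta> a = (\<Inter>v\<in>ray_generators \<Delta>. {u. rvec v \<bullet> u \<ge> - real_of_int (a v)})"
    by (auto simp: polytope_of_def inner_commute)
  then show ?thesis by (auto intro: convex_INT convex_halfspace_ge)
qed

text \<open>Minimising the coordinate forms and their negatives bounds \<open>P\<close>.\<close>

lemma finite_lattice_points:
  assumes "complete_fan \<Delta>" "support_attained \<Delta> a"
  shows "finite (lattice_points \<Delta> a)"
proof -
  have "\<exists>M. \<forall>y\<in>polytope_of \<Delta> a. \<bar>y $ i\<bar> \<le> real_of_int M" for i
  proof -
    obtain u where u: "\<And>y. y \<in> polytope_of \<Delta> a \<Longrightarrow> rvec u \<bullet> axis i 1 \<le> y \<bullet> axis i 1"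
      using support_attained_min[OF assms, of "axis i 1"] by blast
    obtain v where v: "\<And>y. y \<in> polytope_of \<Delta> a \<Longrightarrow> rvec v \<bullet> (- axis i 1) \<le> y \<bullet> (- axis i 1)"
      using support_attained_min[OF assms, of "- axis i 1"] by blast
    have "\<bar>y $ i\<bar> \<le> real_of_int (\<bar>u $ i\<bar> + \<bar>v $ i\<bar>)" if "y \<in> polytope_of \<Delta> a" for y
      using u[OF that] v[OF that] by (simp add: inner_axis)
    then show ?thesis by blast
  qed
  then obtain M where M: "\<And>i y. y \<in> polytope_of \<Delta> a \<Longrightarrow> \<bar>y $ i\<bar> \<le> real_of_int (M i)" by metis
  have "\<bar>u $ i\<bar> \<le> Max (range M)" if u: "u \<in> lattice_points \<Delta> a" for u i
  proof -
    have "\<bar>u $ i\<bar> \<le> M i" using M[of "rvec u" i] u by (simp add: lattice_points_def)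
    also have "\<dots> \<le> Max (range M)" by (rule Max_ge) auto
    finally show ?thesis .
  qed
  then show ?thesis by (intro finite_subset[OF _ finite_int_vectors_bounded[of "Max (range M)"]]) auto
qed

text \<open>A hyperplane separating a point of \<open>P\<close> from the hull would give a linear
  form whose minimum over \<open>P\<close> is attained at no lattice point.\<close>

lemma polytope_of_eq_hull:
  assumes "complete_fan \<Delta>" "support_attained \<Delta> a"
  shows "polytope_of \<Delta> a = convex hull (rvec ` lattice_points \<Delta> a)"
proof
  show "convex hull (rvec ` lattice_points \<Delta> a) \<subseteq> polytope_of \<Delta> a"
    by (rule hull_minimal) (auto simp: lattice_points_def convex_polytope_of)
  show "polytope_of \<Delta> a \<subseteq> convex hull (rvec ` lattice_points \<Delta> a)"
  proof (rule ccontr)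
    assume "\<not> ?thesis"
    then obtain y where y: "y \<in> polytope_of \<Delta> a" "y \<notin> convex hull (rvec ` lattice_points \<Delta> a)" by blast
    have "closed (convex hull (rvec ` lattice_points \<Delta> a))"
      using finite_lattice_points[OF assms] by (intro compact_imp_closed finite_imp_compact_convex_hull) auto
    then obtain c b where cb: "c \<bullet> y < b" "\<And>x. x \<in> convex hull (rvec ` lattice_points \<Delta> a) \<Longrightarrow> c \<bullet> x > b"
      using separating_hyperplane_closed_point[OF convex_convex_hull _ y(2)] by blast
    obtain u where u: "u \<in> lattice_points \<Delta> a" "rvec u \<bullet> c \<le> y \<bullet> c"
      using support_attained_min[OF assms, of c] y by blast
    have "c \<bullet> rvec u > b" using u by (intro cb(2) hull_inc) auto
    then show False using u cb by (simp add: inner_commute)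
  qed
qed

lemma support_attained_nonempty:
  assumes "complete_fan \<Delta>" "support_attained \<Delta> a"
  shows "lattice_points \<Delta> a \<noteq> {}"
  using support_attained_min[OF assms, of 0] by blast

text \<open>Strong convexity makes the apex a face of every cone of the fan; this face provides the
  open torus.\<close>

lemma zero_cone_in_fan:
  assumes "complete_fan \<Delta>"
  shows "{0} \<in> \<Delta>"
proof -
  have "0 \<in> \<Union>\<Delta>" using assms by (simp add: complete_fan_def)
  then obtain \<sigma> where \<sigma>: "\<sigma> \<in> \<Delta>" by blast
  then have "rational_polyhedral_cone \<sigma>" and pointed: "strongly_convex_cone \<sigma>"
     and face: "\<And>\<tau>. \<tau> face_of \<sigma> \<Longrightarrow> \<tau> \<noteq> {} \<Longrightarrow> \<tau> \<in> \<Delta>"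
    using assms by (auto simp: complete_fan_def is_fan_def)
  then obtain B where B: "\<sigma> = convex_cone hull B" by (auto simp: rational_polyhedral_cone_def)
  have "{0} face_of \<sigma>" unfolding face_of_def
  proof (intro conjI ballI impI)
    show "{0} \<subseteq> \<sigma>" using convex_cone_hull_contains_0 by (auto simp: B)
    fix x y z assume xy: "x \<in> \<sigma>" "y \<in> \<sigma>" "z \<in> {0}" "z \<in> open_segment x y"
    then obtain t where t: "0 < t" "t < 1" "(1 - t) *\<^sub>R x + t *\<^sub>R y = 0"
      by (auto simp: in_segment)
    then have neg: "- ((1 - t) *\<^sub>R x) = t *\<^sub>R y" by (simp add: neg_eq_iff_add_eq_0)
    moreover have "(1 - t) *\<^sub>R x \<in> \<sigma>" "t *\<^sub>R y \<in> \<sigma>"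
      using xy t by (auto simp: B intro!: convex_cone_hull_mul)
    ultimately have "(1 - t) *\<^sub>R x = 0" using pointed by (auto simp: strongly_convex_cone_def)
    with neg t show "x \<in> {0}" "y \<in> {0}" by auto
  qed simp
  then show ?thesis using face by blast
qed


section \<open>Consequences of very ampleness\<close>

text \<open>Over a finite field, one plus the product of all \<open>X - c\<close> takes only the
  value one and would be a nonconstant polynomial without roots. Infinitude later lets values on a
  curve determine polynomials.\<close>

lemma infinite_alg_closed_field: "infinite (UNIV :: 'k::alg_closed_field set)"
proof
  assume fin: "finite (UNIV :: 'k set)"
  define q :: "'k poly" where "q = (\<Prod>c\<in>UNIV. [:- c, 1:])"
  have "q \<noteq> 0" using fin by (simp add: q_def)
  have one: "poly (q + 1) x = 1" for x
  proof -
    have "\<exists>c\<in>UNIV. poly [:- c, 1:] x = 0" by (rule bexI[of _ x]) simp_all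
    then have "poly q x = 0" unfolding q_def poly_prod by (rule prod_zero[OF fin])
    then show ?thesis by simp
  qed
  then have "degree (q + 1) = 0" using alg_closed_imp_poly_has_root[of "q + 1"] by fastforce
  then obtain c where "q + 1 = [:c:]" by (rule degree_eq_zeroE)
  with one[of 0] have "q + 1 = 1" by simp
  with \<open>q \<noteq> 0\<close> show False by simp
qed

lemma poly_eqI_infinite:
  fixes p q :: "'k::idom poly"
  assumes "infinite {z. poly p z = poly q z}"
  shows "p = q"
proof (rule ccontr)
  assume "p \<noteq> q"
  then have "finite {z. poly (p - q) z = 0}" by (intro poly_roots_finite) simp
  then show False using assms by simp
qed

lemma pairing_simps:
  "pairing w (u + v) = pairing w u + pairing w v" "pairing w (u - v) = pairing w u - pairing w v"
  "pairing w 0 = 0" "pairing w (c *s u) = c * pairing w u"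
  by (simp_all add: pairing_def sum.distrib sum_subtractf algebra_simps sum_distrib_left)

lemma pairing_sum: "pairing w (sum f A) = (\<Sum>x\<in>A. pairing w (f x))"
  unfolding pairing_def sum_component sum_distrib_left by (rule sum.swap)

lemma pairing_commute: "pairing u v = pairing v u"
  by (simp add: pairing_def mult.commute)

text \<open>With \<open>w\<close> having coordinates \<open>b ^ h i\<close>, the value of
  \<open>w\<close> on a difference of distinct points is a nonzero polynomial in \<open>b\<close>;
  finitely many of these leave an integer \<open>b\<close> that is a root of none.\<close>

lemma exists_separating_direction:
  fixes X :: "(int ^ 'n::finite) set"
  assumes "finite X"
  obtains w where "inj_on (pairing w) X"
proof -
  obtain h :: "'n \<Rightarrow> nat" where h: "inj h"
    using ex_bij_betw_finite_nat[of "UNIV :: 'n set"] by (auto simp: bij_betw_def)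
  define P :: "int ^ 'n \<Rightarrow> int poly" where "P d = (\<Sum>i\<in>UNIV. monom (d $ i) (h i))" for d
  have P: "P d \<noteq> 0" if "d \<noteq> 0" for d
  proof -
    from that obtain i where i: "d $ i \<noteq> 0" by (auto simp: vec_eq_iff)
    have "coeff (P d) (h i) = d $ i"
      unfolding P_def coeff_sum coeff_monom inj_eq[OF h] by simp
    with i show ?thesis by auto
  qed
  define D where "D = (\<lambda>(x, y). x - y) ` (X \<times> X) - {0}"
  have "finite D" using assms by (simp add: D_def)
  then have "finite (\<Union>d\<in>D. {b. poly (P d) b = 0})"
    by (rule finite_UN_I) (rule poly_roots_finite[OF P], simp add: D_def)
  then obtain b where b: "b \<notin> (\<Union>d\<in>D. {b. poly (P d) b = 0})"
    using infinite_UNIV_int by (metis ex_new_if_finite)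
  define w :: "int ^ 'n" where "w = (\<chi> i. b ^ h i)"
  have "pairing w (x - y) = poly (P (x - y)) b" for x y
    by (simp add: pairing_def w_def P_def poly_sum poly_monom mult.commute)
  then have eq: "pairing w x - pairing w y = poly (P (x - y)) b" for x y by (simp add: pairing_simps)
  have "inj_on (pairing w) X"
  proof (rule inj_onI, rule ccontr)
    fix x y assume xy: "x \<in> X" "y \<in> X" "pairing w x = pairing w y" "x \<noteq> y"
    then have "x - y \<in> D" unfolding D_def by force
    then show False using b eq[of x y] xy(3) by simp
  qed
  then show thesis by (rule that)
qed

lemma proj_class_scale: "c \<noteq> 0 \<Longrightarrow> proj_class (\<lambda>u. c * y u) = proj_class y"
proof (intro equalityI subsetI)
  fix x assume c: "c \<noteq> 0" "x \<in> proj_class (\<lambda>u. c * y u)"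
  then obtain d where "d \<noteq> 0" "x = (\<lambda>u. d * (c * y u))" unfolding proj_class_def by blast
  then have "x = (\<lambda>u. (d * c) * y u)" "d * c \<noteq> 0" using c by (simp_all add: mult.assoc)
  then show "x \<in> proj_class y" unfolding proj_class_def by blast
next
  fix x assume c: "c \<noteq> 0" "x \<in> proj_class y"
  then obtain d where "d \<noteq> 0" "x = (\<lambda>u. d * y u)" unfolding proj_class_def by blast
  then have "x = (\<lambda>u. (d / c) * (c * y u))" "d / c \<noteq> 0" using c by simp_all
  then show "x \<in> proj_class (\<lambda>u. c * y u)" unfolding proj_class_def by blast
qed

lemma proj_class_self: "y \<in> proj_class y"
  by (auto simp: proj_class_def intro!: exI[of _ 1])

lemma poly_eval_scale:
  assumes "homogeneous_poly A e F"
  shows "poly_eval F (\<lambda>u. c * y u) = c ^ e * poly_eval F y"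
  unfolding poly_eval_def sum_distrib_left
proof (rule sum.cong[OF refl])
  fix \<mu> assume "\<mu> \<in> Poly_Mapping.keys F"
  then have "(\<Sum>u\<in>Poly_Mapping.keys \<mu>. Poly_Mapping.lookup \<mu> u) = e"
    using assms by (simp add: homogeneous_poly_def)
  then have "c ^ e = (\<Prod>u\<in>Poly_Mapping.keys \<mu>. c ^ Poly_Mapping.lookup \<mu> u)"
    unfolding power_sum[symmetric] by simp
  then show "Poly_Mapping.lookup F \<mu> * (\<Prod>u\<in>Poly_Mapping.keys \<mu>. (c * y u) ^ Poly_Mapping.lookup \<mu> u)
    = c ^ e * (Poly_Mapping.lookup F \<mu> * (\<Prod>u\<in>Poly_Mapping.keys \<mu>. y u ^ Poly_Mapping.lookup \<mu> u))"
    by (simp add: power_mult_distrib prod.distrib)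
qed

lemma poly_eval_proj_class:
  assumes "homogeneous_poly A e F" "y' \<in> proj_class y"
  shows "poly_eval F y' = 0 \<longleftrightarrow> poly_eval F y = 0"
  using assms poly_eval_scale[OF assms(1), of _ y] by (auto simp: proj_class_def)

text \<open>The space of a generated topology is the union of its basic sets; the constant function
  one places every point in such a set.\<close>

lemma in_toric_topspace:
  assumes "(\<tau>, \<gamma>) \<in> toric_points \<Delta>"
  shows "(\<tau>, \<gamma> :: int ^ 'n::finite \<Rightarrow> 'k::field) \<in> topspace (toric_topology \<Delta>)"
proof -
  have "(\<tau>, \<gamma>) \<in> chart \<Delta> \<tau>" "\<tau> \<in> \<Delta>" using assms by (auto simp: chart_def toric_points_def)
  moreover have "chart_eval (1 :: int ^ 'n \<Rightarrow>\<^sub>0 'k) (\<tau>, \<gamma>) \<noteq> 0"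
    using assms by (simp add: chart_eval_def toric_points_def)
  moreover have "(1 :: int ^ 'n \<Rightarrow>\<^sub>0 'k) \<in> chart_functions \<tau>"
    by (simp add: chart_functions_def dual_monoid_def)
  ultimately show ?thesis unfolding toric_topology_def topology_generated_by_topspace by blast
qed

lemma proj_topspace_subset: "topspace (proj_topology A) \<subseteq> proj_space A"
  unfolding proj_topology_def topology_generated_by_topspace by blast

lemma some_local_datum:
  assumes "T_Cartier \<Delta> a" "\<tau> \<in> \<Delta>"
  shows "local_datum \<Delta> a \<tau> (SOME m. local_datum \<Delta> a \<tau> m)"
  using assms unfolding T_Cartier_def by - (rule someI_ex, blast)

text \<open>The section map is evaluated at the distinguished point of the orbit of
  \<open>\<tau>\<close>. The section of \<open>u\<close> is nonzero there exactly if
  \<open>u - m\<close> is orthogonal to \<open>\<tau>\<close>, and then \<open>u\<close> is itself a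
  local datum; some section is nonzero because the image is a point of projective space.\<close>

lemma toric_pair_support_attained:
  assumes "toric_pair TYPE('k::field) \<Delta> a"
  shows "support_attained \<Delta> (a :: int ^ 'n::finite \<Rightarrow> int)"
  unfolding support_attained_def
proof
  fix \<tau> assume \<tau>: "\<tau> \<in> \<Delta>"
  define \<gamma> :: "int ^ 'n \<Rightarrow> 'k" where "\<gamma> u = (if u \<in> perp_lattice \<tau> then 1 else 0)" for u
  have pt: "(\<tau>, \<gamma>) \<in> toric_points \<Delta>"
  proof -
    have "0 \<in> perp_lattice \<tau>" "\<And>u w. u \<in> perp_lattice \<tau> \<Longrightarrow> w \<in> perp_lattice \<tau> \<Longrightarrow> u + w \<in> perp_lattice \<tau>"
      by (simp_all add: perp_lattice_def inner_simps)
    then show ?thesis using \<tau> by (simp add: toric_points_def \<gamma>_def)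
  qed
  have emb: "embedding_map (toric_topology \<Delta> :: ('n, 'k) toric_point topology)
      (proj_topology (lattice_points \<Delta> a)) (section_map \<Delta> a)"
    using assms unfolding toric_pair_def very_ample_def closed_embedding_def by (elim conjE)
  have "section_map \<Delta> a ` topspace (toric_topology \<Delta> :: ('n, 'k) toric_point topology)
      \<subseteq> topspace (proj_topology (lattice_points \<Delta> a))"
    using homeomorphic_imp_surjective_map[OF emb[unfolded embedding_map_def]]
    unfolding topspace_subtopology by blast
  then have in_proj: "section_map \<Delta> a (\<tau>, \<gamma>) \<in> proj_space (lattice_points \<Delta> a)"
    using in_toric_topspace[OF pt] proj_topspace_subset by blast
  define m where "m = (SOME m. local_datum \<Delta> a \<tau> m)"
  define y where "y = (\<lambda>u. if u \<in> lattice_points \<Delta> a then \<gamma> (u - m) else 0)"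
  have "section_map \<Delta> a (\<tau>, \<gamma>) = proj_class y"
    unfolding section_map_def y_def m_def fst_conv snd_conv ..
  with in_proj have "proj_class y \<in> proj_space (lattice_points \<Delta> a)" by (rule subst[rotated])
  then obtain y' u where y': "proj_class y = proj_class y'" "y' u \<noteq> 0"
    unfolding proj_space_def by blast
  then have "y' \<in> proj_class y" using proj_class_self[of y'] by simp
  then obtain c where "y' = (\<lambda>u. c * y u)" unfolding proj_class_def by blast
  then have "y u \<noteq> 0" using y'(2) by auto
  then have u: "u \<in> lattice_points \<Delta> a" "u - m \<in> perp_lattice \<tau>"
    by (auto simp: y_def \<gamma>_def split: if_splits)
  have "local_datum \<Delta> a \<tau> u" unfolding local_datum_def
  proof (intro ballI impI)
    fix v assume v: "v \<in> ray_generators \<Delta>" "rvec v \<in> \<tau>"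
    have "pairing m v = - a v"
      using some_local_datum[of \<Delta> a \<tau>] assms \<tau> v unfolding m_def toric_pair_def local_datum_def by blast
    moreover have "rvec (u - m) \<bullet> rvec v = 0" using u v by (auto simp: perp_lattice_def)
    then have "pairing (u - m) v = 0" unfolding inner_rvec by simp
    then have "pairing u v = pairing m v" by (simp add: pairing_commute[of _ v] pairing_simps)
    ultimately show "pairing u v = - a v" by simp
  qed
  with u show "\<exists>u\<in>lattice_points \<Delta> a. local_datum \<Delta> a \<tau> u" by blast
qed

text \<open>The two elements have equal degree, so \<open>m\<close> is a difference of two sums of
  equally many lattice points of \<open>P\<close>.\<close>

definition generates_lattice :: "(real ^ 'n::finite) set set \<Rightarrow> (int ^ 'n \<Rightarrow> int) \<Rightarrow> bool"
  where "generates_lattice \<Delta> a \<longleftrightarrow>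
    (\<forall>m. \<exists>s\<in>coord_semigroup \<Delta> a. \<exists>t\<in>coord_semigroup \<Delta> a. s - t = (m, 0))"

section \<open>Restriction of sections to one-parameter subgroups\<close>

lemma coord_semigroup_sum:
  "(\<And>x. x \<in> A \<Longrightarrow> f x \<in> coord_semigroup \<Delta> a) \<Longrightarrow> sum f A \<in> coord_semigroup \<Delta> a"
  by (induction A rule: infinite_finite_induct) (auto intro: coord_semigroup_add coord_semigroup.zero)

text \<open>The torus character that the monomial with exponents \<open>\<mu>\<close> in the
  sections becomes.\<close>

definition exponent_sum :: "(int ^ 'n \<Rightarrow>\<^sub>0 nat) \<Rightarrow> int ^ 'n"
  where "exponent_sum \<mu> = (\<Sum>u\<in>Poly_Mapping.keys \<mu>. int (Poly_Mapping.lookup \<mu> u) *s u)"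

lemma exponent_sum_in_coord_semigroup:
  assumes "homogeneous_poly (lattice_points \<Delta> a) e F" "\<mu> \<in> Poly_Mapping.keys F"
  shows "(exponent_sum \<mu>, int e) \<in> coord_semigroup \<Delta> a"
proof -
  have "(\<Sum>u\<in>Poly_Mapping.keys \<mu>. (int (Poly_Mapping.lookup \<mu> u) *s u, int (Poly_Mapping.lookup \<mu> u) * 1))
      \<in> coord_semigroup \<Delta> a"
    using assms unfolding homogeneous_poly_def
    by (intro coord_semigroup_sum coord_semigroup_scale coord_semigroup_generator) blast
  moreover have "(\<Sum>u\<in>Poly_Mapping.keys \<mu>. Poly_Mapping.lookup \<mu> u) = e"
    using assms by (auto simp: homogeneous_poly_def)
  then have "int e = (\<Sum>u\<in>Poly_Mapping.keys \<mu>. int (Poly_Mapping.lookup \<mu> u))" by force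
  ultimately show ?thesis by (simp add: exponent_sum_def sum_prod)
qed

text \<open>The pull-back of \<open>F\<close> along the curve with coordinates
  \<open>z ^ \<omega> u\<close>, written as a polynomial so that coefficients can be compared.
  Different terms of \<open>F\<close> may meet in one degree.\<close>

definition curve_poly ::
  "(int ^ 'n::finite \<Rightarrow> nat) \<Rightarrow> ((int ^ 'n \<Rightarrow>\<^sub>0 nat) \<Rightarrow>\<^sub>0 'k::field) \<Rightarrow> 'k poly"
  where "curve_poly \<omega> F = (\<Sum>\<mu>\<in>Poly_Mapping.keys F.
    monom (Poly_Mapping.lookup F \<mu>) (\<Sum>u\<in>Poly_Mapping.keys \<mu>. \<omega> u * Poly_Mapping.lookup \<mu> u))"

lemma poly_curve_poly:
  assumes "homogeneous_poly A e F" "\<And>u. u \<in> A \<Longrightarrow> y u = z ^ \<omega> u"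
  shows "poly (curve_poly \<omega> F) z = poly_eval F y"
  unfolding curve_poly_def poly_eval_def poly_sum poly_monom
proof (rule sum.cong[OF refl])
  fix \<mu> assume "\<mu> \<in> Poly_Mapping.keys F"
  then have "y u = z ^ \<omega> u" if "u \<in> Poly_Mapping.keys \<mu>" for u
    using assms that by (auto simp: homogeneous_poly_def)
  then show "Poly_Mapping.lookup F \<mu> * z ^ (\<Sum>u\<in>Poly_Mapping.keys \<mu>. \<omega> u * Poly_Mapping.lookup \<mu> u)
    = Poly_Mapping.lookup F \<mu> * (\<Prod>u\<in>Poly_Mapping.keys \<mu>. y u ^ Poly_Mapping.lookup \<mu> u)"
    by (simp add: power_sum power_mult)
qed

text \<open>By homogeneity the shift by \<open>N\<close> contributes the same \<open>N * e\<close>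
  for every term, so degrees still compare exponents through \<open>pairing w\<close>.\<close>

lemma coeff_curve_poly_nonzero:
  assumes "homogeneous_poly A e F" "coeff (curve_poly \<omega> F) i \<noteq> 0"
    and \<omega>: "\<And>u. u \<in> A \<Longrightarrow> int (\<omega> u) = pairing w u + int N"
  shows "\<exists>\<mu>\<in>Poly_Mapping.keys F. int i = pairing w (exponent_sum \<mu>) + int N * int e"
proof -
  obtain \<mu> where \<mu>: "\<mu> \<in> Poly_Mapping.keys F"
      "i = (\<Sum>u\<in>Poly_Mapping.keys \<mu>. \<omega> u * Poly_Mapping.lookup \<mu> u)"
    using assms(2) by (auto simp: curve_poly_def coeff_sum elim!: sum.not_neutral_contains_not_neutral split: if_splits)
  have sub: "Poly_Mapping.keys \<mu> \<subseteq> A" "(\<Sum>u\<in>Poly_Mapping.keys \<mu>. Poly_Mapping.lookup \<mu> u) = e"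
    using assms \<mu> by (auto simp: homogeneous_poly_def)
  have "int i = (\<Sum>u\<in>Poly_Mapping.keys \<mu>. int (\<omega> u) * int (Poly_Mapping.lookup \<mu> u))"
    by (simp add: \<mu>)
  also have "\<dots> = (\<Sum>u\<in>Poly_Mapping.keys \<mu>. (pairing w u + int N) * int (Poly_Mapping.lookup \<mu> u))"
    by (rule sum.cong) (use sub \<omega> in auto)
  also have "\<dots> = pairing w (exponent_sum \<mu>) + int N * int e"
    by (simp add: exponent_sum_def pairing_simps pairing_sum sub(2)[symmetric] sum_distrib_left sum.distrib algebra_simps)
  finally show ?thesis using \<mu> by blast
qed

text \<open>Every character is orthogonal to the zero cone, so for \<open>z \<noteq> 0\<close> this
  is a point of the one-parameter subgroup of \<open>w\<close> in the open torus.\<close>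

definition torus_curve :: "int ^ 'n::finite \<Rightarrow> 'k::field \<Rightarrow> ('n, 'k) toric_point"
  where "torus_curve w z = ({0}, \<lambda>u. z powi pairing w u)"

lemma torus_curve_in_toric_points:
  "complete_fan \<Delta> \<Longrightarrow> z \<noteq> 0 \<Longrightarrow> torus_curve w z \<in> toric_points \<Delta>"
  using zero_cone_in_fan[of \<Delta>]
  by (auto simp: torus_curve_def toric_points_def perp_lattice_def pairing_simps power_int_add)

text \<open>Two choices disappear in the projective class: the local datum picked by
  \<open>SOME\<close>, and the shift by \<open>N\<close> that turns possibly negative exponents
  \<open>pairing w u\<close> into natural numbers.\<close>

lemma section_map_torus_curve:
  assumes \<omega>: "\<And>u. u \<in> lattice_points \<Delta> a \<Longrightarrow> int (\<omega> u) = pairing w u + int N" and z: "z \<noteq> 0"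
  shows "section_map \<Delta> a (torus_curve w z) = proj_class (\<lambda>u. if u \<in> lattice_points \<Delta> a then z ^ \<omega> u else 0)"
proof -
  define m where "m = (SOME m. local_datum \<Delta> a {0} m)"
  let ?c = "z powi (pairing w m + int N)"
  let ?y = "\<lambda>u. if u \<in> lattice_points \<Delta> a then z powi pairing w (u - m) else 0"
  have "section_map \<Delta> a (torus_curve w z) = proj_class ?y"
    unfolding section_map_def torus_curve_def m_def fst_conv snd_conv ..
  also have "\<dots> = proj_class (\<lambda>u. ?c * ?y u)"
    by (rule proj_class_scale[symmetric]) (use z in auto)
  also have "(\<lambda>u. ?c * ?y u) = (\<lambda>u. if u \<in> lattice_points \<Delta> a then z ^ \<omega> u else 0)"
  proof
    fix u
    have "?c * z powi pairing w (u - m) = z powi int (\<omega> u)" if "u \<in> lattice_points \<Delta> a"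
      using z by (simp add: power_int_add[symmetric] pairing_simps \<omega>[OF that] algebra_simps)
    then show "?c * ?y u = (if u \<in> lattice_points \<Delta> a then z ^ \<omega> u else 0)" by simp
  qed
  finally show ?thesis .
qed

text \<open>On a basic open set where \<open>F\<close> does not vanish, the exceptions are roots of
  a polynomial in \<open>z\<close> that is nonzero because its value at \<open>1\<close> is. The
  property passes to intersections and unions; in a union, the point at \<open>1\<close> selects a
  member.\<close>

lemma finite_curve_outside_open:
  fixes \<Delta> :: "(real ^ 'n::finite) set set" and V :: "(int ^ 'n \<Rightarrow> 'k::field) set set"
  assumes fan: "complete_fan \<Delta>" and ne: "lattice_points \<Delta> a \<noteq> {}"
    and \<omega>: "\<And>u. u \<in> lattice_points \<Delta> a \<Longrightarrow> int (\<omega> u) = pairing w u + int N"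
    and V: "openin (proj_topology (lattice_points \<Delta> a)) V" "section_map \<Delta> a (torus_curve w 1) \<in> V"
  shows "finite {z. z \<noteq> 0 \<and> section_map \<Delta> a (torus_curve w z) \<notin> V}"
  using V(1) V(2) unfolding proj_topology_def openin_topology_generated_by_iff
proof (induction rule: generate_topology_on.induct)
  case (Int U V)
  then have "finite ({z. z \<noteq> 0 \<and> section_map \<Delta> a (torus_curve w z) \<notin> U} \<union>
      {z. z \<noteq> 0 \<and> section_map \<Delta> a (torus_curve w z) \<notin> V})" by auto
  then show ?case by (rule finite_subset[rotated]) auto
next
  case (UN K)
  then obtain U where "U \<in> K" "finite {z. z \<noteq> 0 \<and> section_map \<Delta> a (torus_curve w z) \<notin> U}" by blast
  then show ?case by (rule_tac finite_subset[rotated]) auto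
next
  case (Basis V)
  then obtain e F where F: "homogeneous_poly (lattice_points \<Delta> a) e F"
    "V = {L \<in> proj_space (lattice_points \<Delta> a). \<forall>y\<in>L. poly_eval F y \<noteq> 0}" by blast
  let ?y = "\<lambda>z u. if u \<in> lattice_points \<Delta> a then z ^ \<omega> u else 0"
  have eval: "poly (curve_poly \<omega> F) z = poly_eval F (?y z)" for z
    by (rule poly_curve_poly[OF F(1)]) simp
  have "poly_eval F (?y 1) \<noteq> 0"
  proof -
    have eq: "section_map \<Delta> a (torus_curve w 1) = proj_class (?y 1)"
      by (rule section_map_torus_curve[OF \<omega>]) auto
    have "\<forall>y\<in>section_map \<Delta> a (torus_curve w 1). poly_eval F y \<noteq> 0"
      using Basis.prems unfolding F by (elim CollectE conjE)
    then show ?thesis unfolding eq using proj_class_self by (rule bspec)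
  qed
  then have "curve_poly \<omega> F \<noteq> 0" using eval[of 1] by auto
  then have "finite {z. poly (curve_poly \<omega> F) z = 0}" by (rule poly_roots_finite)
  moreover have "section_map \<Delta> a (torus_curve w z) \<in> V"
    if "z \<noteq> 0" "poly (curve_poly \<omega> F) z \<noteq> 0" for z
  proof -
    obtain u where "u \<in> lattice_points \<Delta> a" using ne by blast
    then have "\<exists>u. ?y z u \<noteq> 0" using that by (intro exI[of _ u]) simp
    then have "proj_class (?y z) \<in> proj_space (lattice_points \<Delta> a)"
      unfolding proj_space_def by (intro CollectI exI[of _ "?y z"]) auto
    moreover have "poly_eval F y \<noteq> 0" if "y \<in> proj_class (?y z)" for y
      using poly_eval_proj_class[OF F(1) that] eval[of z] \<open>poly (curve_poly \<omega> F) z \<noteq> 0\<close> by simp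
    moreover have "section_map \<Delta> a (torus_curve w z) = proj_class (?y z)"
      by (rule section_map_torus_curve[OF \<omega> that(1)])
    ultimately show ?thesis unfolding F by simp
  qed
  ultimately show ?case by (rule_tac finite_subset[rotated]) auto
qed simp

lemma torus_point_one: "torus_curve w 1 = ({0}, \<lambda>_. 1)"
  by (simp add: torus_curve_def)

lemma toric_regular_character:
  assumes "complete_fan \<Delta>"
  shows "toric_regular \<Delta> (chart \<Delta> {0} :: ('n::finite, 'k::field) toric_point set) (\<lambda>x. snd x m)"
  unfolding toric_regular_def
proof (intro ballI bexI[OF _ zero_cone_in_fan[OF assms]])
  fix x :: "('n, 'k) toric_point" assume x: "x \<in> chart \<Delta> {0}"
  have one: "chart_eval (1 :: int ^ 'n \<Rightarrow>\<^sub>0 'k) y = 1" if "y \<in> chart \<Delta> {0}" for y :: "('n, 'k) toric_point"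
    using that by (auto simp: chart_eval_def chart_def toric_points_def)
  have fn: "(1 :: int ^ 'n \<Rightarrow>\<^sub>0 'k) \<in> chart_functions {0}" "Poly_Mapping.single m (1::'k) \<in> chart_functions {0}"
    by (auto simp: chart_functions_def dual_monoid_def)
  show "\<exists>g\<in>chart_functions {0}. \<exists>h\<in>chart_functions {0}. x \<in> chart \<Delta> {0} \<and> chart_eval h x \<noteq> 0 \<and>
      (\<forall>y\<in>chart \<Delta> {0} \<inter> chart \<Delta> {0}. chart_eval h y \<noteq> 0 \<longrightarrow> snd y m = chart_eval g y / chart_eval h y)"
    using x one by (intro bexI[OF _ fn(2)] bexI[OF _ fn(1)]) (simp add: chart_eval_def)
qed

lemma openin_torus_chart:
  assumes "complete_fan \<Delta>"
  shows "openin (toric_topology \<Delta>) (chart \<Delta> {0} :: ('n::finite, 'k::field) toric_point set)"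
proof -
  have "chart_eval (1 :: int ^ 'n \<Rightarrow>\<^sub>0 'k) y = 1" if "y \<in> chart \<Delta> {0}" for y :: "('n, 'k) toric_point"
    using that by (auto simp: chart_eval_def chart_def toric_points_def)
  then have "(chart \<Delta> {0} :: ('n, 'k) toric_point set) = {x \<in> chart \<Delta> {0}. chart_eval (1 :: int ^ 'n \<Rightarrow>\<^sub>0 'k) x \<noteq> 0}"
    by auto
  moreover have "(1 :: int ^ 'n \<Rightarrow>\<^sub>0 'k) \<in> chart_functions {0}"
    by (auto simp: chart_functions_def dual_monoid_def)
  ultimately show ?thesis using zero_cone_in_fan[OF assms]
    unfolding toric_topology_def by (intro topology_generated_by_Basis CollectI) blast
qed

text \<open>
  Near the identity of the torus \<open>\<chi>\<^sup>m\<close> is a quotient \<open>F / G\<close> of forms of equal degree in the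
  sections.  On the one-parameter subgroup \<open>torus_curve w\<close> this is an identity of polynomials in \<open>z\<close>,
  and if \<open>w\<close> separates the finitely many exponents, comparing them exhibits \<open>m\<close> as a difference of
  two sums of lattice points of \<open>P\<close>.
\<close>

lemma toric_pair_generates_lattice:
  fixes \<Delta> :: "(real ^ 'n::finite) set set" and a :: "int ^ 'n \<Rightarrow> int"
  assumes pair: "toric_pair TYPE('k::alg_closed_field) \<Delta> a"
  shows "generates_lattice \<Delta> a"
  unfolding generates_lattice_def
proof
  fix m :: "int ^ 'n"
  let ?L = "lattice_points \<Delta> a" and ?W = "chart \<Delta> {0} :: ('n, 'k) toric_point set"
  let ?\<phi> = "section_map \<Delta> a :: ('n, 'k) toric_point \<Rightarrow> (int ^ 'n \<Rightarrow> 'k) set"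
  have fan: "complete_fan \<Delta>" using pair by (simp add: toric_pair_def)
  have att: "support_attained \<Delta> a" using pair by (rule toric_pair_support_attained)
  have finL: "finite ?L" using fan att by (rule finite_lattice_points)
  have neL: "?L \<noteq> {}" using fan att by (rule support_attained_nonempty)
  have curve_chart: "torus_curve w z \<in> ?W" if "z \<noteq> 0" for w z
    using torus_curve_in_toric_points[OF fan that, of w] by (simp add: chart_def torus_curve_def)
  define x1 :: "('n, 'k) toric_point" where "x1 = ({0}, \<lambda>_. 1)"
  have x1: "x1 = torus_curve w 1" for w by (simp add: x1_def torus_point_one)
  have emb: "\<forall>W f x. openin (toric_topology \<Delta>) W \<and> toric_regular \<Delta> W f \<and> x \<in> W \<longrightarrow>
      (\<exists>V g. openin (proj_topology ?L) V \<and> ?\<phi> x \<in> V \<and> proj_regular ?L V g \<and>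
        (\<forall>y\<in>W. ?\<phi> y \<in> V \<longrightarrow> f y = g (?\<phi> y)))"
    using pair unfolding toric_pair_def very_ample_def closed_embedding_def by (elim conjE)
  have "x1 \<in> ?W" unfolding x1[of 0] by (rule curve_chart) simp
  with emb[rule_format, of ?W "\<lambda>x. snd x m" x1] obtain V g
    where V: "openin (proj_topology ?L) V" "?\<phi> x1 \<in> V" and reg: "proj_regular ?L V g"
      and g: "\<And>y. y \<in> ?W \<Longrightarrow> ?\<phi> y \<in> V \<Longrightarrow> snd y m = g (?\<phi> y)"
    using openin_torus_chart[OF fan] toric_regular_character[OF fan, of m] by blast
  from reg V(2) obtain e F G where F: "homogeneous_poly ?L e F" and G: "homogeneous_poly ?L e G"
    and G1: "\<And>y. y \<in> ?\<phi> x1 \<Longrightarrow> poly_eval G y \<noteq> 0"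
    and gFG: "\<And>L' y. L' \<in> V \<Longrightarrow> y \<in> L' \<Longrightarrow> poly_eval G y \<noteq> 0 \<Longrightarrow> g L' = poly_eval F y / poly_eval G y"
    unfolding proj_regular_def by metis
  \<comment> \<open>Both families of exponents are separated together, so that equal degrees across
    the two sides of the identity force equal exponents.\<close>
  obtain w where w: "inj_on (pairing w)
      ((\<lambda>\<mu>. exponent_sum \<mu> + m) ` Poly_Mapping.keys G \<union> exponent_sum ` Poly_Mapping.keys F)"
    by (rule exists_separating_direction[of "(\<lambda>\<mu>. exponent_sum \<mu> + m) ` Poly_Mapping.keys G \<union>
      exponent_sum ` Poly_Mapping.keys F"]) simp_all
  define N where "N = (\<Sum>u\<in>?L. nat \<bar>pairing w u\<bar>)"
  define \<omega> where "\<omega> u = nat (pairing w u + int N)" for u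
  have \<omega>: "int (\<omega> u) = pairing w u + int N" if "u \<in> ?L" for u
  proof -
    have "nat \<bar>pairing w u\<bar> \<le> N" unfolding N_def by (rule member_le_sum) (use that finL in auto)
    then show ?thesis by (simp add: \<omega>_def)
  qed
  let ?y = "\<lambda>z u. if u \<in> ?L then z ^ \<omega> u else (0::'k)"
  have curve: "?\<phi> (torus_curve w z) = proj_class (?y z)" if "z \<noteq> 0" for z
    by (rule section_map_torus_curve[OF \<omega> that])
  have evF: "poly (curve_poly \<omega> F) z = poly_eval F (?y z)" for z
    by (rule poly_curve_poly[OF F]) simp
  have evG: "poly (curve_poly \<omega> G) z = poly_eval G (?y z)" for z
    by (rule poly_curve_poly[OF G]) simp
  have "poly_eval G (?y 1) \<noteq> 0"
    using proj_class_self[of "?y 1"] curve[of 1] by (intro G1) (simp add: x1[of w])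
  then have G0: "curve_poly \<omega> G \<noteq> 0" using evG[of 1] by auto
  \<comment> \<open>Writing the exponent of \<open>z\<close> as \<open>A - B\<close> clears negative
    powers and leaves an identity of polynomials.\<close>
  define A B where "A = nat (pairing w m)" and "B = nat (- pairing w m)"
  have AB: "pairing w m = int A - int B" by (simp add: A_def B_def)
  let ?bad = "{z. z \<noteq> 0 \<and> ?\<phi> (torus_curve w z) \<notin> V} \<union> {z. poly (curve_poly \<omega> G) z = 0} \<union> {0}"
  have "finite ?bad"
    using finite_curve_outside_open[OF fan neL \<omega> V(1)] V(2) x1[of w] poly_roots_finite[OF G0] by simp
  then have "infinite (UNIV - ?bad)"
    using infinite_alg_closed_field by (rule Diff_infinite_finite)
  moreover have "UNIV - ?bad \<subseteq> {z. poly (monom 1 A * curve_poly \<omega> G) z = poly (monom 1 B * curve_poly \<omega> F) z}"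
  proof
    fix z assume "z \<in> UNIV - ?bad"
    then have z: "z \<noteq> 0" "?\<phi> (torus_curve w z) \<in> V" "poly_eval G (?y z) \<noteq> 0" by (auto simp: evG)
    have "z powi pairing w m = snd (torus_curve w z) m" by (simp add: torus_curve_def)
    also have "\<dots> = g (?\<phi> (torus_curve w z))" by (rule g) (use z curve_chart in auto)
    also have "\<dots> = poly_eval F (?y z) / poly_eval G (?y z)"
      by (rule gFG) (use z curve[OF z(1)] proj_class_self in auto)
    finally have "z powi pairing w m * poly_eval G (?y z) = poly_eval F (?y z)" using z by (simp add: field_simps)
    note quot = this
    have "z ^ A = z powi pairing w m * z ^ B"
      using z(1) by (simp add: AB power_int_diff)
    then have "z ^ A * poly_eval G (?y z) = z ^ B * (z powi pairing w m * poly_eval G (?y z))"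
      by (simp only: mult_ac)
    then have "z ^ A * poly_eval G (?y z) = z ^ B * poly_eval F (?y z)" unfolding quot .
    then show "z \<in> {z. poly (monom 1 A * curve_poly \<omega> G) z = poly (monom 1 B * curve_poly \<omega> F) z}"
      by (simp add: poly_monom evF evG)
  qed
  ultimately have eq: "monom 1 A * curve_poly \<omega> G = monom 1 B * curve_poly \<omega> F"
    by (intro poly_eqI_infinite) (meson finite_subset)
  \<comment> \<open>One nonzero coefficient of the pull-back of \<open>G\<close> suffices: the
    matching coefficient on the other side is nonzero as well and therefore stems from some term of
    \<open>F\<close>.\<close>
  obtain i where i: "coeff (curve_poly \<omega> G) i \<noteq> 0" using G0 by (metis leading_coeff_0_iff)
  have "coeff (monom 1 B * curve_poly \<omega> F) (A + i) \<noteq> 0"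
    using i by (simp flip: eq add: coeff_monom_mult)
  then have Bi: "B \<le> A + i" and "coeff (curve_poly \<omega> F) (A + i - B) \<noteq> 0"
    by (auto simp: coeff_monom_mult split: if_splits)
  then obtain \<nu> where \<nu>: "\<nu> \<in> Poly_Mapping.keys F" "int (A + i - B) = pairing w (exponent_sum \<nu>) + int N * int e"
    using coeff_curve_poly_nonzero[OF F _ \<omega>] by blast
  obtain \<mu> where \<mu>: "\<mu> \<in> Poly_Mapping.keys G" "int i = pairing w (exponent_sum \<mu>) + int N * int e"
    using coeff_curve_poly_nonzero[OF G i \<omega>] by blast
  have "pairing w (exponent_sum \<mu> + m) = pairing w (exponent_sum \<nu>)"
    using \<mu>(2) \<nu>(2) Bi AB by (simp add: pairing_simps of_nat_diff)
  then have "exponent_sum \<mu> + m = exponent_sum \<nu>"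
    by (rule inj_onD[OF w]) (use \<mu> \<nu> in auto)
  then have "(exponent_sum \<nu>, int e) - (exponent_sum \<mu>, int e) = (m, 0)"
    by (simp add: algebra_simps flip: \<open>exponent_sum \<mu> + m = exponent_sum \<nu>\<close>)
  then show "\<exists>s\<in>coord_semigroup \<Delta> a. \<exists>t\<in>coord_semigroup \<Delta> a. s - t = (m, 0)"
    using exponent_sum_in_coord_semigroup F G \<mu>(1) \<nu>(1) by blast
qed


section \<open>The semigroup and its cone\<close>

lemma polytope_of_multiple:
  assumes "k \<ge> 1"
  shows "x \<in> polytope_of \<Delta> (multiple k a) \<longleftrightarrow> (1 / real k) *\<^sub>R x \<in> polytope_of \<Delta> a"
proof -
  have "- (real k * real_of_int c) \<le> r \<longleftrightarrow> - real_of_int c \<le> r / real k" for c r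
    using assms by (simp add: field_simps)
  then show ?thesis by (simp add: polytope_of_def multiple_def)
qed

lemma lattice_points_multiple_scale:
  assumes "k \<ge> 1" "u \<in> lattice_points \<Delta> a"
  shows "int k *s u \<in> lattice_points \<Delta> (multiple k a)"
  using assms by (simp add: lattice_points_def polytope_of_multiple)

lemma support_attained_multiple:
  assumes "k \<ge> 1" "support_attained \<Delta> a"
  shows "support_attained \<Delta> (multiple k a)"
  unfolding support_attained_def
proof
  fix \<tau> assume "\<tau> \<in> \<Delta>"
  then obtain u where u: "u \<in> lattice_points \<Delta> a" "local_datum \<Delta> a \<tau> u"
    using assms by (auto simp: support_attained_def)
  then have "local_datum \<Delta> (multiple k a) \<tau> (int k *s u)"
    by (simp add: local_datum_def multiple_def pairing_commute[of "int k *s u"] pairing_simps)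
       (simp add: pairing_commute)
  then show "\<exists>u\<in>lattice_points \<Delta> (multiple k a). local_datum \<Delta> (multiple k a) \<tau> u"
    using lattice_points_multiple_scale[OF assms(1) u(1)] by blast
qed

text \<open>
  Translating by \<open>(k - 1) u\<^sub>0\<close> in every degree moves the semigroup of \<open>D\<close> into that of \<open>kD\<close>
  without changing differences of elements of equal degree.
\<close>

lemma generates_lattice_multiple:
  assumes k: "k \<ge> 1" and gen: "generates_lattice \<Delta> a" and u0: "u0 \<in> lattice_points \<Delta> a"
  shows "generates_lattice \<Delta> (multiple k a)"
proof -
  have shift: "(fst s + (snd s * (int k - 1)) *s u0, snd s) \<in> coord_semigroup \<Delta> (multiple k a)"
    if "s \<in> coord_semigroup \<Delta> a" for s
    using that
  proof induction
    case zero
    have "(0 :: int ^ 'a) + (0 * (int k - 1)) *s u0 = 0" by (simp add: vec_eq_iff)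
    then show ?case using coord_semigroup.zero by (simp add: zero_prod_def)
  next
    case (add s u)
    have "(1 / real k) *\<^sub>R rvec (u + (int k - 1) *s u0)
        = (1 / real k) *\<^sub>R rvec u + (1 - 1 / real k) *\<^sub>R rvec u0"
      using k by (simp add: vec_eq_iff field_simps)
    also have "\<dots> \<in> polytope_of \<Delta> a"
      using add u0 k by (intro convexD[OF convex_polytope_of]) (auto simp: lattice_points_def)
    finally have "u + (int k - 1) *s u0 \<in> lattice_points \<Delta> (multiple k a)"
      using k by (simp add: lattice_points_def polytope_of_multiple)
    from coord_semigroup.add[OF add.IH this] show ?case
      by (simp add: vec_eq_iff algebra_simps)
  qed
  show ?thesis unfolding generates_lattice_def
  proof
    fix m
    obtain s t where st: "s \<in> coord_semigroup \<Delta> a" "t \<in> coord_semigroup \<Delta> a" "s - t = (m, 0)"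
      using gen unfolding generates_lattice_def by blast
    then have "fst s - fst t = m" "snd s = snd t" by (auto simp: prod_eq_iff)
    then have "(fst s + (snd s * (int k - 1)) *s u0, snd s) - (fst t + (snd t * (int k - 1)) *s u0, snd t) = (m, 0)"
      by (simp add: algebra_simps)
    then show "\<exists>s\<in>coord_semigroup \<Delta> (multiple k a). \<exists>t\<in>coord_semigroup \<Delta> (multiple k a). s - t = (m, 0)"
      using shift st by blast
  qed
qed

text \<open>What remains of a toric pair once the field is forgotten. These conditions pass to
  \<open>multiple k a\<close> by a direct argument, so the results in the locale apply to
  \<open>D\<close> and to every \<open>kD\<close>.\<close>

locale lattice_polytope =
  fixes \<Delta> :: "(real ^ 'n::finite) set set" and a :: "int ^ 'n \<Rightarrow> int"
  assumes fan: "complete_fan \<Delta>" and att: "support_attained \<Delta> a" and gen: "generates_lattice \<Delta> a"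
begin

abbreviation "P \<equiv> polytope_of \<Delta> a"
abbreviation "L \<equiv> lattice_points \<Delta> a"
abbreviation "S \<equiv> coord_semigroup \<Delta> a"
abbreviation "C \<equiv> cone_over \<Delta> a"

lemma finite_L: "finite L" using fan att by (rule finite_lattice_points)
lemma L_nonempty: "L \<noteq> {}" using fan att by (rule support_attained_nonempty)
lemma P_eq: "P = convex hull (rvec ` L)" using fan att by (rule polytope_of_eq_hull)

lemma multiple: "k \<ge> 1 \<Longrightarrow> lattice_polytope \<Delta> (multiple k a)"
  using L_nonempty fan support_attained_multiple[OF _ att] generates_lattice_multiple[OF _ gen]
  by (auto simp: lattice_polytope_def)

lemma polytope_P: "polytope P"
  unfolding P_eq polytope_def using finite_L by blast

lemma compact_P: "compact P" using polytope_P by (rule polytope_imp_compact)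
lemma closed_P: "closed P" using polytope_P by (rule polytope_imp_closed)
lemma convex_P: "convex P" by (rule convex_polytope_of)
lemma P_nonempty: "P \<noteq> {}" using L_nonempty by (auto simp: lattice_points_def)

lemma mem_cone: "(x, z) \<in> C \<longleftrightarrow> z \<ge> 0 \<and> (\<exists>p\<in>P. x = z *\<^sub>R p)"
proof -
  have "convex hull (P \<times> {1::real}) = P \<times> {1}"
    by (intro convex_hull_eq[THEN iffD2] convex_Times convex_P) auto
  moreover have "P \<times> {1::real} \<noteq> {}" using P_nonempty by simp
  ultimately show ?thesis unfolding cone_over_def
    by (subst convex_cone_hull_convex_hull_nonempty) auto
qed

lemma mem_cone_pos: "z > 0 \<Longrightarrow> (x, z) \<in> C \<longleftrightarrow> (1 / z) *\<^sub>R x \<in> P"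
  unfolding mem_cone by (auto intro!: bexI[of _ "(1 / z) *\<^sub>R x"])

lemma closed_C: "closed C"
  unfolding cone_over_def
  by (intro polyhedron_imp_closed polyhedron_convex_cone_hull_polytope polytope_Times polytope_P polytope_sing)

lemma cone_add: "x \<in> C \<Longrightarrow> y \<in> C \<Longrightarrow> x + y \<in> C"
  unfolding cone_over_def by (rule convex_cone_hull_add)

lemma cone_scale: "x \<in> C \<Longrightarrow> c \<ge> 0 \<Longrightarrow> c *\<^sub>R x \<in> C"
  unfolding cone_over_def by (rule convex_cone_hull_mul)

lemma cone_lattice_point: "u \<in> L \<Longrightarrow> (rvec u, 1) \<in> C"
  by (auto simp: mem_cone lattice_points_def)

text \<open>The polytope is dilated by \<open>k\<close>, so its cone is \<open>C\<close> with
  heights multiplied by \<open>k\<close>; all multiples can be treated inside the one cone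
  \<open>C\<close>.\<close>

lemma cone_multiple:
  assumes "k \<ge> 1"
  shows "(x, z) \<in> cone_over \<Delta> (multiple k a) \<longleftrightarrow> (x, real k * z) \<in> C"
proof -
  have k: "real k > 0" using assms by simp
  have "(\<exists>p\<in>polytope_of \<Delta> (multiple k a). x = z *\<^sub>R p) \<longleftrightarrow> (\<exists>p\<in>P. x = (real k * z) *\<^sub>R p)"
  proof
    assume "\<exists>p\<in>polytope_of \<Delta> (multiple k a). x = z *\<^sub>R p"
    then obtain p where "p \<in> polytope_of \<Delta> (multiple k a)" "x = z *\<^sub>R p" by blast
    then show "\<exists>p\<in>P. x = (real k * z) *\<^sub>R p"
      using k polytope_of_multiple[OF assms, of p \<Delta> a] by (intro bexI[of _ "(1 / real k) *\<^sub>R p"]) auto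
  next
    assume "\<exists>p\<in>P. x = (real k * z) *\<^sub>R p"
    then obtain p where "p \<in> P" "x = (real k * z) *\<^sub>R p" by blast
    then show "\<exists>p\<in>polytope_of \<Delta> (multiple k a). x = z *\<^sub>R p"
      using k polytope_of_multiple[OF assms, of "real k *\<^sub>R p" \<Delta> a]
      by (intro bexI[of _ "real k *\<^sub>R p"]) (auto simp: mult.commute)
  qed
  then show ?thesis
    using lattice_polytope.mem_cone[OF multiple[OF assms], of x z] mem_cone[of x "real k * z"] k
    by (simp add: zero_le_mult_iff)
qed

lemma lattice_points_multiple:
  assumes "k \<ge> 1"
  shows "u \<in> lattice_points \<Delta> (multiple k a) \<longleftrightarrow> (rvec u, real k) \<in> C"
  using assms mem_cone_pos[of "real k" "rvec u"]
  by (simp add: lattice_points_def polytope_of_multiple)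

lemma semigroup_in_cone: "s \<in> S \<Longrightarrow> (rvec (fst s), real_of_int (snd s)) \<in> C"
proof (induction rule: coord_semigroup.induct)
  case zero
  then show ?case using P_nonempty by (auto simp: mem_cone)
next
  case (add s u)
  from cone_add[OF add(3) cone_lattice_point[OF add(2)]] show ?case by simp
qed

lemma cone_coefficients:
  assumes "(x, z) \<in> C"
  obtains c where "\<And>u. u \<in> L \<Longrightarrow> c u \<ge> 0" "x = (\<Sum>u\<in>L. c u *\<^sub>R rvec u)" "z = sum c L"
proof -
  obtain p where p: "p \<in> P" "x = z *\<^sub>R p" "z \<ge> 0" using assms by (auto simp: mem_cone)
  obtain \<mu> where \<mu>: "\<forall>x\<in>rvec ` L. 0 \<le> \<mu> x" "sum \<mu> (rvec ` L) = 1" "(\<Sum>x\<in>rvec ` L. \<mu> x *\<^sub>R x) = p"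
    using p(1) finite_L unfolding P_eq by (subst (asm) convex_hull_finite) auto
  have inj: "inj_on rvec L" by (simp add: inj_on_def)
  show thesis
  proof
    show "z * \<mu> (rvec u) \<ge> 0" if "u \<in> L" for u using \<mu>(1) p(3) that by simp
    show "x = (\<Sum>u\<in>L. (z * \<mu> (rvec u)) *\<^sub>R rvec u)"
      using \<mu>(3) by (simp add: p(2) sum.reindex[OF inj] scaleR_sum_right[symmetric] flip: scaleR_scaleR)
    show "z = (\<Sum>u\<in>L. z * \<mu> (rvec u))"
      using \<mu>(2) by (simp add: sum.reindex[OF inj] sum_distrib_left[symmetric])
  qed
qed

lemma lattice_combination:
  assumes "\<And>u. u \<in> A \<Longrightarrow> u \<in> L"
  shows "(\<Sum>u\<in>A. int (n u) *s u, int (sum n A)) \<in> S"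
proof -
  have "(\<Sum>u\<in>A. (int (n u) *s u, int (n u) * 1)) \<in> S"
    using assms by (intro coord_semigroup_sum coord_semigroup_scale coord_semigroup_generator)
  then show ?thesis by (simp add: sum_prod)
qed

text \<open>Subtracting \<open>j\<close> copies of one generator reduces to degree zero, where
  \<open>gen\<close> applies.\<close>

lemma difference_of_semigroup:
  assumes "j \<ge> 0"
  shows "\<exists>t\<in>S. (m, j) + t \<in> S"
proof -
  obtain u where u: "u \<in> L" using L_nonempty by blast
  obtain s t where st: "s \<in> S" "t \<in> S" "s - t = (m - j *s u, 0)"
    using gen unfolding generates_lattice_def by blast
  have "(int (nat j) *s u, int (nat j) * 1) \<in> S"
    by (intro coord_semigroup_scale coord_semigroup_generator u)
  then have "s + (j *s u, j) \<in> S" using assms st by (intro coord_semigroup_add) auto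
  moreover have "s + (j *s u, j) = (m, j) + t" using st(3) by (cases s, cases t) (auto simp: algebra_simps)
  ultimately show ?thesis using st(2) by auto
qed

text \<open>
  Subtracting the integral parts of the coefficients from a lattice point of the cone leaves one of
  finitely many remainders, and a single element of \<open>S\<close> moves all of these into \<open>S\<close>.
\<close>

lemma conductor:
  "\<exists>c j0. \<forall>x j. (rvec (x - c), real_of_int (j - j0)) \<in> C \<longrightarrow> (x, j) \<in> S"
proof -
  \<comment> \<open>\<open>B\<close> and \<open>card L\<close> bound the coordinates and the degree
    of a remainder whose coefficients all lie in \<open>[0, 1]\<close>.\<close>
  define B where "B = (\<Sum>u\<in>L. \<Sum>i\<in>UNIV. \<bar>u $ i\<bar>)"
  define F :: "((int ^ 'n) \<times> int) set" where "F = {y. \<forall>i. \<bar>y $ i\<bar> \<le> B} \<times> {0..int (card L)}"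
  have finF: "finite F" unfolding F_def using finite_int_vectors_bounded by (rule finite_cartesian_product) auto
  have "\<forall>f\<in>F. \<exists>t\<in>S. f + t \<in> S" using difference_of_semigroup by (auto simp: F_def)
  then obtain \<tau> where \<tau>: "\<And>f. f \<in> F \<Longrightarrow> \<tau> f \<in> S \<and> f + \<tau> f \<in> S" by metis
  \<comment> \<open>Adding all the \<open>\<tau> f\<close> at once works for every single
    \<open>f\<close>, because the surplus terms are themselves in \<open>S\<close>.\<close>
  define c where "c = sum \<tau> F"
  have Fc: "f + c \<in> S" if "f \<in> F" for f
  proof -
    have "f + c = (f + \<tau> f) + sum \<tau> (F - {f})"
      using finF that by (simp add: c_def sum.remove add.assoc)
    moreover have "sum \<tau> (F - {f}) \<in> S" using \<tau> by (intro coord_semigroup_sum) auto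
    ultimately show ?thesis using \<tau>[OF that] coord_semigroup_add by metis
  qed
  show ?thesis
  proof (intro exI allI impI)
    fix x j assume xj: "(rvec (x - fst c), real_of_int (j - snd c)) \<in> C"
    obtain l where l: "\<And>u. u \<in> L \<Longrightarrow> l u \<ge> 0"
      "rvec (x - fst c) = (\<Sum>u\<in>L. l u *\<^sub>R rvec u)" "real_of_int (j - snd c) = sum l L"
      using cone_coefficients[OF xj] by metis
    define n where "n u = nat \<lfloor>l u\<rfloor>" for u
    have n: "real (n u) \<le> l u" "l u \<le> real (n u) + 1" if "u \<in> L" for u
      using l(1)[OF that] by (auto simp: n_def)
    define y where "y = x - fst c - (\<Sum>u\<in>L. int (n u) *s u)"
    define i where "i = j - snd c - int (sum n L)"
    have y: "real_of_int (y $ e) = (\<Sum>u\<in>L. (l u - real (n u)) * real_of_int (u $ e))" for e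
    proof -
      have "real_of_int (y $ e) = rvec (x - fst c) $ e - (\<Sum>u\<in>L. real (n u) * real_of_int (u $ e))"
        by (simp add: y_def)
      also have "\<dots> = (\<Sum>u\<in>L. (l u - real (n u)) * real_of_int (u $ e))"
        unfolding l(2) by (simp add: sum_subtractf left_diff_distrib)
      finally show ?thesis .
    qed
    have "\<bar>real_of_int (y $ e)\<bar> \<le> real_of_int B" for e
    proof -
      have "\<bar>real_of_int (y $ e)\<bar> \<le> (\<Sum>u\<in>L. \<bar>(l u - real (n u)) * real_of_int (u $ e)\<bar>)"
        unfolding y by (rule sum_abs)
      also have "\<dots> \<le> (\<Sum>u\<in>L. real_of_int (\<Sum>i\<in>UNIV. \<bar>u $ i\<bar>))"
      proof (rule sum_mono)
        fix u assume u: "u \<in> L"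
        have "\<bar>(l u - real (n u)) * real_of_int (u $ e)\<bar> \<le> 1 * \<bar>real_of_int (u $ e)\<bar>"
          unfolding abs_mult using n[OF u] by (intro mult_right_mono) auto
        also have "\<bar>u $ e\<bar> \<le> (\<Sum>i\<in>UNIV. \<bar>u $ i\<bar>)" by (rule member_le_sum) auto
        then have "1 * \<bar>real_of_int (u $ e)\<bar> \<le> real_of_int (\<Sum>i\<in>UNIV. \<bar>u $ i\<bar>)" by linarith
        finally show "\<bar>(l u - real (n u)) * real_of_int (u $ e)\<bar> \<le> real_of_int (\<Sum>i\<in>UNIV. \<bar>u $ i\<bar>)" .
      qed
      also have "\<dots> = real_of_int B" by (simp add: B_def)
      finally show ?thesis .
    qed
    then have "\<bar>y $ e\<bar> \<le> B" for e by (metis of_int_abs of_int_le_iff)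
    moreover have i: "real_of_int i = (\<Sum>u\<in>L. l u - real (n u))"
      using l(3) by (simp add: i_def sum_subtractf)
    have "0 \<le> real_of_int i" unfolding i using n by (intro sum_nonneg) simp
    moreover have "real_of_int i \<le> (\<Sum>u\<in>L. 1)" unfolding i using n by (intro sum_mono) (simp add: algebra_simps)
    ultimately have "\<forall>e. \<bar>y $ e\<bar> \<le> B" "0 \<le> i" "i \<le> int (card L)" by simp_all
    then have "(y, i) \<in> F" unfolding F_def by (intro SigmaI CollectI) simp_all
    then have "(\<Sum>u\<in>L. int (n u) *s u, int (sum n L)) + ((y, i) + c) \<in> S"
      using Fc lattice_combination[of L n] coord_semigroup_add by blast
    moreover have "(\<Sum>u\<in>L. int (n u) *s u, int (sum n L)) + ((y, i) + c) = (x, j)"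
      by (cases c) (simp add: y_def i_def)
    ultimately show "(x, j) \<in> S" by simp
  qed
qed

text \<open>If \<open>P\<close> lay in a hyperplane with normal \<open>e\<close> and value
  \<open>b\<close>, then \<open>e\<close> would be \<open>b\<close> times the degree on
  \<open>S\<close> and vanish on differences of equal degree, hence on the whole lattice.\<close>

lemma P_ball:
  obtains p r where "r > 0" "cball p r \<subseteq> P"
proof -
  have "interior P \<noteq> {}"
  proof
    assume "interior P = {}"
    then obtain e b where e: "e \<noteq> 0" "P \<subseteq> {x. e \<bullet> x = b}"
      using empty_interior_subset_hyperplane[OF convex_P] by metis
    have S: "e \<bullet> rvec (fst s) = b * real_of_int (snd s)" if "s \<in> S" for s
      using that
    proof induction
      case (add s u)
      then have "rvec u \<in> P" by (simp add: lattice_points_def)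
      then have "e \<bullet> rvec u = b" using e(2) by blast
      with add show ?case by (simp add: inner_simps algebra_simps)
    qed simp
    have "e \<bullet> rvec m = 0" for m
    proof -
      obtain s t where "s \<in> S" "t \<in> S" "s - t = (m, 0)"
        using gen unfolding generates_lattice_def by blast
      then have "rvec m = rvec (fst s) - rvec (fst t)" "snd s = snd t" by (auto simp: prod_eq_iff)
      then show ?thesis using S[OF \<open>s \<in> S\<close>] S[OF \<open>t \<in> S\<close>] by (simp add: inner_diff_right)
    qed
    then have "e $ i = 0" for i
      using \<open>\<And>m. e \<bullet> rvec m = 0\<close>[of "axis i 1"]
      by (simp add: rvec_def axis_def inner_vec_def if_distrib[of real_of_int] if_distrib[of "(*) _"] cong: if_cong)
    with e(1) show False by (simp add: vec_eq_iff)
  qed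
  then obtain p where "p \<in> interior P" by blast
  then show thesis using that by (auto simp: mem_interior_cball)
qed

end


section \<open>Lattice point counts\<close>

text \<open>Dominated convergence for indicator functions, with the fixed box as majorant.\<close>

lemma measure_lebesgue_tendsto:
  fixes U :: "nat \<Rightarrow> (real ^ 'n::finite) set"
  assumes U: "\<And>m. U m \<in> sets lebesgue" and E: "E \<in> sets lebesgue"
    and bd: "\<And>m. U m \<subseteq> cbox a b"
    and conv: "AE y in lebesgue. \<forall>\<^sub>F m in sequentially. y \<in> U m \<longleftrightarrow> y \<in> E"
  shows "(\<lambda>m. measure lebesgue (U m)) \<longlonglongrightarrow> measure lebesgue E"
proof -
  have "(\<lambda>m. integral\<^sup>L lebesgue (indicator (U m) :: _ \<Rightarrow> real)) \<longlonglongrightarrow> integral\<^sup>L lebesgue (indicator E :: _ \<Rightarrow> real)"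
  proof (rule integral_dominated_convergence[where w = "indicator (cbox a b)"])
    show "integrable lebesgue (indicator (cbox a b) :: _ \<Rightarrow> real)"
      by (intro integrable_real_indicator) (auto simp: emeasure_lborel_cbox_eq)
    show "AE y in lebesgue. (\<lambda>m. indicator (U m) y :: real) \<longlonglongrightarrow> indicator E y"
      using conv
    proof eventually_elim
      case (elim y)
      then show ?case by (intro tendsto_eventually) (auto elim!: eventually_mono simp: indicator_def)
    qed
    show "AE y in lebesgue. norm (indicator (U m) y :: real) \<le> indicator (cbox a b) y" for m
      using bd[of m] by (auto simp: indicator_def)
  qed (use U E in auto)
  then show ?thesis by simp
qed

text \<open>Its fibres are half-open cells, so every point belongs to exactly one lattice point and
  counts become volumes without overlap.\<close>

definition floor_vec :: "real ^ 'n \<Rightarrow> int ^ 'n"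
  where "floor_vec y = (\<chi> i. \<lfloor>y $ i\<rfloor>)"

lemma floor_vec_eq_iff:
  "floor_vec y = x \<longleftrightarrow> (\<forall>i. real_of_int (x $ i) \<le> y $ i \<and> y $ i < real_of_int (x $ i) + 1)"
  by (simp add: floor_vec_def vec_eq_iff floor_eq_iff)

lemma norm_floor_vec: "norm (y - rvec (floor_vec y)) \<le> real CARD('n)" for y :: "real ^ 'n::finite"
proof -
  have "norm (y - rvec (floor_vec y)) \<le> (\<Sum>i\<in>UNIV. \<bar>(y - rvec (floor_vec y)) $ i\<bar>)"
    by (rule norm_le_l1_cart)
  also have "\<dots> \<le> (\<Sum>i\<in>(UNIV :: 'n set). 1)"
    by (rule sum_mono) (simp add: floor_vec_def, linarith)
  finally show ?thesis by simp
qed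

lemma floor_cell:
  fixes x :: "int ^ 'n::finite"
  assumes r: "r > 0"
  shows "{y. floor_vec (r *\<^sub>R y) = x} \<in> lmeasurable"
    and "measure lebesgue {y. floor_vec (r *\<^sub>R y) = x} = 1 / r ^ CARD('n)"
    and "negligible (cbox ((1 / r) *\<^sub>R rvec x) ((1 / r) *\<^sub>R (rvec x + 1)) - {y. floor_vec (r *\<^sub>R y) = x})"
    and "{y. floor_vec (r *\<^sub>R y) = x} \<subseteq> cbox ((1 / r) *\<^sub>R rvec x) ((1 / r) *\<^sub>R (rvec x + 1))"
proof -
  let ?a = "(1 / r) *\<^sub>R rvec x" and ?b = "(1 / r) *\<^sub>R (rvec x + 1)" and ?F = "{y. floor_vec (r *\<^sub>R y) = x}"
  have *: "y \<in> ?F \<longleftrightarrow> (\<forall>i. ?a $ i \<le> y $ i \<and> y $ i < ?b $ i)" for y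
    using r by (simp add: floor_vec_eq_iff field_simps)
  show sub: "?F \<subseteq> cbox ?a ?b" using * by (fastforce simp: mem_box_cart less_imp_le)
  have "cbox ?a ?b - ?F \<subseteq> cbox ?a ?b - box ?a ?b"
    using * by (fastforce simp: mem_box_cart less_imp_le)
  then show neg: "negligible (cbox ?a ?b - ?F)"
    using negligible_frontier_interval negligible_subset by blast
  have neg': "negligible (cbox ?a ?b - ?F \<union> (?F - cbox ?a ?b))" using neg sub by (simp add: Diff_eq_empty_iff[THEN iffD2])
  show "?F \<in> lmeasurable" by (rule lmeasurable_negligible_symdiff[OF _ neg']) simp
  have "measure lebesgue ?F = measure lebesgue (cbox ?a ?b)"
    by (rule measure_negligible_symdiff[OF _ neg']) simp
  also have "\<dots> = (\<Prod>i\<in>(UNIV :: 'n set). ?b $ i - ?a $ i)"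
  proof (subst content_cbox_cart[symmetric])
    have "?a \<in> cbox ?a ?b" using r by (simp add: mem_box_cart divide_right_mono)
    then show "cbox ?a ?b \<noteq> {}" by blast
  qed simp
  also have "\<dots> = 1 / r ^ CARD('n)" by (simp add: field_simps power_one_over flip: diff_divide_distrib)
  finally show "measure lebesgue ?F = 1 / r ^ CARD('n)" .
qed

lemma floor_cells_union:
  fixes A :: "(int ^ 'n::finite) set"
  assumes r: "r > 0" and A: "finite A"
  shows "{y. floor_vec (r *\<^sub>R y) \<in> A} \<in> lmeasurable"
    and "measure lebesgue {y. floor_vec (r *\<^sub>R y) \<in> A} = real (card A) / r ^ CARD('n)"
proof -
  have eq: "{y. floor_vec (r *\<^sub>R y) \<in> A} = (\<Union>x\<in>A. {y. floor_vec (r *\<^sub>R y) = x})" by auto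
  show "{y. floor_vec (r *\<^sub>R y) \<in> A} \<in> lmeasurable" unfolding eq
    using A by (intro fmeasurable.finite_UN) (auto intro: floor_cell[OF r])
  have "measure lebesgue {y. floor_vec (r *\<^sub>R y) \<in> A} = (\<Sum>x\<in>A. measure lebesgue {y. floor_vec (r *\<^sub>R y) = x})"
    unfolding eq by (rule measure_UNION') (auto simp: A floor_cell[OF r] pairwise_def disjnt_def)
  then show "measure lebesgue {y. floor_vec (r *\<^sub>R y) \<in> A} = real (card A) / r ^ CARD('n)"
    by (simp add: floor_cell(2)[OF r])
qed

text \<open>The quotient is the volume of the union of cells of side \<open>1 / r m\<close> placed
  at the points \<open>x / r m\<close>; the hypothesis \<open>conv\<close> says that these unions
  converge to \<open>E\<close> almost everywhere.\<close>

lemma card_lattice_tendsto: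
  fixes A :: "nat \<Rightarrow> (int ^ 'n::finite) set"
  assumes r: "\<And>m. r m \<ge> 1"
    and bd: "\<And>m x i. x \<in> A m \<Longrightarrow> \<bar>real_of_int (x $ i)\<bar> \<le> B * r m"
    and E: "E \<in> sets lebesgue"
    and conv: "AE y in lebesgue. \<forall>\<^sub>F m in sequentially. floor_vec (r m *\<^sub>R y) \<in> A m \<longleftrightarrow> y \<in> E"
  shows "(\<lambda>m. real (card (A m)) / r m ^ CARD('n)) \<longlonglongrightarrow> measure lebesgue E"
proof -
  have rpos: "r m > 0" for m using r[of m] by simp
  have fin: "finite (A m)" for m
  proof (rule finite_subset[OF _ finite_int_vectors_bounded[of "\<lceil>B * r m\<rceil>"]], rule subsetI, rule CollectI, rule allI)
    fix x i assume "x \<in> A m"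
    from bd[OF this, of i] show "\<bar>x $ i\<bar> \<le> \<lceil>B * r m\<rceil>" by linarith
  qed
  have "(\<lambda>m. measure lebesgue {y. floor_vec (r m *\<^sub>R y) \<in> A m}) \<longlonglongrightarrow> measure lebesgue E"
  \<comment> \<open>The extra \<open>1\<close> covers the side of a cell, which is at most
    \<open>1\<close> since \<open>r m \<ge> 1\<close>.\<close>
  proof (rule measure_lebesgue_tendsto[OF _ E, where a = "\<chi> i. - (B + 1)" and b = "\<chi> i. B + 1"])
    show "{y. floor_vec (r m *\<^sub>R y) \<in> A m} \<in> sets lebesgue" for m
      using floor_cells_union(1)[OF rpos fin] by blast
    show "{y. floor_vec (r m *\<^sub>R y) \<in> A m} \<subseteq> cbox (\<chi> i. - (B + 1)) (\<chi> i. B + 1)" for m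
    proof
      fix y assume "y \<in> {y. floor_vec (r m *\<^sub>R y) \<in> A m}"
      then have "\<bar>y $ i\<bar> \<le> B + 1" for i
      proof -
        have "\<bar>real_of_int (floor_vec (r m *\<^sub>R y) $ i)\<bar> \<le> B * r m"
          using bd \<open>y \<in> _\<close> by blast
        then have "\<bar>r m * y $ i\<bar> \<le> B * r m + 1" by (simp add: floor_vec_def) linarith
        then have "r m * \<bar>y $ i\<bar> \<le> r m * (B + 1)" using r[of m] by (simp add: abs_mult algebra_simps)
        then show ?thesis using rpos[of m] by simp
      qed
      then show "y \<in> cbox (\<chi> i. - (B + 1)) (\<chi> i. B + 1)"
        unfolding mem_box_cart abs_le_iff vec_lambda_beta by (metis minus_le_iff)
    qed
  qed (use conv in simp)
  then show ?thesis by (simp add: floor_cells_union(2)[OF rpos fin])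
qed

lemma floor_vec_scaled_tendsto:
  fixes y :: "real ^ 'n::finite"
  assumes "filterlim r at_top F"
  shows "((\<lambda>m. (1 / r m) *\<^sub>R rvec (floor_vec (r m *\<^sub>R y))) \<longlongrightarrow> y) F"
proof (rule Lim_transform2)
  show "((\<lambda>m. y) \<longlongrightarrow> y) F" by simp
  have "\<forall>\<^sub>F m in F. r m > 0" using assms by (simp add: filterlim_at_top_dense)
  then have "\<forall>\<^sub>F m in F. norm (y - (1 / r m) *\<^sub>R rvec (floor_vec (r m *\<^sub>R y))) \<le> real CARD('n) * (1 / r m)"
  proof eventually_elim
    case (elim m)
    have "y - (1 / r m) *\<^sub>R rvec (floor_vec (r m *\<^sub>R y)) = (1 / r m) *\<^sub>R (r m *\<^sub>R y - rvec (floor_vec (r m *\<^sub>R y)))"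
      using elim by (simp add: scaleR_diff_right)
    then show ?case using elim norm_floor_vec[of "r m *\<^sub>R y"] by (simp add: divide_right_mono)
  qed
  moreover have "((\<lambda>m. real CARD('n) * (1 / r m)) \<longlongrightarrow> 0) F"
    by (intro tendsto_mult_right_zero tendsto_divide_0[OF tendsto_const] filterlim_at_top_imp_at_infinity assms)
  ultimately show "((\<lambda>m. y - (1 / r m) *\<^sub>R rvec (floor_vec (r m *\<^sub>R y))) \<longlongrightarrow> 0) F"
    by (rule Lim_null_comparison)
qed

lemma floor_scaled_tendsto:
  fixes t :: real
  assumes "filterlim r at_top F"
  shows "((\<lambda>m. real_of_int \<lfloor>r m * t\<rfloor> / r m) \<longlongrightarrow> t) F"
proof -
  have "((\<lambda>m. (1 / r m) *\<^sub>R rvec (floor_vec (r m *\<^sub>R ((\<chi> i. t) :: real ^ 1)))) \<longlongrightarrow> (\<chi> i. t)) F"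
    using assms by (rule floor_vec_scaled_tendsto)
  from tendsto_vec_nth[OF this, of 1] show ?thesis by (simp add: floor_vec_def)
qed

section \<open>Asymptotic comparison of the semigroup with its cone\<close>

context lattice_polytope
begin

text \<open>\<open>S\<close> lies in a closed cone, so a limit outside the cone excludes all nearby
  rescaled points.\<close>

lemma semigroup_eventually_notin:
  assumes r: "filterlim r at_top F"
    and x: "((\<lambda>m. (1 / r m) *\<^sub>R rvec (x m)) \<longlongrightarrow> y) F" and j: "((\<lambda>m. real_of_int (j m) / r m) \<longlongrightarrow> s) F"
    and out: "(y, s) \<notin> C"
  shows "\<forall>\<^sub>F m in F. (x m, j m) \<notin> S"
proof -
  have "((\<lambda>m. ((1 / r m) *\<^sub>R rvec (x m), real_of_int (j m) / r m)) \<longlongrightarrow> (y, s)) F"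
    by (intro tendsto_Pair x j)
  then have "\<forall>\<^sub>F m in F. ((1 / r m) *\<^sub>R rvec (x m), real_of_int (j m) / r m) \<in> - C"
    using closed_C out by (intro topological_tendstoD) auto
  moreover have "\<forall>\<^sub>F m in F. r m > 0" using r by (simp add: filterlim_at_top_dense)
  ultimately show ?thesis
  proof eventually_elim
    case (elim m)
    show ?case
    proof
      assume "(x m, j m) \<in> S"
      then have "(1 / r m) *\<^sub>R (rvec (x m), real_of_int (j m)) \<in> C"
        using semigroup_in_cone elim(2) by (intro cone_scale) auto
      with elim(1) show False by simp
    qed
  qed
qed

text \<open>After division by \<open>r m\<close> the shift by the conductor tends to zero and cannot
  push the points out of the open cone.\<close>

lemma semigroup_eventually_in:
  assumes r: "filterlim r at_top F"
    and x: "((\<lambda>m. (1 / r m) *\<^sub>R rvec (x m)) \<longlongrightarrow> y) F" and j: "((\<lambda>m. real_of_int (j m) / r m) \<longlongrightarrow> s) F"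
    and int: "(y, s) \<in> interior C"
  shows "\<forall>\<^sub>F m in F. (x m, j m) \<in> S"
proof -
  obtain c j0 where c: "\<And>x j. (rvec (x - c), real_of_int (j - j0)) \<in> C \<Longrightarrow> (x, j) \<in> S"
    using conductor by blast
  have inv: "((\<lambda>m. 1 / r m) \<longlongrightarrow> 0) F"
    using r by (intro tendsto_divide_0[OF tendsto_const] filterlim_at_top_imp_at_infinity)
  have "((\<lambda>m. ((1 / r m) *\<^sub>R rvec (x m) - (1 / r m) *\<^sub>R rvec c, real_of_int (j m) / r m - (1 / r m) * real_of_int j0))
      \<longlongrightarrow> (y - 0 *\<^sub>R rvec c, s - 0 * real_of_int j0)) F"
    by (intro tendsto_Pair tendsto_diff x j tendsto_scaleR tendsto_mult inv tendsto_const)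
  then have "\<forall>\<^sub>F m in F. ((1 / r m) *\<^sub>R rvec (x m) - (1 / r m) *\<^sub>R rvec c,
      real_of_int (j m) / r m - (1 / r m) * real_of_int j0) \<in> interior C"
    using int by (intro topological_tendstoD) auto
  moreover have "\<forall>\<^sub>F m in F. r m > 0" using r by (simp add: filterlim_at_top_dense)
  ultimately show ?thesis
  proof eventually_elim
    case (elim m)
    have "r m *\<^sub>R ((1 / r m) *\<^sub>R rvec (x m) - (1 / r m) *\<^sub>R rvec c,
      real_of_int (j m) / r m - (1 / r m) * real_of_int j0) \<in> C"
      using elim interior_subset by (intro cone_scale) auto
    then have "(rvec (x m - c), real_of_int (j m - j0)) \<in> C"
      using elim(2) by (simp add: scaleR_diff_right right_diff_distrib)
    then show ?case by (rule c)
  qed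
qed

lemma interior_cone:
  assumes "s > 0" "(1 / s) *\<^sub>R y \<in> interior P"
  shows "(y, s) \<in> interior C"
proof (rule interiorI)
  let ?U = "{x :: (real ^ 'n) \<times> real. snd x > 0} \<inter> (\<lambda>x. (1 / snd x) *\<^sub>R fst x) -` interior P"
  show "open ?U"
  proof (rule continuous_open_preimage)
    show "continuous_on {x :: (real ^ 'n) \<times> real. snd x > 0} (\<lambda>x. (1 / snd x) *\<^sub>R fst x)"
      by (intro continuous_intros) auto
    show "open {x :: (real ^ 'n) \<times> real. snd x > 0}"
      by (intro open_Collect_less continuous_intros)
  qed simp
  show "(y, s) \<in> ?U" using assms by simp
  show "?U \<subseteq> C" using interior_subset[of P] by (auto simp: mem_cone_pos)
qed

text \<open>At positive height the boundary of \<open>C\<close> lies in a dilate of the frontier of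
  the convex set \<open>P\<close>; at height zero the slice is just the apex.\<close>

lemma negligible_cone_slice:
  assumes "s \<ge> 0"
  shows "negligible {y. (y, s) \<in> C - interior C}"
proof (cases "s = 0")
  case True
  then have "{y. (y, s) \<in> C - interior C} \<subseteq> {0}" by (auto simp: mem_cone)
  then show ?thesis using negligible_sing negligible_subset by blast
next
  case False
  then have s: "s > 0" using assms by simp
  have "{y. (y, s) \<in> C - interior C} \<subseteq> (\<lambda>x. s *\<^sub>R x) ` frontier P"
  proof
    fix y assume "y \<in> {y. (y, s) \<in> C - interior C}"
    then have "(1 / s) *\<^sub>R y \<in> frontier P"
      using interior_cone[OF s] s closed_P by (auto simp: mem_cone_pos frontier_def)
    moreover have "y = s *\<^sub>R ((1 / s) *\<^sub>R y)" using s by simp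
    ultimately show "y \<in> (\<lambda>x. s *\<^sub>R x) ` frontier P" by blast
  qed
  moreover have "negligible ((\<lambda>x. s *\<^sub>R x) ` frontier P)"
    by (rule negligible_differentiable_image_negligible[OF order_refl negligible_convex_frontier[OF convex_P]])
       (rule linear_imp_differentiable_on, simp add: linear_iff algebra_simps)
  ultimately show ?thesis using negligible_subset by blast
qed

lemma negligible_cone_slice_translate:
  assumes "s \<ge> 0"
  shows "negligible {y. (y - w, s) \<in> C - interior C}"
proof -
  have "{y. (y - w, s) \<in> C - interior C} = (+) w ` {y. (y, s) \<in> C - interior C}"
    by (auto simp: image_iff intro!: exI[of _ "_ - w"])
  then show ?thesis using negligible_translation[OF negligible_cone_slice[OF assms]] by simp
qed

lemma closed_cone_slice: "closed {y. (y - w, s) \<in> C}"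
proof -
  have "closed ((\<lambda>y. (y - w, s)) -` C)"
    by (intro closed_vimage closed_C continuous_intros)
  then show ?thesis by (simp add: vimage_def)
qed

lemma P_bounded: "\<exists>B>0. \<forall>p\<in>P. norm p \<le> B"
  using compact_imp_bounded[OF compact_P] unfolding bounded_pos by blast

lemma cone_norm_le:
  assumes "\<And>p. p \<in> P \<Longrightarrow> norm p \<le> B" "(x, z) \<in> C"
  shows "norm x \<le> z * B"
  using assms by (auto simp: mem_cone intro!: mult_left_mono)

lemma AE_not_negligible: "negligible N \<Longrightarrow> AE y in lebesgue. y \<notin> N"
  by (rule AE_not_in) (simp add: negligible_iff_null_sets)

text \<open>The limit shape in degree \<open>q (t + 1)\<close> after division by \<open>q\<close>:
  subtracting \<open>q\<close> times \<open>(u, 1)\<close> becomes subtracting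
  \<open>(u, 1)\<close>.\<close>

definition HK_region :: "real \<Rightarrow> (real ^ 'n) set"
  where "HK_region t = {y. (y, t + 1) \<in> C \<and> (\<forall>u\<in>L. (y - rvec u, t) \<notin> C)}"

lemma HK_region_measurable: "HK_region t \<in> sets lebesgue"
proof -
  have "HK_region t = {y. (y - 0, t + 1) \<in> C} - (\<Union>u\<in>L. {y. (y - rvec u, t) \<in> C})"
    by (auto simp: HK_region_def)
  also have "\<dots> \<in> sets borel"
    using finite_L by (intro sets.Diff sets.finite_UN borel_closed closed_cone_slice)
  finally show ?thesis by simp
qed

lemma semigroup_degree_bounded:
  "\<exists>B>0. \<forall>x j i. (x, j) \<in> S \<longrightarrow> \<bar>real_of_int (x $ i)\<bar> \<le> B * real_of_int j"
proof -
  obtain B where B: "B > 0" "\<And>p. p \<in> P \<Longrightarrow> norm p \<le> B" using P_bounded by blast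
  have "\<bar>real_of_int (x $ i)\<bar> \<le> B * real_of_int j" if "(x, j) \<in> S" for x j i
    using cone_norm_le[OF B(2), of "rvec x" "real_of_int j"] semigroup_in_cone[OF that]
      component_le_norm_cart[of "rvec x" i] by (simp add: mult.commute)
  with B(1) show ?thesis by blast
qed

lemma finite_degree: "finite {x. (x, j) \<in> S}"
proof -
  obtain B where B: "\<And>x j i. (x, j) \<in> S \<Longrightarrow> \<bar>real_of_int (x $ i)\<bar> \<le> B * real_of_int j"
    using semigroup_degree_bounded by blast
  show ?thesis
  proof (rule finite_subset[OF _ finite_int_vectors_bounded[of "\<lceil>B * real_of_int j\<rceil>"]], rule subsetI, rule CollectI, rule allI)
    fix x i assume "x \<in> {x. (x, j) \<in> S}"
    then show "\<bar>x $ i\<bar> \<le> \<lceil>B * real_of_int j\<rceil>" using B[of x j i] by (simp, linarith)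
  qed
qed

text \<open>The shift to \<open>Suc m\<close> keeps the scale at least one, as
  \<open>card_lattice_tendsto\<close> demands.\<close>

lemma card_degree_tendsto:
  "(\<lambda>m. real (card {x. (x, int (Suc m)) \<in> S}) / real (Suc m) ^ CARD('n)) \<longlonglongrightarrow> measure lebesgue P"
proof -
  obtain B where B: "\<And>x j i. (x, j) \<in> S \<Longrightarrow> \<bar>real_of_int (x $ i)\<bar> \<le> B * real_of_int j"
    using semigroup_degree_bounded by blast
  have lim: "filterlim (\<lambda>m. real (Suc m)) at_top sequentially"
    using filterlim_real_sequentially by (rule filterlim_compose) (rule filterlim_Suc)
  show ?thesis
  proof (rule card_lattice_tendsto)
    show "P \<in> sets lebesgue" using closed_P by simp
    show "AE y in lebesgue. \<forall>\<^sub>F m in sequentially.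
        floor_vec (real (Suc m) *\<^sub>R y) \<in> {x. (x, int (Suc m)) \<in> S} \<longleftrightarrow> y \<in> P"
      using AE_not_negligible[OF negligible_cone_slice[OF zero_le_one]]
    proof eventually_elim
      case (elim y)
      have x: "((\<lambda>m. (1 / real (Suc m)) *\<^sub>R rvec (floor_vec (real (Suc m) *\<^sub>R y))) \<longlongrightarrow> y) sequentially"
        by (rule floor_vec_scaled_tendsto[OF lim])
      have j: "((\<lambda>m. real_of_int (int (Suc m)) / real (Suc m)) \<longlongrightarrow> 1) sequentially" by simp
      have "(y, 1) \<in> C \<longleftrightarrow> y \<in> P" by (simp add: mem_cone_pos)
      then consider "(y, 1) \<in> interior C" "y \<in> P" | "(y, 1) \<notin> C" "y \<notin> P" using elim by auto
      then show ?case
      proof cases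
        case 1
        with semigroup_eventually_in[OF lim x j] show ?thesis by (auto elim: eventually_mono)
      next
        case 2
        with semigroup_eventually_notin[OF lim x j] show ?thesis by (auto elim: eventually_mono)
      qed
    qed
    show "\<bar>real_of_int (x $ i)\<bar> \<le> B * real (Suc m)" if "x \<in> {x. (x, int (Suc m)) \<in> S}" for m x i
      using B[of x "int (Suc m)" i] that by simp
  qed simp
qed

text \<open>Off the null boundaries of the finitely many cones involved, a point is strictly inside
  or strictly outside each of them, and the semigroup eventually agrees. Finiteness of
  \<open>L\<close> makes the conditions for all \<open>u\<close> hold from one index on.\<close>

lemma card_HK_tendsto:
  assumes t: "t \<ge> 0" and q1: "\<And>m. q m \<ge> (1::nat)" and lim: "filterlim (\<lambda>m. real (q m)) at_top sequentially"
  shows "(\<lambda>m. real (card {x. (x, \<lfloor>real (q m) * (t + 1)\<rfloor>) \<in> S \<and>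
      (\<forall>u\<in>L. (x - int (q m) *s u, \<lfloor>real (q m) * (t + 1)\<rfloor> - int (q m)) \<notin> S)}) / real (q m) ^ CARD('n))
    \<longlonglongrightarrow> measure lebesgue (HK_region t)"
proof -
  obtain B where B: "B > 0" "\<And>x j i. (x, j) \<in> S \<Longrightarrow> \<bar>real_of_int (x $ i)\<bar> \<le> B * real_of_int j"
    using semigroup_degree_bounded by blast
  let ?j = "\<lambda>m. \<lfloor>real (q m) * (t + 1)\<rfloor>"
  have j: "((\<lambda>m. real_of_int (?j m) / real (q m)) \<longlongrightarrow> t + 1) sequentially"
    by (rule floor_scaled_tendsto[OF lim])
  have q0: "real (q m) \<noteq> 0" for m using q1[of m] by simp
  have j': "((\<lambda>m. real_of_int (?j m - int (q m)) / real (q m)) \<longlongrightarrow> t) sequentially"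
    using tendsto_diff[OF j tendsto_const[of 1]] by (simp add: diff_divide_distrib q0 del: of_nat_eq_0_iff)
  show ?thesis
  proof (rule card_lattice_tendsto)
    show "HK_region t \<in> sets lebesgue" by (rule HK_region_measurable)
    have "AE y in lebesgue. y \<notin> {y. (y, t + 1) \<in> C - interior C}"
      using t by (intro AE_not_negligible negligible_cone_slice) simp
    moreover have "AE y in lebesgue. \<forall>u\<in>L. y \<notin> {y. (y - rvec u, t) \<in> C - interior C}"
      using t finite_L by (intro AE_finite_allI AE_not_negligible negligible_cone_slice_translate)
    ultimately show "AE y in lebesgue. \<forall>\<^sub>F m in sequentially. floor_vec (real (q m) *\<^sub>R y) \<in>
        {x. (x, ?j m) \<in> S \<and> (\<forall>u\<in>L. (x - int (q m) *s u, ?j m - int (q m)) \<notin> S)} \<longleftrightarrow> y \<in> HK_region t"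
    proof eventually_elim
      case (elim y)
      let ?x = "\<lambda>m. floor_vec (real (q m) *\<^sub>R y)"
      have x: "((\<lambda>m. (1 / real (q m)) *\<^sub>R rvec (?x m)) \<longlongrightarrow> y) sequentially"
        by (rule floor_vec_scaled_tendsto[OF lim])
      have xu: "((\<lambda>m. (1 / real (q m)) *\<^sub>R rvec (?x m - int (q m) *s u)) \<longlongrightarrow> y - rvec u) sequentially" for u
        using tendsto_diff[OF x tendsto_const[of "rvec u"]] by (simp add: scaleR_diff_right q0 del: of_nat_eq_0_iff)
      consider (out) "(y, t + 1) \<notin> C"
        | (hit) u where "u \<in> L" "(y - rvec u, t) \<in> interior C"
        | (good) "(y, t + 1) \<in> interior C" "\<forall>u\<in>L. (y - rvec u, t) \<notin> C"
        using elim by blast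
      then show ?case
      proof cases
        case out
        have "\<forall>\<^sub>F m in sequentially. (?x m, ?j m) \<notin> S"
          by (rule semigroup_eventually_notin[OF lim x j out])
        moreover have "y \<notin> HK_region t" using out by (simp add: HK_region_def)
        ultimately show ?thesis by (auto elim: eventually_mono)
      next
        case hit
        have "\<forall>\<^sub>F m in sequentially. (?x m - int (q m) *s u, ?j m - int (q m)) \<in> S"
          by (rule semigroup_eventually_in[OF lim xu j' hit(2)])
        moreover have "y \<notin> HK_region t" using hit interior_subset by (auto simp: HK_region_def)
        ultimately show ?thesis using hit(1) by simp (auto elim!: eventually_mono)
      next
        case good
        have "\<forall>\<^sub>F m in sequentially. (?x m, ?j m) \<in> S"
          by (rule semigroup_eventually_in[OF lim x j good(1)])
        moreover have "\<forall>\<^sub>F m in sequentially. \<forall>u\<in>L. (?x m - int (q m) *s u, ?j m - int (q m)) \<notin> S"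
          using good(2) semigroup_eventually_notin[OF lim xu j'] by (intro eventually_ball_finite finite_L) blast
        moreover have y: "y \<in> HK_region t" using good interior_subset by (auto simp: HK_region_def)
        ultimately show ?thesis by (simp add: eventually_conj_iff y)
      qed
    qed
    show "\<bar>real_of_int (x $ i)\<bar> \<le> (B * (t + 1)) * real (q m)"
      if "x \<in> {x. (x, ?j m) \<in> S \<and> (\<forall>u\<in>L. (x - int (q m) *s u, ?j m - int (q m)) \<notin> S)}" for m x i
    proof -
      have "\<bar>real_of_int (x $ i)\<bar> \<le> B * real_of_int (?j m)" using B(2) that by blast
      also have "\<dots> \<le> B * (real (q m) * (t + 1))" using B(1) by (intro mult_left_mono) auto
      finally show ?thesis by (simp add: algebra_simps)
    qed
  qed (use q1 in simp)
qed

end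


section \<open>Volume estimates\<close>

lemma power_diff_le:
  fixes x y :: real
  assumes "0 \<le> y" "y \<le> x"
  shows "x ^ n - y ^ n \<le> real n * x ^ (n - 1) * (x - y)"
proof (induction n)
  case (Suc n)
  have "x ^ Suc n - y ^ Suc n = x * (x ^ n - y ^ n) + (x - y) * y ^ n" by (simp add: algebra_simps)
  also have "\<dots> \<le> x * (real n * x ^ (n - 1) * (x - y)) + (x - y) * x ^ n"
    using assms by (intro add_mono mult_left_mono Suc power_mono) auto
  also have "\<dots> = real (Suc n) * x ^ (Suc n - 1) * (x - y)"
    by (cases n) (simp_all add: algebra_simps)
  finally show ?case .
qed simp

lemma exists_partial_sum:
  fixes n :: "'a \<Rightarrow> nat"
  assumes "finite A" "k \<le> sum n A"
  shows "\<exists>m. (\<forall>u\<in>A. m u \<le> n u) \<and> sum m A = k"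
  using assms
proof (induction A arbitrary: k rule: finite_induct)
  case (insert x A)
  have "k - min k (n x) \<le> sum n A" using insert by auto
  then obtain m where m: "\<forall>u\<in>A. m u \<le> n u" "sum m A = k - min k (n x)" using insert.IH by blast
  have "sum (m(x := min k (n x))) A = sum m A" using insert by (intro sum.cong) auto
  then have "sum (m(x := min k (n x))) (insert x A) = k" using insert m by simp
  moreover have "\<forall>u\<in>insert x A. (m(x := min k (n x))) u \<le> n u" using m by auto
  ultimately show ?case by blast
qed auto

section \<open>Gaps between lattice translates of the cone\<close>

context lattice_polytope
begin

text \<open>What translates by the whole lattice leave uncovered at height \<open>s\<close>; by
  periodicity every unit cell contains the same volume of it.\<close>

definition gap :: "real \<Rightarrow> (real ^ 'n) set"
  where "gap s = {x. \<forall>u. (x - rvec u, s) \<notin> C}"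

text \<open>In these coordinates the function for \<open>kD\<close> at \<open>t\<close> is
  \<open>gap_volume (k t)\<close>.\<close>

definition gap_volume :: "real \<Rightarrow> real"
  where "gap_volume s = measure lebesgue (cbox 0 1 \<inter> gap s)"

text \<open>\<open>HK_region\<close> of \<open>kD\<close> expressed through \<open>C\<close>, with
  \<open>s = k t\<close>. In contrast to \<open>gap\<close>, only translates by lattice points of
  \<open>kP\<close> are removed.\<close>

definition scaled_region :: "nat \<Rightarrow> real \<Rightarrow> (real ^ 'n) set"
  where "scaled_region k s = {y. (y, real k + s) \<in> C \<and> (\<forall>u. (rvec u, real k) \<in> C \<longrightarrow> (y - rvec u, s) \<notin> C)}"

lemma HK_region_multiple:
  assumes "k \<ge> 1"
  shows "lattice_polytope.HK_region \<Delta> (multiple k a) t = scaled_region k (real k * t)"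
  unfolding lattice_polytope.HK_region_def[OF multiple[OF assms]] scaled_region_def
    cone_multiple[OF assms] lattice_points_multiple[OF assms] Ball_def
  by (simp add: distrib_left add.commute)

lemma gap_borel: "gap s \<in> sets borel"
proof -
  have "gap s = - (\<Union>u. {x. (x - rvec u, s) \<in> C})" by (auto simp: gap_def)
  also have "\<dots> \<in> sets borel"
    by (intro borel_comp sets.countable_UN'' borel_closed closed_cone_slice) auto
  finally show ?thesis .
qed

lemma gap_lmeasurable: "B \<in> lmeasurable \<Longrightarrow> B \<inter> gap s \<in> lmeasurable"
  using gap_borel[of s] by (intro fmeasurable_Int_fmeasurable) auto

lemma gap_translate: "x + rvec v \<in> gap s \<longleftrightarrow> x \<in> gap s"
proof
  assume *: "x + rvec v \<in> gap s"
  have "(x - rvec u, s) \<notin> C" for u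
    using * by (auto simp: gap_def dest!: spec[of _ "u + v"])
  then show "x \<in> gap s" by (simp add: gap_def)
next
  assume *: "x \<in> gap s"
  have "(x + rvec v - rvec u, s) \<notin> C" for u
    using *[unfolded gap_def, THEN CollectD, rule_format, of "u - v"] by (simp add: algebra_simps)
  then show "x + rvec v \<in> gap s" by (simp add: gap_def)
qed

lemma measure_unit_cell_gap: "measure lebesgue (unit_cell v \<inter> gap s) = gap_volume s"
proof -
  have "unit_cell v \<inter> gap s = (+) (rvec v) ` (cbox 0 1 \<inter> gap s)"
    using gap_translate[of _ v s] by (auto simp: unit_cell_def add.commute)
  then show ?thesis by (simp add: gap_volume_def measure_translation)
qed

lemma cell_volume_multiple:
  assumes "k \<ge> 1"
  shows "cell_volume \<Delta> (multiple k a) v t = gap_volume (real k * t)"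
proof -
  have "(x, t + 1) \<in> (+) (rvec u, 1) ` cone_over \<Delta> (multiple k a) \<longleftrightarrow> (x - rvec u, real k * t) \<in> C" for x u
  proof -
    have "(x, t + 1) \<in> (+) (rvec u, 1) ` cone_over \<Delta> (multiple k a) \<longleftrightarrow> (x - rvec u, t) \<in> cone_over \<Delta> (multiple k a)"
      by (auto simp: image_iff intro!: bexI[of _ "(x - rvec u, t)"])
    then show ?thesis by (simp add: cone_multiple[OF assms])
  qed
  then have "{x. (x, t + 1) \<in> unit_cell v \<times> {t + 1} - (\<Union>u. (+) (rvec u, 1) ` cone_over \<Delta> (multiple k a))}
      = unit_cell v \<inter> gap (real k * t)"
    by (auto simp: gap_def)
  then show ?thesis by (simp add: cell_volume_def measure_unit_cell_gap)
qed

lemma gap_volume_range: "gap_volume s \<in> {0..1}"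
proof -
  have "gap_volume s \<le> measure lebesgue (cbox (0 :: real ^ 'n) 1)"
    unfolding gap_volume_def by (intro measure_mono_fmeasurable) (use gap_lmeasurable in auto)
  also have "\<dots> = 1"
  proof -
    have "(0 :: real ^ 'n) \<in> cbox 0 1" by (simp add: mem_box_cart)
    then have "cbox (0 :: real ^ 'n) 1 \<noteq> {}" by blast
    then show ?thesis by (simp add: content_cbox_cart)
  qed
  finally show ?thesis by (simp add: gap_volume_def)
qed

text \<open>\<open>gap\<close> involves infinitely many translates, but at heights below
  \<open>s + 1\<close> only those with \<open>u\<close> in a bounded set can reach \<open>y\<close>,
  so finitely many conditions have to stabilise.\<close>

lemma eventually_gap:
  assumes s: "s \<ge> 0" and x: "x \<longlonglongrightarrow> s"
    and y: "\<And>u. y \<notin> {y. (y - rvec u, s) \<in> C - interior C}"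
  shows "\<forall>\<^sub>F m in sequentially. y \<in> gap (x m) \<longleftrightarrow> y \<in> gap s"
proof (cases "y \<in> gap s")
  case False
  then obtain u where "(y - rvec u, s) \<in> interior C" using y by (auto simp: gap_def)
  moreover have "(\<lambda>m. (y - rvec u, x m)) \<longlonglongrightarrow> (y - rvec u, s)" by (intro tendsto_Pair tendsto_const x)
  ultimately have "\<forall>\<^sub>F m in sequentially. (y - rvec u, x m) \<in> interior C"
    by (intro topological_tendstoD) auto
  then have "\<forall>\<^sub>F m in sequentially. y \<notin> gap (x m)"
    by (rule eventually_mono) (use interior_subset in \<open>auto simp: gap_def\<close>)
  then show ?thesis using False by simp
next
  case True
  obtain B where B: "B > 0" "\<And>p. p \<in> P \<Longrightarrow> norm p \<le> B" using P_bounded by blast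
  define M where "M = \<lceil>norm y + (s + 1) * B\<rceil>"
  define U where "U = {u :: int ^ 'n. \<forall>i. \<bar>u $ i\<bar> \<le> M}"
  have "finite U" unfolding U_def by (rule finite_int_vectors_bounded)
  moreover have "\<forall>\<^sub>F m in sequentially. (y - rvec u, x m) \<notin> C" for u
  proof -
    have "(\<lambda>m. (y - rvec u, x m)) \<longlonglongrightarrow> (y - rvec u, s)" by (intro tendsto_Pair tendsto_const x)
    then have "\<forall>\<^sub>F m in sequentially. (y - rvec u, x m) \<in> - C"
      by (rule topological_tendstoD) (use True closed_C in \<open>auto simp: gap_def\<close>)
    then show ?thesis by simp
  qed
  ultimately have "\<forall>\<^sub>F m in sequentially. \<forall>u\<in>U. (y - rvec u, x m) \<notin> C"
    by (intro eventually_ball_finite) auto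
  moreover have "\<forall>\<^sub>F m in sequentially. x m < s + 1" using x by (rule order_tendstoD) simp
  ultimately have "\<forall>\<^sub>F m in sequentially. y \<in> gap (x m)"
  proof eventually_elim
    case (elim m)
    have "(y - rvec u, x m) \<notin> C" for u
    proof
      assume u: "(y - rvec u, x m) \<in> C"
      have "norm (y - rvec u) \<le> x m * B" by (rule cone_norm_le[OF B(2) u])
      also have "\<dots> \<le> (s + 1) * B" using elim(2) B(1) by (intro mult_right_mono) auto
      finally have "norm (rvec u) \<le> norm y + (s + 1) * B"
        using norm_triangle_ineq3[of y "rvec u"] norm_triangle_sub[of "rvec u" y]
        by (simp add: norm_minus_commute)
      then have "\<bar>real_of_int (u $ i)\<bar> \<le> norm y + (s + 1) * B" for i
        using component_le_norm_cart[of "rvec u" i] by simp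
      then have "\<bar>u $ i\<bar> \<le> M" for i 
        using \<open>\<And>i. \<bar>real_of_int (u $ i)\<bar> \<le> norm y + (s + 1) * B\<close>[of i] unfolding M_def by linarith
      then have "u \<in> U" by (simp add: U_def)
      then show False using elim(1) u by blast
    qed
    then show ?case by (simp add: gap_def)
  qed
  then show ?thesis using True by simp
qed

text \<open>The lattice is countable, so almost every point avoids the boundaries of all translates,
  and dominated convergence turns pointwise stability into convergence of volumes.\<close>

lemma continuous_gap_volume: "continuous_on {0..} gap_volume"
  unfolding continuous_on_sequentially
proof (intro allI ballI impI)
  fix x :: "nat \<Rightarrow> real" and s :: real
  assume s: "s \<in> {0..}" and x: "(\<forall>m. x m \<in> {0..}) \<and> x \<longlonglongrightarrow> s"
  have "(\<lambda>m. measure lebesgue (cbox 0 1 \<inter> gap (x m))) \<longlonglongrightarrow> measure lebesgue (cbox 0 1 \<inter> gap s)"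
  proof (rule measure_lebesgue_tendsto)
    show "cbox 0 1 \<inter> gap s \<in> sets lebesgue" "cbox 0 1 \<inter> gap (x m) \<in> sets lebesgue" for m
      using gap_lmeasurable[OF lmeasurable_cbox] by blast+
    show "cbox 0 1 \<inter> gap (x m) \<subseteq> cbox 0 1" for m by blast
    have "AE y in lebesgue. \<forall>u. y \<notin> {y. (y - rvec u, s) \<in> C - interior C}"
      unfolding AE_all_countable
      using s by (intro allI AE_not_negligible negligible_cone_slice_translate) simp
    then show "AE y in lebesgue. \<forall>\<^sub>F m in sequentially. y \<in> cbox 0 1 \<inter> gap (x m) \<longleftrightarrow> y \<in> cbox 0 1 \<inter> gap s"
    proof eventually_elim
      case (elim y)
      have "\<forall>\<^sub>F m in sequentially. y \<in> gap (x m) \<longleftrightarrow> y \<in> gap s"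
        by (rule eventually_gap) (use s x elim in auto)
      then show ?case by (rule eventually_mono) auto
    qed
  qed
  then show "(gap_volume \<circ> x) \<longlonglongrightarrow> gap_volume s" by (simp add: gap_volume_def comp_def)
qed

lemma ball_in_cone:
  assumes "cball p r \<subseteq> P" "z > 0" "norm (x - z *\<^sub>R p) \<le> z * r"
  shows "(x, z) \<in> C"
proof -
  have "(1 / z) *\<^sub>R x - p = (1 / z) *\<^sub>R (x - z *\<^sub>R p)" using assms(2) by (simp add: scaleR_diff_right)
  then have "norm ((1 / z) *\<^sub>R x - p) = norm (x - z *\<^sub>R p) / z" using assms(2) by (simp only: norm_scaleR) simp
  then have "norm ((1 / z) *\<^sub>R x - p) \<le> r" using assms(2,3) by (simp add: divide_le_eq mult.commute)
  then have "(1 / z) *\<^sub>R x \<in> cball p r" by (simp add: dist_norm norm_minus_commute)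
  then show ?thesis using assms(1,2) by (auto simp: mem_cone_pos)
qed

lemma gap_volume_eventually_zero: "\<exists>c. \<forall>s\<ge>c. gap_volume s = 0"
proof -
  obtain p r where pr: "r > 0" "cball p r \<subseteq> P" using P_ball by blast
  show ?thesis
  proof (intro exI allI impI)
    \<comment> \<open>At this height \<open>s P\<close> contains a ball of radius
      \<open>s r \<ge> CARD('n)\<close>, enough for \<open>x\<close> to stay in the translate
      obtained by rounding \<open>x - s p\<close> down to a lattice vector.\<close>
    fix s assume s: "s \<ge> real CARD('n) / r"
    then have "s > 0" using pr(1) by (smt (verit) divide_pos_pos of_nat_0_less_iff zero_less_card_finite)
    have "x \<notin> gap s" for x
    proof -
      let ?u = "floor_vec (x - s *\<^sub>R p)"
      have "norm ((x - rvec ?u) - s *\<^sub>R p) \<le> real CARD('n)"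
        using norm_floor_vec[of "x - s *\<^sub>R p"] by (simp add: algebra_simps)
      also have "\<dots> \<le> s * r" using s pr(1) by (simp add: field_simps)
      finally have "(x - rvec ?u, s) \<in> C" by (rule ball_in_cone[OF pr(2) \<open>s > 0\<close>])
      then show ?thesis by (auto simp: gap_def)
    qed
    then have "gap s = {}" by blast
    then show "gap_volume s = 0" by (simp add: gap_volume_def)
  qed
qed

lemma cone_combination:
  assumes "\<And>u. u \<in> A \<Longrightarrow> u \<in> L" "\<And>u. u \<in> A \<Longrightarrow> c u \<ge> 0"
  shows "(\<Sum>u\<in>A. c u *\<^sub>R rvec u, sum c A) \<in> C"
  using assms
proof (induction A rule: infinite_finite_induct)
  case (insert u A)
  have "c u *\<^sub>R (rvec u, 1) \<in> C" using insert by (intro cone_scale cone_lattice_point) auto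
  with insert show ?case using cone_add[of "c u *\<^sub>R (rvec u, 1)"] by fastforce
qed (use P_nonempty in \<open>auto simp: mem_cone\<close>)

text \<open>
  A point of \<open>C\<close> of height \<open>k + s\<close> has coefficients whose integral parts add up to at least
  \<open>k + s - card L\<close>, so a lattice point of \<open>k P\<close> splits off.
\<close>

lemma scaled_region_empty:
  assumes "s \<ge> real (card L)"
  shows "scaled_region k s = {}"
proof -
  have False if y: "y \<in> scaled_region k s" for y
  proof -
    have "(y, real k + s) \<in> C" using y by (simp add: scaled_region_def)
    then obtain c where c: "\<And>u. u \<in> L \<Longrightarrow> c u \<ge> 0" "y = (\<Sum>u\<in>L. c u *\<^sub>R rvec u)" "real k + s = sum c L"
      using cone_coefficients by metis
    define n where "n u = nat \<lfloor>c u\<rfloor>" for u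
    have n: "real (n u) \<le> c u" "c u \<le> real (n u) + 1" if "u \<in> L" for u
      using c(1)[OF that] by (auto simp: n_def)
    have "sum c L \<le> (\<Sum>u\<in>L. real (n u) + 1)" by (intro sum_mono n)
    then have "real k \<le> real (sum n L)" using assms c(3) by (simp add: sum.distrib)
    then have "k \<le> sum n L" by (simp only: of_nat_le_iff)
    \<comment> \<open>The parts \<open>m u\<close> never exceed the coefficients, so what is left
      after splitting them off still has nonnegative coefficients, with total
      \<open>s\<close>.\<close>
    then obtain m where m: "\<forall>u\<in>L. m u \<le> n u" "sum m L = k"
      using exists_partial_sum[OF finite_L] by blast
    define w where "w = (\<Sum>u\<in>L. int (m u) *s u)"
    have "(w, int k) \<in> S" using lattice_combination[of L m] m by (simp add: w_def)
    then have "(rvec w, real k) \<in> C" using semigroup_in_cone by fastforce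
    then have "(y - rvec w, s) \<notin> C" using y by (simp add: scaled_region_def)
    moreover have "rvec w = (\<Sum>u\<in>L. real (m u) *\<^sub>R rvec u)"
      by (simp add: w_def vec_eq_iff)
    then have "y - rvec w = (\<Sum>u\<in>L. (c u - real (m u)) *\<^sub>R rvec u)"
      unfolding c(2) by (simp add: scaleR_diff_left sum_subtractf)
    moreover have "s = (\<Sum>u\<in>L. c u - real (m u))"
      using c(3) m(2) by (simp add: sum_subtractf flip: of_nat_sum)
    moreover have "(\<Sum>u\<in>L. (c u - real (m u)) *\<^sub>R rvec u, \<Sum>u\<in>L. c u - real (m u)) \<in> C"
    proof (rule cone_combination)
      fix u assume "u \<in> L"
      then have "real (m u) \<le> real (n u)" using m(1) by simp
      then show "c u - real (m u) \<ge> 0" using n(1)[OF \<open>u \<in> L\<close>] by linarith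
    qed
    ultimately show False by simp
  qed
  then show ?thesis by blast
qed

section \<open>Shells around the dilated polytope and the error term\<close>

lemma cone_slice_affine:
  assumes "z \<ge> 0"
  shows "{y. (y + w, z) \<in> C} = (\<lambda>x. z *\<^sub>R x + (- w)) ` P"
proof -
  have "y + w = z *\<^sub>R p \<longleftrightarrow> y = z *\<^sub>R p + - w" for y p by (simp add: eq_diff_eq)
  then show ?thesis using assms unfolding mem_cone by (auto simp: image_iff)
qed

lemma cone_slice_lmeasurable: "{y. (y + w, z) \<in> C} \<in> lmeasurable"
proof (cases "z \<ge> 0")
  case True
  have "compact ((\<lambda>x. z *\<^sub>R x + (- w)) ` P)"
    by (intro compact_continuous_image compact_P continuous_intros)
  then show ?thesis unfolding cone_slice_affine[OF True] by (rule lmeasurable_compact)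
qed (auto simp: mem_cone)

lemma measure_cone_slice:
  assumes "z \<ge> 0"
  shows "measure lebesgue {y. (y + w, z) \<in> C} = z ^ CARD('n) * measure lebesgue P"
  unfolding cone_slice_affine[OF assms] using measure_lebesgue_affine[of z "- w" P] assms by simp

lemma measure_cell_gap:
  fixes w :: "int ^ 'n"
  shows "measure lebesgue ({y. floor_vec y = w} \<inter> gap s) = gap_volume s"
proof -
  have cbox: "cbox (rvec w) (rvec w + 1) = unit_cell w"
    using cbox_translation[of "rvec w" 0 1] by (simp add: unit_cell_def)
  have cell: "negligible (unit_cell w - {y. floor_vec y = w})" "{y. floor_vec y = w} \<subseteq> unit_cell w"
    using floor_cell(3,4)[of 1 w] by (simp_all add: cbox)
  have "measure lebesgue ({y. floor_vec y = w} \<inter> gap s) = measure lebesgue (unit_cell w \<inter> gap s)"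
  proof (rule measure_negligible_symdiff)
    show "unit_cell w \<inter> gap s \<in> lmeasurable" unfolding cbox[symmetric] by (rule gap_lmeasurable) simp
    show "negligible (unit_cell w \<inter> gap s - {y. floor_vec y = w} \<inter> gap s
        \<union> ({y. floor_vec y = w} \<inter> gap s - unit_cell w \<inter> gap s))"
      by (rule negligible_subset[OF cell(1)]) (use cell(2) in blast)
  qed
  then show ?thesis by (simp add: measure_unit_cell_gap)
qed

lemma measure_cells_gap:
  assumes W: "finite W"
  shows "measure lebesgue ({y. floor_vec y \<in> W} \<inter> gap s) = real (card W) * gap_volume s"
proof -
  have cell: "{y. floor_vec y = w} \<in> lmeasurable" for w :: "int ^ 'n"
    using floor_cell(1)[of 1 w] by simp
  have "{y. floor_vec y \<in> W} \<inter> gap s = (\<Union>w\<in>W. {y. floor_vec y = w} \<inter> gap s)" by auto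
  then have "measure lebesgue ({y. floor_vec y \<in> W} \<inter> gap s)
      = (\<Sum>w\<in>W. measure lebesgue ({y. floor_vec y = w} \<inter> gap s))"
    by (simp only:) (rule measure_UNION', auto simp: W pairwise_def disjnt_def intro: gap_lmeasurable cell)
  then show ?thesis by (simp add: measure_cell_gap)
qed

lemma scaled_region_lmeasurable: "scaled_region k s \<in> lmeasurable"
proof -
  have "scaled_region k s = {y. (y + 0, real k + s) \<in> C} \<inter> - (\<Union>u\<in>{u. (rvec u, real k) \<in> C}. {y. (y - rvec u, s) \<in> C})"
    by (auto simp: scaled_region_def)
  moreover have "- (\<Union>u\<in>{u. (rvec u, real k) \<in> C}. {y. (y - rvec u, s) \<in> C}) \<in> sets borel"
    by (intro borel_comp sets.countable_UN'' borel_closed closed_cone_slice) auto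
  ultimately show ?thesis using cone_slice_lmeasurable[of 0] by (simp add: fmeasurable_Int_fmeasurable)
qed

text \<open>Either set is covered by the other together with the shell \<open>B - A\<close>.\<close>

lemma measure_diff_le_shell:
  fixes X Y :: "(real ^ 'n) set"
  assumes "X \<in> lmeasurable" "Y \<in> lmeasurable" "A \<in> lmeasurable" "B \<in> lmeasurable"
    and "A \<subseteq> B" "X \<subseteq> B" "Y \<subseteq> B" "X \<inter> A = Y \<inter> A"
  shows "\<bar>measure lebesgue X - measure lebesgue Y\<bar> \<le> measure lebesgue B - measure lebesgue A"
proof -
  have shell: "B - A \<in> lmeasurable" "measure lebesgue (B - A) = measure lebesgue B - measure lebesgue A"
    using assms measurable_measure_Diff[of B lebesgue A] by (auto intro: fmeasurable.Diff)
  have *: "measure lebesgue X \<le> measure lebesgue Y + (measure lebesgue B - measure lebesgue A)"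
    if "X \<in> lmeasurable" "Y \<in> lmeasurable" "X \<subseteq> B" "X \<inter> A = Y \<inter> A" for X Y :: "(real ^ 'n) set"
  proof -
    have "measure lebesgue X \<le> measure lebesgue (Y \<union> (B - A))"
      using that shell(1) by (intro measure_mono_fmeasurable fmeasurable.Un) auto
    also have "\<dots> \<le> measure lebesgue Y + measure lebesgue (B - A)"
      using that shell(1) by (intro measure_Un_le) auto
    finally show ?thesis using shell(2) by simp
  qed
  show ?thesis using *[of X Y] *[of Y X] assms by (simp add: abs_le_iff)
qed

lemma floor_vec_rvec [simp]: "floor_vec (rvec w) = w"
  by (simp add: floor_vec_def vec_eq_iff)

lemma norm_diff_same_cell:
  fixes y z :: "real ^ 'n"
  assumes "floor_vec y = floor_vec z"
  shows "norm (y - z) \<le> real CARD('n)"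
proof -
  have "norm (y - z) \<le> (\<Sum>i\<in>UNIV. \<bar>(y - z) $ i\<bar>)" by (rule norm_le_l1_cart)
  also have "\<dots> \<le> (\<Sum>i\<in>(UNIV :: 'n set). 1)"
  proof (rule sum_mono)
    fix i
    have "\<lfloor>y $ i\<rfloor> = \<lfloor>z $ i\<rfloor>" using arg_cong[OF assms, of "\<lambda>v. v $ i"] by (simp add: floor_vec_def)
    then show "\<bar>(y - z) $ i\<bar> \<le> 1" by simp linarith
  qed
  finally show ?thesis by simp
qed

text \<open>Translations do not affect volume, so \<open>w\<close> and \<open>w'\<close> are
  arbitrary. The two summands of the constant serve the cases \<open>k \<ge> \<delta>\<close> and
  \<open>k < \<delta>\<close>.\<close>

lemma shell_volume_bound:
  assumes \<delta>: "\<delta> > 0" and k: "k \<ge> 1"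
  defines "n \<equiv> CARD('n)" and "V \<equiv> measure lebesgue P"
  shows "measure lebesgue {y. (y + w, real k + \<delta>) \<in> C} - measure lebesgue {y. (y + w', real k - \<delta>) \<in> C}
    \<le> V * (2 * \<delta> * real n * (1 + \<delta>) ^ (n - 1) + \<delta> * (1 + \<delta>) ^ n) * real k ^ (n - 1)"
proof -
  have V: "V \<ge> 0" by (simp add: V_def)
  have n: "n > 0" by (simp add: n_def)
  have k\<delta>: "real k + \<delta> \<le> (1 + \<delta>) * real k"
    using \<delta> k mult_left_mono[of 1 "real k" \<delta>] by (simp add: algebra_simps)
  have outer: "measure lebesgue {y. (y + w, real k + \<delta>) \<in> C} = (real k + \<delta>) ^ n * V"
    unfolding n_def V_def by (rule measure_cone_slice) (use \<delta> in simp)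
  have "measure lebesgue {y. (y + w, real k + \<delta>) \<in> C} - measure lebesgue {y. (y + w', real k - \<delta>) \<in> C}
      \<le> V * (2 * \<delta> * real n * (1 + \<delta>) ^ (n - 1)) * real k ^ (n - 1)
        + V * (\<delta> * (1 + \<delta>) ^ n) * real k ^ (n - 1)"
  proof (cases "real k \<ge> \<delta>")
    case True
    then have inner: "measure lebesgue {y. (y + w', real k - \<delta>) \<in> C} = (real k - \<delta>) ^ n * V"
      unfolding n_def V_def by (intro measure_cone_slice) simp
    have "(real k + \<delta>) ^ n - (real k - \<delta>) ^ n \<le> real n * (real k + \<delta>) ^ (n - 1) * (2 * \<delta>)"
      using power_diff_le[of "real k - \<delta>" "real k + \<delta>" n] True \<delta> by simp
    also have "\<dots> \<le> real n * ((1 + \<delta>) * real k) ^ (n - 1) * (2 * \<delta>)"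
      using k\<delta> \<delta> by (intro mult_right_mono mult_left_mono power_mono) auto
    finally have "((real k + \<delta>) ^ n - (real k - \<delta>) ^ n) * V
        \<le> (real n * ((1 + \<delta>) ^ (n - 1) * real k ^ (n - 1)) * (2 * \<delta>)) * V"
      unfolding power_mult_distrib using V by (rule mult_right_mono)
    moreover have "0 \<le> V * (\<delta> * (1 + \<delta>) ^ n) * real k ^ (n - 1)" using V \<delta> by simp
    ultimately show ?thesis unfolding outer inner by (simp add: algebra_simps)
  next
    case False
    \<comment> \<open>The inner slice has negative height here, but the outer volume alone is small
      enough: one factor \<open>k\<close> is replaced by the larger \<open>\<delta>\<close>.\<close>
    have "(real k + \<delta>) ^ n \<le> ((1 + \<delta>) * real k) ^ n" using k\<delta> \<delta> by (intro power_mono) auto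
    also have "\<dots> = (1 + \<delta>) ^ n * (real k * real k ^ (n - 1))"
      using n by (simp add: power_mult_distrib power_Suc[symmetric] del: power_Suc)
    also have "\<dots> \<le> (1 + \<delta>) ^ n * (\<delta> * real k ^ (n - 1))"
      using False \<delta> by (intro mult_left_mono mult_right_mono) auto
    finally have "(real k + \<delta>) ^ n * V \<le> (1 + \<delta>) ^ n * (\<delta> * real k ^ (n - 1)) * V"
      using V by (rule mult_right_mono)
    moreover have "0 \<le> V * (2 * \<delta> * real n * (1 + \<delta>) ^ (n - 1)) * real k ^ (n - 1)" using V \<delta> by simp
    moreover have "0 \<le> measure lebesgue {y. (y + w', real k - \<delta>) \<in> C}" by simp
    moreover have "(1 + \<delta>) ^ n * (\<delta> * real k ^ (n - 1)) * V = V * (\<delta> * (1 + \<delta>) ^ n) * real k ^ (n - 1)"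
      by (simp only: mult_ac)
    ultimately show ?thesis unfolding outer by linarith
  qed
  then show ?thesis by (simp add: algebra_simps)
qed

text \<open>
  With \<open>\<delta> = D / r\<close> and a ball of radius \<open>r\<close> around \<open>p\<close> inside \<open>P\<close>, the translates
  \<open>I = (k - \<delta>) P + \<delta> p\<close> and \<open>O = (k + \<delta>) P - \<delta> p\<close> satisfy \<open>I + B\<^sub>D \<subseteq> kP\<close> and
  \<open>kP + B\<^sub>D \<subseteq> O\<close>.  Within \<open>I\<close> the region and the gap coincide, and the lattice cells contained
  in \<open>kP\<close> cover \<open>I\<close>, so all errors live in the shell \<open>O - I\<close> of volume \<open>O(k\<^sup>n\<^sup>-\<^sup>1)\<close>.
\<close>

lemma scaled_region_estimate:
  "\<exists>K. \<forall>k\<ge>1. \<forall>s. 0 \<le> s \<and> s \<le> c \<longrightarrow>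
    \<bar>measure lebesgue (scaled_region k s) - measure lebesgue P * real k ^ CARD('n) * gap_volume s\<bar>
      \<le> K * real k ^ (CARD('n) - 1)"
proof -
  obtain p r where pr: "r > 0" "cball p r \<subseteq> P" using P_ball by blast
  obtain B where B: "B > 0" "\<And>p. p \<in> P \<Longrightarrow> norm p \<le> B" using P_bounded by blast
  \<comment> \<open>\<open>D\<close> has to dominate both the norms in \<open>s P\<close> for
    \<open>s \<le> c\<close> and a bound for the diameter of a unit cell.\<close>
  define D where "D = \<bar>c\<bar> * B + real CARD('n)"
  define \<delta> where "\<delta> = D / r"
  have nD: "real CARD('n) \<le> D" using B(1) by (simp add: D_def)
  then have D: "D > 0" by (smt (verit) of_nat_0_less_iff zero_less_card_finite)
  then have \<delta>: "\<delta> > 0" "\<delta> * r = D" using pr(1) by (simp_all add: \<delta>_def)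
  \<comment> \<open>A displacement of norm at most \<open>D\<close> costs \<open>\<delta>\<close> in
    height, since \<open>\<delta> P\<close> contains the ball of radius
    \<open>\<delta> r = D\<close> around \<open>\<delta> p\<close>.\<close>
  have fatten: "(x + (\<delta> *\<^sub>R p + w), z + \<delta>) \<in> C" if "(x, z) \<in> C" "norm w \<le> D" for x w z
    using cone_add[OF that(1) ball_in_cone[OF pr(2) \<delta>(1), of "\<delta> *\<^sub>R p + w"]] that(2) \<delta>(2) by simp
  let ?V = "measure lebesgue P" and ?n = "CARD('n)"
  define K where "K = ?V * (2 * \<delta> * real ?n * (1 + \<delta>) ^ (?n - 1) + \<delta> * (1 + \<delta>) ^ ?n)"
  have "\<bar>measure lebesgue (scaled_region k s) - ?V * real k ^ ?n * gap_volume s\<bar> \<le> 2 * K * real k ^ (?n - 1)"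
    if k: "k \<ge> 1" and s: "0 \<le> s" "s \<le> c" for k s
  proof -
    define Inn where "Inn = {y. (y + - (\<delta> *\<^sub>R p), real k - \<delta>) \<in> C}"
    define Mid where "Mid = {y. (y + 0, real k) \<in> C}"
    define Out where "Out = {y. (y + \<delta> *\<^sub>R p, real k + \<delta>) \<in> C}"
    have meas: "Inn \<in> lmeasurable" "Mid \<in> lmeasurable" "Out \<in> lmeasurable"
      unfolding Inn_def Mid_def Out_def by (rule cone_slice_lmeasurable)+
    have sB: "s * B \<le> D"
    proof -
      have "s * B \<le> \<bar>c\<bar> * B" using s B(1) by (intro mult_right_mono) auto
      then show ?thesis by (simp add: D_def)
    qed
    have sP: "norm (s *\<^sub>R p') \<le> D" if "p' \<in> P" for p'
      using mult_left_mono[OF B(2)[OF that] s(1)] sB s(1) by simp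
    have InnMid: "y + w \<in> Mid" if "y \<in> Inn" "norm w \<le> D" for y w
      using fatten[of "y + - (\<delta> *\<^sub>R p)" "real k - \<delta>" w] that by (simp add: Inn_def Mid_def)
    have MidOut: "y + w \<in> Out" if "y \<in> Mid" "norm w \<le> D" for y w
      using fatten[of y "real k" w] that by (simp add: Out_def Mid_def algebra_simps)
    have sub: "Inn \<subseteq> Mid" "Mid \<subseteq> Out"
      using InnMid[of _ 0] MidOut[of _ 0] D by auto
    let ?Q = "scaled_region k s"
    have QOut: "?Q \<subseteq> Out"
    proof
      fix y assume "y \<in> ?Q"
      then obtain p' where p': "p' \<in> P" "y = (real k + s) *\<^sub>R p'"
        by (auto simp: scaled_region_def mem_cone)
      have "real k *\<^sub>R p' \<in> Mid" using p'(1) by (auto simp: Mid_def mem_cone)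
      from MidOut[OF this sP[OF p'(1)]] show "y \<in> Out" by (simp add: p'(2) scaleR_add_left)
    qed
    \<comment> \<open>A translate \<open>u + s P\<close> through a point of \<open>Inn\<close> has
      \<open>u\<close> within \<open>D\<close> of that point, hence in \<open>kP\<close>, so
      removing all translates or only those from \<open>kP\<close> has the same effect. Conversely,
      subtracting any point of \<open>s P\<close> from a point of \<open>Inn\<close> stays in
      \<open>kP\<close>, which puts the latter in \<open>(k + s) P\<close>.\<close>
    have Qgap: "?Q \<inter> Inn = gap s \<inter> Inn"
    proof (intro equalityI subsetI)
      fix y assume y: "y \<in> ?Q \<inter> Inn"
      have "(y - rvec u, s) \<notin> C" for u
      proof
        assume u: "(y - rvec u, s) \<in> C"
        have "norm (y - rvec u) \<le> s * B" by (rule cone_norm_le[OF B(2) u])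
        then have "norm (rvec u - y) \<le> D" using sB by (simp add: norm_minus_commute)
        then have "rvec u \<in> Mid" using InnMid[of y "rvec u - y"] y by simp
        then show False using y u by (simp add: Mid_def scaled_region_def)
      qed
      then show "y \<in> gap s \<inter> Inn" using y by (simp add: gap_def)
    next
      fix y assume y: "y \<in> gap s \<inter> Inn"
      obtain p' where p': "p' \<in> P" using P_nonempty by blast
      have "y + - (s *\<^sub>R p') \<in> Mid" using y sP[OF p'] by (intro InnMid) auto
      moreover have "(s *\<^sub>R p', s) \<in> C" using p' s(1) by (auto simp: mem_cone)
      ultimately have "(y, real k + s) \<in> C"
        using cone_add[of "(y - s *\<^sub>R p', real k)" "(s *\<^sub>R p', s)"] by (simp add: Mid_def)
      then show "y \<in> ?Q \<inter> Inn" using y by (simp add: scaled_region_def gap_def)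
    qed
    \<comment> \<open>Only cells entirely inside \<open>kP\<close> are kept, so that periodicity
      gives the exact volume of the gap in their union \<open>N\<close>.\<close>
    define W where "W = {w. {y. floor_vec y = w} \<subseteq> Mid}"
    define N where "N = {y. floor_vec (1 *\<^sub>R y) \<in> W}"
    have finW: "finite W"
    proof (rule finite_subset[OF _ finite_int_vectors_bounded[of "\<lceil>real k * B\<rceil>"]], rule subsetI, rule CollectI, rule allI)
      fix w i assume "w \<in> W"
      then have "rvec w \<in> Mid" by (auto simp: W_def)
      then have "norm (rvec w) \<le> real k * B" using cone_norm_le[OF B(2)] by (simp add: Mid_def)
      then show "\<bar>w $ i\<bar> \<le> \<lceil>real k * B\<rceil>" using component_le_norm_cart[of "rvec w" i] by simp linarith
    qed
    have InnN: "Inn \<subseteq> N"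
    proof
      fix y assume y: "y \<in> Inn"
      have "z \<in> Mid" if "floor_vec z = floor_vec y" for z
        using InnMid[OF y, of "z - y"] norm_diff_same_cell[OF that] nD by simp
      then show "y \<in> N" by (auto simp: N_def W_def)
    qed
    have NMid: "N \<subseteq> Mid" by (auto simp: N_def W_def)
    have N: "N \<in> lmeasurable" "measure lebesgue N = real (card W)"
      using floor_cells_union[of 1 W] finW by (simp_all add: N_def)
    have Ngap: "N \<inter> gap s \<in> lmeasurable" "measure lebesgue (N \<inter> gap s) = measure lebesgue N * gap_volume s"
      using gap_lmeasurable[OF N(1)] measure_cells_gap[OF finW, of s] N(2) by (simp_all add: N_def)
    let ?A = "measure lebesgue Out - measure lebesgue Inn"
    have 1: "\<bar>measure lebesgue ?Q - measure lebesgue (N \<inter> gap s)\<bar> \<le> ?A"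
      by (rule measure_diff_le_shell[OF scaled_region_lmeasurable Ngap(1) meas(1,3)])
         (use sub QOut Qgap InnN NMid in blast)+
    have 2: "\<bar>measure lebesgue N - measure lebesgue Mid\<bar> \<le> ?A"
      by (rule measure_diff_le_shell[OF N(1) meas(2,1,3)]) (use sub InnN NMid in blast)+
    have g: "0 \<le> gap_volume s" "gap_volume s \<le> 1" using gap_volume_range[of s] by auto
    have "measure lebesgue Mid = real k ^ ?n * ?V" unfolding Mid_def by (rule measure_cone_slice) simp
    \<comment> \<open>Two shell errors arise: from replacing the region by the gap in
      \<open>N\<close>, and from replacing \<open>N\<close> by \<open>kP\<close>, the latter
      weighted by \<open>gap_volume s \<le> 1\<close>. This is the factor \<open>2\<close>.\<close>
    then have "measure lebesgue ?Q - ?V * real k ^ ?n * gap_volume s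
      = (measure lebesgue ?Q - measure lebesgue (N \<inter> gap s))
        + (measure lebesgue N - measure lebesgue Mid) * gap_volume s"
      by (simp add: Ngap(2) algebra_simps)
    also have "\<bar>\<dots>\<bar> \<le> ?A + ?A * 1"
    proof (rule order_trans[OF abs_triangle_ineq add_mono[OF 1]])
      show "\<bar>(measure lebesgue N - measure lebesgue Mid) * gap_volume s\<bar> \<le> ?A * 1"
        unfolding abs_mult using 2 g by (intro mult_mono) auto
    qed
    also have "\<dots> \<le> 2 * (K * real k ^ (?n - 1))"
      using shell_volume_bound[OF \<delta>(1) k, of "\<delta> *\<^sub>R p" "- (\<delta> *\<^sub>R p)"] unfolding K_def Inn_def Out_def by simp
    finally show ?thesis by (simp add: mult.assoc)
  qed
  then show ?thesis by blast
qed

end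


section \<open>Multiplicity and Hilbert-Kunz density\<close>

text \<open>The differences of consecutive \<open>(n + 1)\<close>-st powers telescope and lie
  between the values of the derivative at the two endpoints.\<close>

lemma sum_power_bounds:
  "(\<Sum>j<N. real j ^ n) \<le> real N ^ (n + 1) / real (n + 1)"
  "real N ^ (n + 1) / real (n + 1) \<le> (\<Sum>j<N. real (Suc j) ^ n)"
proof -
  have step: "real (n + 1) * real j ^ n \<le> real (Suc j) ^ (n + 1) - real j ^ (n + 1)" for j
  proof -
    have "real j ^ (n + 1) + real (n + 1) * real j ^ n \<le> real (Suc j) ^ (n + 1)"
    proof (induction n)
      case (Suc n)
      have "real j ^ (Suc n + 1) + real (Suc n + 1) * real j ^ Suc n
          \<le> (real j ^ (n + 1) + real (n + 1) * real j ^ n) * (real j + 1)"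
        by (simp add: algebra_simps)
      also have "\<dots> \<le> real (Suc j) ^ (n + 1) * (real j + 1)"
        by (rule mult_right_mono[OF Suc]) simp
      finally show ?case by (simp add: algebra_simps)
    qed simp
    then show ?thesis by simp
  qed
  have "real (n + 1) * (\<Sum>j<N. real j ^ n) \<le> real N ^ (n + 1)"
  proof (induction N)
    case (Suc N)
    then show ?case using step[of N] by (simp add: algebra_simps)
  qed simp
  then show "(\<Sum>j<N. real j ^ n) \<le> real N ^ (n + 1) / real (n + 1)"
    by (simp add: le_divide_eq mult.commute)
  have step': "real (Suc j) ^ (n + 1) - real j ^ (n + 1) \<le> real (n + 1) * real (Suc j) ^ n" for j
    using power_diff_le[of "real j" "real (Suc j)" "n + 1"] by simp
  have "real N ^ (n + 1) \<le> real (n + 1) * (\<Sum>j<N. real (Suc j) ^ n)"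
  proof (induction N)
    case (Suc N)
    then show ?case using step'[of N] by (simp add: algebra_simps)
  qed simp
  then show "real N ^ (n + 1) / real (n + 1) \<le> (\<Sum>j<N. real (Suc j) ^ n)"
    by (simp add: divide_le_eq mult.commute)
qed

lemma sum_power_tendsto:
  assumes n: "n > 0"
  shows "(\<lambda>N. (\<Sum>j<N. real j ^ n) / real N ^ (n + 1)) \<longlonglongrightarrow> 1 / real (n + 1)"
proof (rule real_tendsto_sandwich)
  have lower: "1 / real (n + 1) - 1 / real N \<le> (\<Sum>j<N. real j ^ n) / real N ^ (n + 1)" if N: "N > 0" for N
  proof -
    \<comment> \<open>Since \<open>n > 0\<close>, the term at \<open>j = 0\<close> vanishes, and the
      shifted sum exceeds the original one by exactly \<open>N ^ n\<close>.\<close>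
    have "(\<Sum>j<N. real (Suc j) ^ n) = (\<Sum>j<Suc N. real j ^ n)"
      using n by (subst sum.lessThan_Suc_shift) simp
    then have "real N ^ (n + 1) / real (n + 1) - real N ^ n \<le> (\<Sum>j<N. real j ^ n)"
      using sum_power_bounds(2)[of N n] by simp
    then have "(real N ^ (n + 1) / real (n + 1) - real N ^ n) / real N ^ (n + 1)
        \<le> (\<Sum>j<N. real j ^ n) / real N ^ (n + 1)"
      by (rule divide_right_mono) simp
    then show ?thesis using N by (simp add: diff_divide_distrib)
  qed
  show "\<forall>\<^sub>F N in sequentially. 1 / real (n + 1) - 1 / real N \<le> (\<Sum>j<N. real j ^ n) / real N ^ (n + 1)"
    using eventually_gt_at_top[of 0] by (rule eventually_mono) (rule lower)
  have upper: "(\<Sum>j<N. real j ^ n) / real N ^ (n + 1) \<le> 1 / real (n + 1)" if N: "N > 0" for N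
  proof -
    have "(\<Sum>j<N. real j ^ n) / real N ^ (n + 1) \<le> (real N ^ (n + 1) / real (n + 1)) / real N ^ (n + 1)"
      by (rule divide_right_mono[OF sum_power_bounds(1)]) simp
    then show ?thesis using N by simp
  qed
  show "\<forall>\<^sub>F N in sequentially. (\<Sum>j<N. real j ^ n) / real N ^ (n + 1) \<le> 1 / real (n + 1)"
    using eventually_gt_at_top[of 0] by (rule eventually_mono) (rule upper)
  show "(\<lambda>N. 1 / real (n + 1) - 1 / real N) \<longlonglongrightarrow> 1 / real (n + 1)"
    using tendsto_diff[OF tendsto_const lim_1_over_n[where 'a = real]] by simp
qed simp

text \<open>A Cesaro argument: the deviation from \<open>V * j ^ n\<close> contributes a fixed head
  sum plus an arbitrarily small multiple of \<open>N ^ (n + 1)\<close>.\<close>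

lemma sum_tendsto_of_leading_coefficient:
  fixes h :: "nat \<Rightarrow> real"
  assumes n: "n > 0" and h: "(\<lambda>j. h (Suc j) / real (Suc j) ^ n) \<longlonglongrightarrow> V"
  shows "(\<lambda>N. (\<Sum>j<N. h j) / real N ^ (n + 1)) \<longlonglongrightarrow> V / real (n + 1)"
proof -
  define g where "g j = h j - V * real j ^ n" for j
  have "(\<lambda>N. (\<Sum>j<N. g j) / real N ^ (n + 1)) \<longlonglongrightarrow> 0"
  proof (rule LIMSEQ_I)
    fix \<epsilon> :: real assume \<epsilon>: "\<epsilon> > 0"
    have "(\<lambda>j. h j / real j ^ n) \<longlonglongrightarrow> V" using h by (rule LIMSEQ_imp_Suc)
    moreover have "\<epsilon> / 2 > 0" using \<epsilon> by simp
    ultimately obtain j0 where j0: "\<And>j. j \<ge> j0 \<Longrightarrow> norm (h j / real j ^ n - V) < \<epsilon> / 2"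
      by (blast dest: LIMSEQ_D)
    define M where "M = (\<Sum>j<Suc j0. \<bar>g j\<bar>)"
    have M: "M \<ge> 0" unfolding M_def by (rule sum_nonneg) simp
    have g: "\<bar>g j\<bar> \<le> (if j < Suc j0 then \<bar>g j\<bar> else 0) + \<epsilon> / 2 * real j ^ n" for j
    proof (cases "j < Suc j0")
      case False
      then have j: "real j ^ n > 0" by simp
      have "g j = (h j / real j ^ n - V) * real j ^ n" using j by (simp add: g_def left_diff_distrib)
      then have "\<bar>g j\<bar> = norm (h j / real j ^ n - V) * real j ^ n" using j by (simp add: abs_mult)
      also have "\<dots> \<le> \<epsilon> / 2 * real j ^ n" using j0[of j] False j by (intro mult_right_mono) auto
      finally show ?thesis using False by simp
    qed (use \<epsilon> in simp)
    have bound: "\<bar>\<Sum>j<N. g j\<bar> \<le> M + \<epsilon> / 2 * real N ^ (n + 1)" for N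
    proof -
      have "\<bar>\<Sum>j<N. g j\<bar> \<le> (\<Sum>j<N. \<bar>g j\<bar>)" by (rule sum_abs)
      also have "\<dots> \<le> (\<Sum>j<N. (if j < Suc j0 then \<bar>g j\<bar> else 0) + \<epsilon> / 2 * real j ^ n)"
        by (rule sum_mono) (rule g)
      also have "\<dots> = (\<Sum>j\<in>{..<N} \<inter> {..<Suc j0}. \<bar>g j\<bar>) + \<epsilon> / 2 * (\<Sum>j<N. real j ^ n)"
        by (simp add: sum.distrib sum_distrib_left sum.If_cases lessThan_def)
      also have "(\<Sum>j\<in>{..<N} \<inter> {..<Suc j0}. \<bar>g j\<bar>) \<le> M"
        unfolding M_def by (rule sum_mono2) auto
      also have "(\<Sum>j<N. real j ^ n) \<le> real N ^ (n + 1)"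
      proof (rule order_trans[OF sum_power_bounds(1)])
        show "real N ^ (n + 1) / real (n + 1) \<le> real N ^ (n + 1)"
          using divide_left_mono[of 1 "real (n + 1)" "real N ^ (n + 1)"] by simp
      qed
      finally show ?thesis using \<epsilon> by (simp add: mult_left_mono)
    qed
    show "\<exists>N0. \<forall>N\<ge>N0. norm ((\<Sum>j<N. g j) / real N ^ (n + 1) - 0) < \<epsilon>"
    proof (intro exI allI impI)
      fix N assume N: "N \<ge> Suc (nat \<lceil>2 * M / \<epsilon>\<rceil>)"
      then have N1: "real N \<ge> 1" and "2 * M / \<epsilon> < real N" by linarith+
      then have "M < \<epsilon> / 2 * real N" using \<epsilon> by (simp add: field_simps)
      also have "\<dots> \<le> \<epsilon> / 2 * real N ^ (n + 1)"
        using \<epsilon> N1 power_increasing[of 1 "n + 1" "real N"] by (intro mult_left_mono) auto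
      finally have "\<bar>\<Sum>j<N. g j\<bar> < \<epsilon> * real N ^ (n + 1)" using bound[of N] by simp
      then show "norm ((\<Sum>j<N. g j) / real N ^ (n + 1) - 0) < \<epsilon>"
        using N1 by (simp add: divide_less_eq)
    qed
  qed
  then have "(\<lambda>N. (\<Sum>j<N. g j) / real N ^ (n + 1) + V * ((\<Sum>j<N. real j ^ n) / real N ^ (n + 1)))
      \<longlonglongrightarrow> 0 + V * (1 / real (n + 1))"
    by (intro tendsto_add tendsto_mult tendsto_const sum_power_tendsto n)
  moreover have "(\<Sum>j<N. g j) / real N ^ (n + 1) + V * ((\<Sum>j<N. real j ^ n) / real N ^ (n + 1))
      = (\<Sum>j<N. h j) / real N ^ (n + 1)" for N
    by (simp add: g_def sum_subtractf sum_distrib_left[symmetric] diff_divide_distrib)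
  ultimately show ?thesis by simp
qed

context lattice_polytope
begin

lemma card_below_degree:
  "finite {s \<in> S. snd s < int N}"
  "card {s \<in> S. snd s < int N} = (\<Sum>j<N. card {x. (x, int j) \<in> S})"
proof -
  have eq: "{s \<in> S. snd s < int N} = (\<Union>j<N. (\<lambda>x. (x, int j)) ` {x. (x, int j) \<in> S})"
  proof (intro equalityI subsetI)
    fix s assume s: "s \<in> {s \<in> S. snd s < int N}"
    then have "snd s = int (nat (snd s))" "nat (snd s) < N"
      using coord_semigroup_snd_nonneg[of s \<Delta> a] by auto
    then show "s \<in> (\<Union>j<N. (\<lambda>x. (x, int j)) ` {x. (x, int j) \<in> S})"
      using s by (intro UN_I[of "nat (snd s)"] image_eqI[of _ _ "fst s"]) (auto simp: prod_eq_iff)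
  qed auto
  show "finite {s \<in> S. snd s < int N}" unfolding eq by (intro finite_UN_I finite_imageI finite_degree) auto
  have "card {s \<in> S. snd s < int N} = (\<Sum>j<N. card ((\<lambda>x. (x, int j)) ` {x. (x, int j) \<in> S}))"
    unfolding eq by (rule card_UN_disjoint) (auto simp: finite_degree)
  also have "\<dots> = (\<Sum>j<N. card {x. (x, int j) \<in> S})"
    by (intro sum.cong refl card_image) (auto simp: inj_on_def)
  finally show "card {s \<in> S. snd s < int N} = (\<Sum>j<N. card {x. (x, int j) \<in> S})" .
qed

text \<open>Summation over degrees contributes \<open>1 / (CARD('n) + 1)\<close>, which reduces the
  factorial belonging to the ring dimension \<open>CARD('n) + 1\<close> to that of
  \<open>CARD('n)\<close>.\<close>

lemma e0_eq: "e0 TYPE('k::field) \<Delta> a = fact CARD('n) * measure lebesgue P"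
proof -
  have "(\<lambda>N. (\<Sum>j<N. real (card {x. (x, int j) \<in> S})) / real N ^ (CARD('n) + 1))
      \<longlonglongrightarrow> measure lebesgue P / real (CARD('n) + 1)"
    by (rule sum_tendsto_of_leading_coefficient[OF zero_less_card_finite card_degree_tendsto])
  from tendsto_mult[OF tendsto_const[of "fact (CARD('n) + 1)"] this]
  have lim: "(\<lambda>N. fact (CARD('n) + 1) * real (card {s \<in> S. snd s < int N}) / real N ^ (CARD('n) + 1))
      \<longlonglongrightarrow> fact (CARD('n) + 1) * (measure lebesgue P / real (CARD('n) + 1))"
    by (simp add: card_below_degree(2))
  also have "fact (CARD('n) + 1) * (measure lebesgue P / real (CARD('n) + 1)) = fact CARD('n) * measure lebesgue P"
    by (simp add: field_simps del: of_nat_Suc)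
  finally show ?thesis
    unfolding e0_def Let_def multiplicity_of_def
    by (simp only: length_quotient_max_ideal_pow[OF card_below_degree(1)] limI)
qed

text \<open>For every \<open>q\<close> the length is exactly a lattice point count, so the limit is
  the one already found at scales \<open>q = p ^ m\<close>, which tend to infinity because
  \<open>p \<ge> 2\<close>.\<close>

lemma HKd_eq:
  assumes char: "CHAR('k::field) > 0" and t: "t \<ge> 0"
  shows "HKd TYPE('k) \<Delta> a (t + 1) = measure lebesgue (HK_region t)"
proof -
  have p: "prime CHAR('k)" using char by (rule prime_CHAR_semidom)
  then have p2: "CHAR('k) \<ge> 2" by (rule prime_ge_2_nat)
  have fin: "finite {s \<in> S. snd s = j}" for j
  proof -
    have "{s \<in> S. snd s = j} = (\<lambda>x. (x, j)) ` {x. (x, j) \<in> S}" by auto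
    then show ?thesis using finite_degree by simp
  qed
  have lim: "filterlim (\<lambda>m. real (CHAR('k) ^ m)) at_top sequentially"
    using p2 by (simp add: filterlim_realpow_sequentially_gt1 filterlim_at_infinity_imp_filterlim_at_top)
  have "(\<lambda>m. real (card {x. (x, \<lfloor>real (CHAR('k) ^ m) * (t + 1)\<rfloor>) \<in> S \<and>
      (\<forall>u\<in>L. (x - int (CHAR('k) ^ m) *s u, \<lfloor>real (CHAR('k) ^ m) * (t + 1)\<rfloor> - int (CHAR('k) ^ m)) \<notin> S)})
      / real (CHAR('k) ^ m) ^ CARD('n)) \<longlonglongrightarrow> measure lebesgue (HK_region t)"
    by (rule card_HK_tendsto[OF t _ lim]) (use p2 in simp)
  then show ?thesis
    unfolding HKd_def Let_def by (simp only: length_frobenius_quotient[OF p refl fin] limI)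
qed

end

lemma toric_pair_lattice_polytope:
  assumes "toric_pair TYPE('k::alg_closed_field) \<Delta> a"
  shows "lattice_polytope \<Delta> a"
  using assms toric_pair_support_attained[OF assms] toric_pair_generates_lattice[OF assms]
  by (simp add: lattice_polytope_def toric_pair_def)

theorem proposition1p2:
  fixes \<Delta> :: "(real ^ 'n::finite) set set" and a :: "int ^ 'n \<Rightarrow> int"
  assumes "CHAR('k::alg_closed_field) > 0"
    and "toric_pair TYPE('k) \<Delta> a"
  shows "\<exists>\<phi> :: nat \<Rightarrow> real \<Rightarrow> real.
    (\<forall>k\<ge>1.
      (\<forall>v. \<forall>t\<ge>0. \<phi> k t = cell_volume \<Delta> (multiple k a) v t) \<and>
      \<phi> k ` {0..} \<subseteq> {0..1} \<and>
      continuous_on {0..} (\<phi> k) \<and>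
      compact (closure {t \<in> {0..}. \<phi> k t \<noteq> 0})) \<and>
    (\<exists>C. \<forall>k\<ge>1. \<forall>t\<ge>0.
      \<bar>HKd TYPE('k) \<Delta> (multiple k a) (t + 1)
        - e0 TYPE('k) \<Delta> a * real k ^ CARD('n) / fact (CARD('n)) * \<phi> k t\<bar>
      \<le> C * real k ^ (CARD('n) - 1))"
proof -
  interpret lattice_polytope \<Delta> a using assms(2) by (rule toric_pair_lattice_polytope)
  define \<phi> where "\<phi> k t = gap_volume (real k * t)" for k :: nat and t
  obtain c0 where c0: "\<And>s. s \<ge> c0 \<Longrightarrow> gap_volume s = 0" using gap_volume_eventually_zero by blast
  \<comment> \<open>One threshold for all \<open>k\<close>, past which both the region and the gap
    volume are gone; below it the estimate is uniform in \<open>s\<close>.\<close>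
  define c where "c = max c0 (real (card L))"
  obtain K where K: "\<And>k s. k \<ge> 1 \<Longrightarrow> 0 \<le> s \<Longrightarrow> s \<le> c \<Longrightarrow>
    \<bar>measure lebesgue (scaled_region k s) - measure lebesgue P * real k ^ CARD('n) * gap_volume s\<bar>
      \<le> K * real k ^ (CARD('n) - 1)"
    using scaled_region_estimate[of c] by blast
  have "continuous_on {0..} (\<phi> k)" for k
    unfolding \<phi>_def
    by (rule continuous_on_compose2[OF continuous_gap_volume]) (auto intro!: continuous_intros)
  moreover have "compact (closure {t \<in> {0..}. \<phi> k t \<noteq> 0})" if k: "k \<ge> 1" for k
  proof -
    \<comment> \<open>Since \<open>k \<ge> 1\<close> gives \<open>t \<le> k t\<close>, the threshold
      for \<open>s\<close> also bounds the support in \<open>t\<close>.\<close>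
    have "\<bar>t\<bar> \<le> \<bar>c0\<bar>" if "t \<ge> 0" "\<phi> k t \<noteq> 0" for t
    proof -
      have "\<not> c0 \<le> real k * t" using that(2) c0 by (auto simp: \<phi>_def)
      moreover have "t \<le> real k * t" using k that(1) mult_right_mono[of 1 "real k" t] by simp
      ultimately show ?thesis using that(1) by simp
    qed
    then have "bounded {t \<in> {0..}. \<phi> k t \<noteq> 0}" by (intro boundedI[of _ "\<bar>c0\<bar>"]) auto
    then show ?thesis by (simp add: compact_closure)
  qed
  moreover have "\<phi> k t = cell_volume \<Delta> (multiple k a) v t" if "k \<ge> 1" for k v t
    by (simp add: \<phi>_def cell_volume_multiple[OF that])
  moreover have "\<phi> k ` {0..} \<subseteq> {0..1}" for k using gap_volume_range by (auto simp: \<phi>_def)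
  moreover have "\<bar>HKd TYPE('k) \<Delta> (multiple k a) (t + 1)
        - e0 TYPE('k) \<Delta> a * real k ^ CARD('n) / fact (CARD('n)) * \<phi> k t\<bar>
      \<le> max K 0 * real k ^ (CARD('n) - 1)" if k: "k \<ge> 1" and t: "t \<ge> 0" for k t
  proof -
    have HKd: "HKd TYPE('k) \<Delta> (multiple k a) (t + 1) = measure lebesgue (scaled_region k (real k * t))"
      using lattice_polytope.HKd_eq[OF multiple[OF k] assms(1) t] HK_region_multiple[OF k] by simp
    have e0: "e0 TYPE('k) \<Delta> a * real k ^ CARD('n) / fact (CARD('n)) = measure lebesgue P * real k ^ CARD('n)"
      by (simp add: e0_eq)
    show ?thesis
    proof (cases "real k * t \<le> c")
      case True
      have "K * real k ^ (CARD('n) - 1) \<le> max K 0 * real k ^ (CARD('n) - 1)"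
        by (intro mult_right_mono) auto
      with K[OF k _ True] t show ?thesis unfolding HKd e0 \<phi>_def by fastforce
    next
      case False
      \<comment> \<open>Here the left-hand side is zero and no estimate with \<open>K\<close> is at
        hand; \<open>max K 0\<close> keeps the right-hand side nonnegative.\<close>
      then have "scaled_region k (real k * t) = {}" "gap_volume (real k * t) = 0"
        using scaled_region_empty[of "real k * t" k] c0[of "real k * t"] by (auto simp: c_def)
      then show ?thesis unfolding HKd \<phi>_def by simp
    qed
  qed
  ultimately show ?thesis by blast
qed

end
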